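(* There exist a reflected diffusion, an open continuation set $\mathcal C$ (with stopping set $\mathcal D$ its complement in the state space), and a non-negative bounded function $f$ such that $R_r^{\mathcal C}f(x)<R_r^{\mathrm R}(f\mathbf 1_{\mathcal C})(x)$ for every $x\in\mathcal C$. Concretely, let $r>0$, $b>0$, let $X$ be reflected Brownian motion on $[0,\infty)$ (generator $\frac12\partial_{xx}$ with Neumann condition at $0$), let $\mathcal C=[0,b)$, $\mathcal D=[b,\infty)$, and $f=\mathbf 1_{[0,b)}$. With $\theta:=\sqrt{2r}$, for every $x\in[0,b)$, $$R_r^{\mathrm R}(f\mathbf 1_{\mathcal C})(x)-R_r^{\mathcal C}f(x)=\frac{\cosh(\theta x)}{r}\cdot\frac{1-e^{-2\theta b}}{2\cosh(\theta b)}>0.$$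
   Context: For a reflected diffusion $X$ and a closed set $\mathcal D$ let $\tau_{\mathcal D}=\inf\{t\ge 0:X_t\in\mathcal D\}$. The killed resolvent of a bounded Borel function $f$ is $R_r^{\mathcal C}f(x)=\mathbb E_x[\int_0^{\tau_{\mathcal D}}e^{-rs}f(X_s)\,ds]$, and the unrestricted reflected resolvent is $R_r^{\mathrm R}f(x)=\mathbb E_x[\int_0^\infty e^{-rs}f(X_s)\,ds]$. "Open" is relative to the state space. *)

theory Defs
  imports "HOL-Probability.Probability"
begin

section \<open>Martingales in continuous time\<close>

definition natural_filtration :: "'w set \<Rightarrow> (real \<Rightarrow> 'w \<Rightarrow> real) \<Rightarrow> real \<Rightarrow> 'w measure" where
  "natural_filtration \<Omega> X t = sigma \<Omega> (\<Union>s\<in>{0..t}. {X s -` A \<inter> \<Omega> | A. A \<in> sets borel})"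

definition martingale ::
    "'w measure \<Rightarrow> (real \<Rightarrow> 'w measure) \<Rightarrow> (real \<Rightarrow> 'w \<Rightarrow> real) \<Rightarrow> bool" where
  "martingale M F Z \<longleftrightarrow>
     (\<forall>t\<ge>0. Z t \<in> borel_measurable (F t) \<and> integrable M (Z t)) \<and>
     (\<forall>s\<ge>0. \<forall>t\<ge>s. AE \<omega> in M. real_cond_exp M (F s) (Z t) \<omega> = Z s \<omega>)"

section \<open>Reflected diffusions\<close>

text \<open>
  Twice continuously differentiable functions \<open>f\<close> with compact support in \<open>S\<close> that satisfy the
  Neumann condition at the boundary points of \<open>S\<close>; \<open>f'\<close> and \<open>f''\<close> are the derivatives
  (one-sided at the boundary). For closed \<open>S\<close>, boundedness of the set where \<open>f\<close> does not vanish
  is compactness of the support; the support may contain boundary points.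
\<close>

definition neumann_test_function ::
    "real set \<Rightarrow> (real \<Rightarrow> real) \<Rightarrow> (real \<Rightarrow> real) \<Rightarrow> (real \<Rightarrow> real) \<Rightarrow> bool" where
  "neumann_test_function S f f' f'' \<longleftrightarrow>
     (\<forall>y\<in>S. (f has_real_derivative f' y) (at y within S)) \<and>
     (\<forall>y\<in>S. (f' has_real_derivative f'' y) (at y within S)) \<and>
     continuous_on S f'' \<and>
     bounded {y\<in>S. f y \<noteq> 0} \<and>
     (\<forall>y\<in>frontier S. f' y = 0)"

text \<open>
  A one-dimensional diffusion with drift \<open>\<mu>\<close> and dispersion \<open>\<sigma>\<close> on a closed interval \<open>S\<close>, reflected
  at the boundary points of \<open>S\<close>: a Markov process with continuous paths and generator
  \<open>\<sigma>\<^sup>2/2 \<partial>\<^sub>x\<^sub>x + \<mu> \<partial>\<^sub>x\<close> under Neumann conditions, the generator being understood in the sense of the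
  martingale problem of Stroock and Varadhan. The law under which the process starts from \<open>x\<close>
  is \<open>P x\<close>, a probability kernel from \<open>S\<close> to the measurable space underlying \<open>N\<close> (the measure
  of \<open>N\<close> itself is irrelevant). The time parameter is real, but only \<open>X t\<close> with \<open>t \<ge> 0\<close> matters,
  and likewise only \<open>P x\<close> with \<open>x \<in> S\<close>. The interval must have a boundary point, for otherwise
  nothing is reflected.
\<close>

locale reflected_diffusion =
  fixes S :: "real set" and \<mu> \<sigma> :: "real \<Rightarrow> real"
    and N :: "'w measure" and P :: "real \<Rightarrow> 'w measure" and X :: "real \<Rightarrow> 'w \<Rightarrow> real"
  assumes state_space: "is_interval S" "closed S" "interior S \<noteq> {}" "frontier S \<noteq> {}"
    and coefficients: "continuous_on S \<mu>" "continuous_on S \<sigma>" "\<And>y. y \<in> S \<Longrightarrow> 0 < \<sigma> y"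
    and kernel: "P \<in> restrict_space borel S \<rightarrow>\<^sub>M prob_algebra N"
    and measurable_X: "\<And>t. 0 \<le> t \<Longrightarrow> X t \<in> borel_measurable N"
    and X_in_S: "\<And>t \<omega>. 0 \<le> t \<Longrightarrow> \<omega> \<in> space N \<Longrightarrow> X t \<omega> \<in> S"
    and continuous_paths: "\<And>\<omega>. \<omega> \<in> space N \<Longrightarrow> continuous_on {0..} (\<lambda>t. X t \<omega>)"
    and start: "\<And>x. x \<in> S \<Longrightarrow> AE \<omega> in P x. X 0 \<omega> = x"
    and Markov: "\<And>x s t g. x \<in> S \<Longrightarrow> 0 \<le> s \<Longrightarrow> 0 \<le> t \<Longrightarrow>
        g \<in> borel_measurable borel \<Longrightarrow> bounded (range g) \<Longrightarrow>
        AE \<omega> in P x.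
          real_cond_exp (P x) (natural_filtration (space N) X s) (\<lambda>\<omega>'. g (X (s + t) \<omega>')) \<omega>
            = (LINT \<omega>'|P (X s \<omega>). g (X t \<omega>'))"
    and generator: "\<And>x f f' f''. x \<in> S \<Longrightarrow> neumann_test_function S f f' f'' \<Longrightarrow>
        martingale (P x) (natural_filtration (space N) X)
          (\<lambda>t \<omega>. f (X t \<omega>)
             - (LBINT s:{0..t}. (\<sigma> (X s \<omega>))\<^sup>2 / 2 * f'' (X s \<omega>) + \<mu> (X s \<omega>) * f' (X s \<omega>)))"

abbreviation reflected_brownian_motion ::
    "'w measure \<Rightarrow> (real \<Rightarrow> 'w measure) \<Rightarrow> (real \<Rightarrow> 'w \<Rightarrow> real) \<Rightarrow> bool" where
  "reflected_brownian_motion \<equiv> reflected_diffusion {0..} (\<lambda>_. 0) (\<lambda>_. 1)"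

section \<open>Resolvents\<close>

text \<open>The value is \<open>\<infinity>\<close>, the infimum of the empty set, if \<open>D\<close> is never hit.\<close>

definition hitting_time :: "(real \<Rightarrow> 'w \<Rightarrow> real) \<Rightarrow> real set \<Rightarrow> 'w \<Rightarrow> ereal" where
  "hitting_time X D \<omega> = Inf {ereal t | t. 0 \<le> t \<and> X t \<omega> \<in> D}"

definition killed_resolvent ::
    "(real \<Rightarrow> 'w measure) \<Rightarrow> (real \<Rightarrow> 'w \<Rightarrow> real) \<Rightarrow> real \<Rightarrow> real set \<Rightarrow> (real \<Rightarrow> real) \<Rightarrow> real \<Rightarrow> real"
  where
  "killed_resolvent P X r D f x =
     (LINT \<omega>|P x. (LBINT s=0..hitting_time X D \<omega>. exp (- r * s) * f (X s \<omega>)))"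

definition reflected_resolvent ::
    "(real \<Rightarrow> 'w measure) \<Rightarrow> (real \<Rightarrow> 'w \<Rightarrow> real) \<Rightarrow> real \<Rightarrow> (real \<Rightarrow> real) \<Rightarrow> real \<Rightarrow> real" where
  "reflected_resolvent P X r f x =
     (LINT \<omega>|P x. (LBINT s=0..\<infinity>. exp (- r * s) * f (X s \<omega>)))"

end

theory Submission
  imports Defs
begin

text \<open>
  Let \<open>\<mu>\<close> be the law of \<open>X\<close>, started in \<open>x\<close>, at an independent exponential time of rate \<open>r\<close>, so that the
  reflected resolvent of \<open>g\<close> is \<open>1/r\<close> times the \<open>\<mu>\<close>-integral of \<open>g\<close>. The Laplace transform of the
  martingale problem gives \<open>\<integral> (r h - h''/2) d\<mu> = r h(x)\<close> for all bounded \<open>h\<close> with bounded derivatives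
  and \<open>h'(0) = 0\<close>, and explicit \<open>h\<close> yield the distribution function of \<open>\<mu>\<close>.

  The Markov property, extended to the hitting time \<open>\<tau>\<close> of \<open>b\<close> by dyadic approximation from the right,
  shows that the reflected and the killed resolvent of \<open>g\<close> differ by \<open>E\<^sub>x[exp (-r \<tau>)]\<close> times the
  reflected resolvent of \<open>g\<close> at \<open>b\<close>. For the indicator of \<open>[b, \<infinity>)\<close> the killed resolvent vanishes,
  which determines \<open>E\<^sub>x[exp (-r \<tau>)]\<close>; the indicator of \<open>[0, b)\<close> then gives the claim.

  Reflected Brownian motion exists as the law of \<open>|x + W|\<close>. Brownian motion \<open>W\<close> is the projective limit
  of scaled Gaussian random walks along dyadic partitions, made continuous by a fourth moment bound.
\<close>

section \<open>The Markov property and the hitting time\<close>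

text \<open>No Feller property is among the axioms of the diffusion, yet the passage to \<tau> needs
  one: the dyadic times come after \<tau>, where X is only close to b. The explicit distribution
  function, valid for every starting point, supplies this continuity, so it is computed first and
  without hitting times. Two restrictions shape that computation. Test functions have compact
  support, so bounded solutions of the resolvent equation are multiplied by smooth cutoffs.
  Solutions need a continuous second derivative, so the indicator of [0,b] on the right-hand side is
  replaced by exp(-\<kappa> (y - b)^+), and \<kappa> tends to infinity. The exponential time turns
  discounted integrals into expectations, and its lack of memory turns a delay q into the factor
  exp(-r q). Existence must be proved: the first claim asserts it, and the formula alone would be
  compatible with there being no such process. The definition wants one process X under all laws P
  x, so the laws of |x + W| are moved to a space of paths. The Neumann condition acts by making even
  extensions of test functions twice continuously differentiable.\<close>

lemma sets_natural_filtration: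
  "sets (natural_filtration \<Omega> X t) = sigma_sets \<Omega> (\<Union>s\<in>{0..t}. {X s -` A \<inter> \<Omega> | A. A \<in> sets borel})"
  unfolding natural_filtration_def by (rule sets_measure_of) auto

lemma space_natural_filtration [simp]: "space (natural_filtration \<Omega> X t) = \<Omega>"
  unfolding natural_filtration_def by (rule space_measure_of) auto

lemma measurable_natural_filtration:
  assumes "0 \<le> s" "s \<le> t"
  shows "X s \<in> borel_measurable (natural_filtration \<Omega> X t)"
proof (rule measurableI)
  fix A :: "real set" assume "A \<in> sets borel"
  then show "X s -` A \<inter> space (natural_filtration \<Omega> X t) \<in> sets (natural_filtration \<Omega> X t)"
    unfolding sets_natural_filtration space_natural_filtration
    using assms by (intro sigma_sets.Basic UN_I[of s]) auto
qed simp

lemma sets_natural_filtration_subset: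
  assumes "\<And>s. 0 \<le> s \<Longrightarrow> s \<le> t \<Longrightarrow> X s \<in> borel_measurable M" "space M = \<Omega>"
  shows "sets (natural_filtration \<Omega> X t) \<subseteq> sets M"
  unfolding sets_natural_filtration assms(2)[symmetric]
  by (intro sets.sigma_sets_subset) (auto intro!: measurable_sets[OF assms(1)])

text \<open>Time is rounded down to multiples of 1/(n+1), where joint measurability involves only
  countably many fixed times; continuity of paths gives the limit. Times are clamped at 0 because
  nothing is known about negative ones.\<close>

lemma borel_measurable_continuous_process:
  fixes X :: "real \<Rightarrow> 'w \<Rightarrow> real"
  assumes measurable_X: "\<And>t. 0 \<le> t \<Longrightarrow> X t \<in> borel_measurable N"
    and continuous_paths: "\<And>\<omega>. \<omega> \<in> space N \<Longrightarrow> continuous_on {0..} (\<lambda>t. X t \<omega>)"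
  shows "(\<lambda>(t, \<omega>). X (max 0 t) \<omega>) \<in> borel_measurable (borel \<Otimes>\<^sub>M N)"
proof -
  define q where "q n t = real_of_int \<lfloor>real (Suc n) * max 0 t\<rfloor> / real (Suc n)" for n and t :: real
  have "(\<lambda>z. X (q n (fst z)) (snd z)) \<in> borel_measurable (borel \<Otimes>\<^sub>M N)" for n
  proof -
    have *: "(\<lambda>z. X (max 0 (real_of_int i / real (Suc n))) (snd z)) \<in> borel_measurable (borel \<Otimes>\<^sub>M N)" for i :: int
      by (intro measurable_compose[OF measurable_snd] measurable_X) auto
    have "(\<lambda>z. (\<lambda>i z. X (max 0 (real_of_int i / real (Suc n))) (snd z)) (\<lfloor>real (Suc n) * max 0 (fst z)\<rfloor>) z)
        \<in> borel_measurable (borel \<Otimes>\<^sub>M N)"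
      by (rule measurable_compose_countable[OF *]) measurable
    moreover have "max 0 (real_of_int \<lfloor>real (Suc n) * max 0 t\<rfloor> / real (Suc n)) = q n t" for t
      by (auto simp: q_def max_def)
    ultimately show ?thesis by simp
  qed
  moreover have "(\<lambda>n. X (q n (fst z)) (snd z)) \<longlonglongrightarrow> X (max 0 (fst z)) (snd z)" if "z \<in> space (borel \<Otimes>\<^sub>M N)" for z
  proof -
    have "snd z \<in> space N" using that by (auto simp: space_pair_measure)
    then have c: "continuous_on {0..} (\<lambda>t. X t (snd z))" by (rule continuous_paths)
    have "(\<lambda>n. q n (fst z)) \<longlonglongrightarrow> max 0 (fst z)"
    proof (rule tendsto_sandwich)
      show "\<forall>\<^sub>F n in sequentially. max 0 (fst z) - inverse (real (Suc n)) \<le> q n (fst z)"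
      proof (intro always_eventually allI)
        fix n
        have "real (Suc n) * max 0 (fst z) - 1 \<le> real_of_int \<lfloor>real (Suc n) * max 0 (fst z)\<rfloor>" by linarith
        then have "(real (Suc n) * max 0 (fst z) - 1) / real (Suc n) \<le> q n (fst z)"
          unfolding q_def by (intro divide_right_mono) auto
        then show "max 0 (fst z) - inverse (real (Suc n)) \<le> q n (fst z)"
          by (simp add: diff_divide_distrib inverse_eq_divide del: of_nat_Suc)
      qed
      show "\<forall>\<^sub>F n in sequentially. q n (fst z) \<le> max 0 (fst z)"
      proof (intro always_eventually allI)
        fix n
        have "real_of_int \<lfloor>real (Suc n) * max 0 (fst z)\<rfloor> \<le> real (Suc n) * max 0 (fst z)" by linarith
        then have "q n (fst z) \<le> (real (Suc n) * max 0 (fst z)) / real (Suc n)"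
          unfolding q_def by (intro divide_right_mono) auto
        then show "q n (fst z) \<le> max 0 (fst z)" by (simp del: of_nat_Suc)
      qed
      show "(\<lambda>n. max 0 (fst z) - inverse (real (Suc n))) \<longlonglongrightarrow> max 0 (fst z)"
        using tendsto_diff[OF tendsto_const LIMSEQ_inverse_real_of_nat, of "max 0 (fst z)"] by simp
    qed simp
    moreover have "0 \<le> q n (fst z)" for n by (auto simp: q_def)
    ultimately show ?thesis
      using continuous_on_tendsto_compose[OF c, of "\<lambda>n. q n (fst z)" "max 0 (fst z)" sequentially] by auto
  qed
  ultimately have "(\<lambda>z. X (max 0 (fst z)) (snd z)) \<in> borel_measurable (borel \<Otimes>\<^sub>M N)"
    by (rule borel_measurable_LIMSEQ_real[rotated])
  then show ?thesis by (simp add: case_prod_beta)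
qed

context reflected_diffusion
begin

lemma S_borel [measurable]: "S \<in> sets borel"
  using state_space(2) by auto

lemma kernel_prob_space: "x \<in> S \<Longrightarrow> prob_space (P x)"
  and sets_kernel [simp]: "x \<in> S \<Longrightarrow> sets (P x) = sets N"
  using measurable_space[OF kernel, of x] by (auto simp: space_prob_algebra space_restrict_space)

lemma space_kernel [simp]: "x \<in> S \<Longrightarrow> space (P x) = space N"
  using sets_eq_imp_space_eq[OF sets_kernel] .

lemma kernel_subprob [measurable]: "P \<in> restrict_space borel S \<rightarrow>\<^sub>M subprob_algebra N"
  using kernel by (rule measurable_prob_algebraD)

abbreviation "F s \<equiv> natural_filtration (space N) X s"

lemma sets_F_N: "sets (F s) \<subseteq> sets N"
  by (rule sets_natural_filtration_subset) (auto intro: measurable_X)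

lemma subalgebra_F: "x \<in> S \<Longrightarrow> subalgebra (P x) (F s)"
  using sets_F_N by (simp add: subalgebra_def)

lemma sigma_finite_subalgebra_F: "x \<in> S \<Longrightarrow> sigma_finite_subalgebra (P x) (F s)"
proof -
  assume x: "x \<in> S"
  interpret prob_space "P x" using x by (rule kernel_prob_space)
  show ?thesis
  proof (intro finite_measure_subalgebra_is_sigma_finite)
    show "finite_measure_subalgebra (P x) (F s)"
      by unfold_locales (rule subalgebra_F[OF x])
  qed
qed

text \<open>The conditional expectation is integrated over an event of the past. An identity between
  numbers survives a further integration over \<open>t\<close>, where null sets depending on
  \<open>t\<close> would obstruct an almost sure statement.\<close>

lemma Markov_set_integral:
  fixes g :: "real \<Rightarrow> real"
  assumes "x \<in> S" "0 \<le> s" "0 \<le> t" "A \<in> sets (F s)"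
    and [measurable]: "g \<in> borel_measurable borel" and "bounded (range g)"
  shows "(LINT \<omega>:A|P x. g (X (s + t) \<omega>)) = (LINT \<omega>:A|P x. (LINT \<omega>'|P (X s \<omega>). g (X t \<omega>')))"
proof -
  interpret prob_space "P x" using assms by (intro kernel_prob_space)
  interpret sf: sigma_finite_subalgebra "P x" "F s" by (rule sigma_finite_subalgebra_F[OF assms(1)])
  have [measurable]: "X (s + t) \<in> borel_measurable (P x)" "X s \<in> borel_measurable (P x)"
    using measurable_X[of "s + t"] measurable_X[of s] assms by (auto cong: measurable_cong_sets)
  obtain C where C: "\<And>y. norm (g y) \<le> C" using assms(6) by (auto simp: bounded_iff)
  have int: "integrable (P x) (\<lambda>\<omega>. g (X (s + t) \<omega>))"
    by (rule integrable_const_bound[where B = C]) (use C in auto)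
  have "A \<in> sets (P x)" using assms sets_F_N by auto
  have Xs: "X s \<in> N \<rightarrow>\<^sub>M restrict_space borel S"
    using assms(2) X_in_S measurable_X by (intro measurable_restrict_space2) auto
  have [measurable]: "X t \<in> borel_measurable N" using assms by (intro measurable_X)
  have "(\<lambda>\<omega>. LINT \<omega>'|P (X s \<omega>). g (X t \<omega>')) \<in> borel_measurable N"
    by (rule measurable_compose[OF measurable_compose[OF Xs kernel_subprob]])
       (rule integral_measurable_subprob_algebra; measurable)
  then have [measurable]: "(\<lambda>\<omega>. LINT \<omega>'|P (X s \<omega>). g (X t \<omega>')) \<in> borel_measurable (P x)"
    using assms(1) by (simp cong: measurable_cong_sets)
  have "(LINT \<omega>:A|P x. g (X (s + t) \<omega>)) =
      (LINT \<omega>:A|P x. real_cond_exp (P x) (F s) (\<lambda>\<omega>'. g (X (s + t) \<omega>')) \<omega>)"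
    by (rule sf.real_cond_exp_intA[OF int assms(4)])
  also have "\<dots> = (LINT \<omega>:A|P x. (LINT \<omega>'|P (X s \<omega>). g (X t \<omega>')))"
    using \<open>A \<in> sets (P x)\<close> Markov[OF assms(1,2,3,5,6)]
    by (intro set_lebesgue_integral_cong_AE) auto
  finally show ?thesis .
qed

lemma measurable_joint:
  "(\<lambda>(t, \<omega>). X (max 0 t) \<omega>) \<in> borel_measurable (borel \<Otimes>\<^sub>M N)"
  by (rule borel_measurable_continuous_process[OF measurable_X continuous_paths])

end

text \<open>For a non-integrable function the integral is 0 by convention, and the bound at any
  point of the nonempty space gives 0 \<le> C.\<close>

lemma (in prob_space) abs_integral_le_const:
  fixes f :: "'a \<Rightarrow> real"
  assumes "\<And>x. x \<in> space M \<Longrightarrow> \<bar>f x\<bar> \<le> C"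
  shows "\<bar>integral\<^sup>L M f\<bar> \<le> C"
proof (cases "integrable M f")
  case True
  then have "integral\<^sup>L M f \<le> C" "- C \<le> integral\<^sup>L M f"
    using assms by (auto intro!: integral_le_const integral_ge_const AE_I2 simp: abs_le_iff minus_le_iff)
  then show ?thesis by simp
next
  case False
  obtain x where "x \<in> space M" using not_empty by auto
  then show ?thesis using False assms[of x] by (simp add: not_integrable_integral_eq)
qed

text \<open>Pushing each \<open>K x\<close> forward along \<open>f x\<close> moves the dependence of
  the integrand on \<open>x\<close> into the kernel; what remains is the identity integrated against
  a measurable kernel on the reals.\<close>

lemma borel_measurable_kernel_integral:
  fixes f :: "'a \<Rightarrow> 'b \<Rightarrow> real"
  assumes K: "K \<in> L \<rightarrow>\<^sub>M subprob_algebra N" and f: "case_prod f \<in> borel_measurable (L \<Otimes>\<^sub>M N)"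
  shows "(\<lambda>x. LINT y|K x. f x y) \<in> borel_measurable L"
proof -
  have "(\<lambda>x. integral\<^sup>L (distr (K x) borel (f x)) (\<lambda>y. y)) \<in> borel_measurable L"
    by (rule measurable_compose[OF measurable_distr2[OF f K] integral_measurable_subprob_algebra]) simp
  moreover have "integral\<^sup>L (distr (K x) borel (f x)) (\<lambda>y. y) = (LINT y|K x. f x y)" if "x \<in> space L" for x
    using measurable_Pair2[OF f that] subprob_measurableD(3)[OF K that]
    by (subst integral_distr) auto
  ultimately show ?thesis by (simp cong: measurable_cong)
qed

section \<open>Exponential times\<close>

abbreviation exponential_law :: "real \<Rightarrow> real measure" where
  "exponential_law r \<equiv> density lborel (\<lambda>s. ennreal (exponential_density r s))"

text \<open>Turns a discounted integral up to a possibly infinite time into an expectation under a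
  probability measure, where bounded integrands are integrable at once.\<close>

lemma interval_integral_exponential_law:
  fixes h :: "real \<Rightarrow> real" and T :: ereal
  assumes "r > 0" "0 \<le> T" and [measurable]: "h \<in> borel_measurable borel"
  shows "(LBINT s=0..T. exp (- r * s) * h s) = (1 / r) * (LINT s|exponential_law r. indicator {s. ereal s < T} s * h s)"
proof -
  have *[measurable]: "{s. ereal s < T} \<in> sets borel" by measurable
  have "(LINT s|exponential_law r. indicator {s. ereal s < T} s * h s) =
      (LINT s|lborel. exponential_density r s * (indicator {s. ereal s < T} s * h s))"
    using assms by (subst integral_real_density) (auto simp: exponential_density_nonneg)
  also have "\<dots> = (LINT s|lborel. r * (indicator (einterval 0 T) s * (exp (- r * s) * h s)))"
  proof (rule integral_cong_AE)
    show "AE s in lborel. exponential_density r s * (indicator {s. ereal s < T} s * h s) =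
        r * (indicator (einterval 0 T) s * (exp (- r * s) * h s))"
      \<comment> \<open>\<open>einterval 0 T\<close> is open at 0, while the exponential density is
        positive there.\<close>
      using AE_lborel_singleton[of 0]
      by eventually_elim (auto simp: exponential_density_def einterval_def indicator_def zero_ereal_def mult_ac)
  qed measurable
  finally show ?thesis
    using assms by (simp add: interval_lebesgue_integral_def set_lebesgue_integral_def)
qed

text \<open>The translation s = q + u turns the density at s into exp(-r q) times the density at u;
  the integrands differ only at u = 0.\<close>

lemma exponential_law_memoryless:
  fixes h :: "real \<Rightarrow> real"
  assumes "r > 0" "0 \<le> q" and [measurable]: "h \<in> borel_measurable borel"
  shows "(LINT s|exponential_law r. indicator {q<..} s * h s) = exp (- r * q) * (LINT u|exponential_law r. h (q + u))"
proof -
  have "(LINT s|exponential_law r. indicator {q<..} s * h s) =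
      (LINT s|lborel. exponential_density r s * (indicator {q<..} s * h s))"
    using assms by (subst integral_real_density) (auto simp: exponential_density_nonneg)
  also have "\<dots> = (LINT u|lborel. exponential_density r (q + u) * (indicator {q<..} (q + u) * h (q + u)))"
    using lborel_integral_real_affine[of 1 "\<lambda>s. exponential_density r s * (indicator {q<..} s * h s)" q] by simp
  also have "\<dots> = (LINT u|lborel. exp (- r * q) * (exponential_density r u * h (q + u)))"
  proof (rule integral_cong_AE)
    show "AE u in lborel. exponential_density r (q + u) * (indicator {q<..} (q + u) * h (q + u)) =
        exp (- r * q) * (exponential_density r u * h (q + u))"
    proof (rule AE_mp[OF AE_lborel_singleton[of 0]], rule AE_I2, rule impI)
      fix u :: real assume "u \<noteq> 0"
      then show "exponential_density r (q + u) * (indicator {q<..} (q + u) * h (q + u)) =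
        exp (- r * q) * (exponential_density r u * h (q + u))"
        using \<open>0 \<le> q\<close> by (auto simp: exponential_density_def indicator_def exp_add[symmetric] algebra_simps)
    qed
  qed measurable
  also have "\<dots> = exp (- r * q) * (LINT u|exponential_law r. h (q + u))"
    using assms by (subst integral_real_density) (auto simp: exponential_density_nonneg)
  finally show ?thesis .
qed

section \<open>The resolvent as a law at an exponential time, and its Markov property\<close>

context reflected_diffusion
begin

definition resolvent_law :: "real \<Rightarrow> real \<Rightarrow> real measure" where
  "resolvent_law r x = distr (exponential_law r \<Otimes>\<^sub>M P x) borel (\<lambda>(t, \<omega>). X (max 0 t) \<omega>)"

lemma measurable_joint_kernel [measurable]:
  assumes "x \<in> S"
  shows "(\<lambda>(t, \<omega>). X (max 0 t) \<omega>) \<in> borel_measurable (exponential_law r \<Otimes>\<^sub>M P x)"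
proof -
  have "sets (exponential_law r \<Otimes>\<^sub>M P x) = sets (borel \<Otimes>\<^sub>M N)"
    using assms by (intro sets_pair_measure_cong) auto
  then show ?thesis using measurable_joint by (simp cong: measurable_cong_sets)
qed

lemma prob_space_resolvent_law: "r > 0 \<Longrightarrow> x \<in> S \<Longrightarrow> prob_space (resolvent_law r x)"
proof -
  assume r: "r > 0" and x: "x \<in> S"
  interpret E: prob_space "exponential_law r" using r by (rule prob_space_exponential_density)
  interpret Px: prob_space "P x" using x by (rule kernel_prob_space)
  interpret pair_prob_space "exponential_law r" "P x" ..
  show ?thesis unfolding resolvent_law_def
    using x by (intro prob_space_distr) measurable
qed

lemma sets_resolvent_law [simp, measurable_cong]: "sets (resolvent_law r x) = sets borel"
  by (simp add: resolvent_law_def)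

text \<open>Fubini in both orders. With the path outermost, the inner integral is the discounted
  time integral of \<open>reflected_resolvent\<close>; with the time outermost, facts about
  \<open>X\<close> at a fixed time become applicable.\<close>

lemma
  fixes g :: "real \<Rightarrow> real"
  assumes "r > 0" "x \<in> S" and [measurable]: "g \<in> borel_measurable borel" and "bounded (range g)"
  shows resolvent_law_time_first:
      "(LINT y|resolvent_law r x. g y) = (LINT \<omega>|P x. LINT t|exponential_law r. g (X (max 0 t) \<omega>))"
    and resolvent_law_space_first:
      "(LINT y|resolvent_law r x. g y) = (LINT t|exponential_law r. LINT \<omega>|P x. g (X (max 0 t) \<omega>))"
proof -
  interpret E: prob_space "exponential_law r" using assms by (intro prob_space_exponential_density)
  interpret Px: prob_space "P x" using assms by (intro kernel_prob_space)
  interpret pair_prob_space "exponential_law r" "P x" ..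
  obtain C where C: "\<And>y. norm (g y) \<le> C" using assms(4) by (auto simp: bounded_iff)
  note measurable_joint_kernel[OF assms(2), measurable]
  have *: "(LINT y|resolvent_law r x. g y) = (LINT z|(exponential_law r \<Otimes>\<^sub>M P x). g (case z of (t, \<omega>) \<Rightarrow> X (max 0 t) \<omega>))"
    unfolding resolvent_law_def by (subst integral_distr) measurable
  have int: "integrable (exponential_law r \<Otimes>\<^sub>M P x) (\<lambda>z. g (case z of (t, \<omega>) \<Rightarrow> X (max 0 t) \<omega>))"
    by (rule integrable_const_bound[where B = C]) (use C in auto)
  show "(LINT y|resolvent_law r x. g y) = (LINT \<omega>|P x. LINT t|exponential_law r. g (X (max 0 t) \<omega>))"
    using integral_snd[of "\<lambda>t \<omega>. g (X (max 0 t) \<omega>)"] int * by (simp add: case_prod_unfold)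
  show "(LINT y|resolvent_law r x. g y) = (LINT t|exponential_law r. LINT \<omega>|P x. g (X (max 0 t) \<omega>))"
    using integral_fst'[OF int] * by simp
qed

lemma measurable_path:
  assumes "\<omega> \<in> space N" shows "(\<lambda>t. X (max 0 t) \<omega>) \<in> borel_measurable borel"
  using measurable_compose[OF measurable_Pair2'[OF assms] measurable_joint] by simp

lemma reflected_resolvent_eq:
  fixes g :: "real \<Rightarrow> real"
  assumes "r > 0" "x \<in> S" and [measurable]: "g \<in> borel_measurable borel" and "bounded (range g)"
  shows "reflected_resolvent P X r g x = (1 / r) * (LINT y|resolvent_law r x. g y)"
proof -
  have "(LBINT s=0..\<infinity>. exp (- r * s) * g (X s \<omega>)) = (1 / r) * (LINT t|exponential_law r. g (X (max 0 t) \<omega>))"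
    if "\<omega> \<in> space (P x)" for \<omega>
  proof -
    have [measurable]: "(\<lambda>t. X (max 0 t) \<omega>) \<in> borel_measurable borel"
      using that assms(2) by (intro measurable_path) simp
    have "(LBINT s=0..\<infinity>. exp (- r * s) * g (X s \<omega>)) = (LBINT s=0..\<infinity>. exp (- r * s) * g (X (max 0 s) \<omega>))"
      by (intro interval_integral_cong) (auto simp: einterval_def max_def)
    also have "\<dots> = (1 / r) * (LINT t|exponential_law r. g (X (max 0 t) \<omega>))"
      using assms(1) by (subst interval_integral_exponential_law) auto
    finally show ?thesis .
  qed
  then have "reflected_resolvent P X r g x = (LINT \<omega>|P x. (1 / r) * (LINT t|exponential_law r. g (X (max 0 t) \<omega>)))"
    unfolding reflected_resolvent_def by (intro Bochner_Integration.integral_cong) auto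
  then show ?thesis
    using resolvent_law_time_first[OF assms] by simp
qed

text \<open>Memorylessness shifts the time integral by \<open>q\<close>, Fubini isolates a fixed lag
  \<open>u\<close>, the Markov property is used at that lag, and a second Fubini reassembles the
  resolvent started afresh at \<open>X q\<close>.\<close>

lemma Markov_resolvent:
  fixes g :: "real \<Rightarrow> real"
  assumes "r > 0" "x \<in> S" "0 \<le> q" "A \<in> sets (F q)"
    and [measurable]: "g \<in> borel_measurable borel" and "bounded (range g)"
  shows "(LINT \<omega>:A|P x. LINT s|exponential_law r. indicator {q<..} s * g (X (max 0 s) \<omega>)) =
    (LINT \<omega>:A|P x. exp (- r * q) * (LINT y|resolvent_law r (X q \<omega>). g y))"
proof -
  interpret E: prob_space "exponential_law r" using assms by (intro prob_space_exponential_density)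
  interpret Px: prob_space "P x" using assms by (intro kernel_prob_space)
  interpret pair_prob_space "exponential_law r" "P x" ..
  obtain C where C: "\<And>y. norm (g y) \<le> C" using assms(6) by (auto simp: bounded_iff)
  have C0: "0 \<le> C" using norm_ge_zero[of "g 0"] C[of 0] by linarith
  have sets_eq: "sets (exponential_law r \<Otimes>\<^sub>M P x) = sets (borel \<Otimes>\<^sub>M N)"
    using assms by (intro sets_pair_measure_cong) auto
  have A[measurable]: "A \<in> sets (P x)" using assms sets_F_N by auto
  have q': "(\<lambda>(u, \<omega>). X (max 0 (q + u)) \<omega>) \<in> borel_measurable (borel \<Otimes>\<^sub>M N)"
  proof -
    have "(\<lambda>z. (q + fst z, snd z)) \<in> (borel \<Otimes>\<^sub>M N) \<rightarrow>\<^sub>M (borel \<Otimes>\<^sub>M N)" by measurable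
    from measurable_compose[OF this measurable_joint] show ?thesis by (simp add: case_prod_beta)
  qed
  have Xq: "X q \<in> N \<rightarrow>\<^sub>M restrict_space borel S"
    using assms(3) X_in_S measurable_X by (intro measurable_restrict_space2) auto
  have K: "(\<lambda>z. P (X q (snd z))) \<in> (borel \<Otimes>\<^sub>M N) \<rightarrow>\<^sub>M subprob_algebra N"
    by (rule measurable_compose[OF _ kernel_subprob]) (rule measurable_compose[OF measurable_snd Xq])
  \<comment> \<open>Fubini needs this expectation measurable jointly in the lag and the path. The
    lag sits in the integrand and the path in the kernel, hence the lemma on kernels with a
    parameter.\<close>
  have "(\<lambda>z. LINT \<omega>'|P (X q (snd z)). g (X (max 0 (fst z)) \<omega>')) \<in> borel_measurable (borel \<Otimes>\<^sub>M N)"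
  proof (rule borel_measurable_kernel_integral[OF K])
    have "(\<lambda>z. (fst (fst z), snd z)) \<in> (borel \<Otimes>\<^sub>M N) \<Otimes>\<^sub>M N \<rightarrow>\<^sub>M borel \<Otimes>\<^sub>M N" by measurable
    from measurable_compose[OF this measurable_compose[OF measurable_joint \<open>g \<in> borel_measurable borel\<close>]]
    show "(\<lambda>(z, \<omega>'). g (X (max 0 (fst z)) \<omega>')) \<in> borel_measurable ((borel \<Otimes>\<^sub>M N) \<Otimes>\<^sub>M N)"
      by (simp add: case_prod_beta)
  qed
  then have m1[measurable]: "(\<lambda>z. LINT \<omega>'|P (X q (snd z)). g (X (max 0 (fst z)) \<omega>')) \<in> borel_measurable (exponential_law r \<Otimes>\<^sub>M P x)"
    using sets_eq by (simp cong: measurable_cong_sets)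
  have m2[measurable]: "(\<lambda>(u, \<omega>). X (max 0 (q + u)) \<omega>) \<in> borel_measurable (exponential_law r \<Otimes>\<^sub>M P x)"
    using q' sets_eq by (simp cong: measurable_cong_sets)
  have bK: "norm (LINT \<omega>'|P y. g (X (max 0 u) \<omega>')) \<le> C" if "y \<in> S" for y u
  proof -
    interpret Py: prob_space "P y" using that by (rule kernel_prob_space)
    show ?thesis using C by (auto intro: Py.abs_integral_le_const)
  qed
  have "(LINT \<omega>:A|P x. LINT s|exponential_law r. indicator {q<..} s * g (X (max 0 s) \<omega>)) =
      (LINT \<omega>|P x. LINT u|exponential_law r. exp (- r * q) * (indicator A \<omega> * g (X (max 0 (q + u)) \<omega>)))"
    unfolding set_lebesgue_integral_def
  proof (intro Bochner_Integration.integral_cong refl)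
    fix \<omega> assume "\<omega> \<in> space (P x)"
    then have [measurable]: "(\<lambda>t. X (max 0 t) \<omega>) \<in> borel_measurable borel"
      using assms(2) by (intro measurable_path) simp
    show "indicator A \<omega> *\<^sub>R (LINT s|exponential_law r. indicator {q<..} s * g (X (max 0 s) \<omega>)) =
      (LINT u|exponential_law r. exp (- r * q) * (indicator A \<omega> * g (X (max 0 (q + u)) \<omega>)))"
      using exponential_law_memoryless[OF assms(1,3), of "\<lambda>s. g (X (max 0 s) \<omega>)"] by simp
  qed
  also have "\<dots> = (LINT u|exponential_law r. LINT \<omega>|P x. exp (- r * q) * (indicator A \<omega> * g (X (max 0 (q + u)) \<omega>)))"
  proof (rule Fubini_integral)
    show "integrable (exponential_law r \<Otimes>\<^sub>M P x) (\<lambda>(u, \<omega>). exp (- r * q) * (indicator A \<omega> * g (X (max 0 (q + u)) \<omega>)))"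
    proof (rule integrable_const_bound[where B = "exp (- r * q) * C"])
      show "(\<lambda>(u, \<omega>). exp (- r * q) * (indicator A \<omega> * g (X (max 0 (q + u)) \<omega>))) \<in> borel_measurable (exponential_law r \<Otimes>\<^sub>M P x)"
        using measurable_compose[OF m2 \<open>g \<in> borel_measurable borel\<close>] by (simp add: case_prod_beta)
    qed (use C C0 in \<open>auto simp: indicator_def abs_mult intro!: AE_I2\<close>)
  qed
  also have "\<dots> = (LINT u|exponential_law r. LINT \<omega>|P x. exp (- r * q) * (indicator A \<omega> * (LINT \<omega>'|P (X q \<omega>). g (X (max 0 u) \<omega>'))))"
  proof (rule integral_cong_AE)
    show "AE u in exponential_law r. (LINT \<omega>|P x. exp (- r * q) * (indicator A \<omega> * g (X (max 0 (q + u)) \<omega>))) =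
      (LINT \<omega>|P x. exp (- r * q) * (indicator A \<omega> * (LINT \<omega>'|P (X q \<omega>). g (X (max 0 u) \<omega>'))))"
    proof -
      \<comment> \<open>The Markov property is available for nonnegative lags, which carry all the
        exponential mass.\<close>
      have "AE u in exponential_law r. 0 \<le> u"
        by (auto simp: AE_density exponential_density_def intro!: AE_I2)
      then show ?thesis
      proof eventually_elim
        case (elim u)
        then show ?case
          using Markov_set_integral[OF assms(2,3) elim assms(4,5,6)] \<open>0 \<le> q\<close>
          by (simp add: set_lebesgue_integral_def)
      qed
    qed
    show "(\<lambda>u. LINT \<omega>|P x. exp (- r * q) * (indicator A \<omega> * g (X (max 0 (q + u)) \<omega>))) \<in> borel_measurable (exponential_law r)"
      using measurable_compose[OF m2 \<open>g \<in> borel_measurable borel\<close>]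
      by (intro Px.borel_measurable_lebesgue_integral) (simp add: case_prod_beta)
    show "(\<lambda>u. LINT \<omega>|P x. exp (- r * q) * (indicator A \<omega> * (LINT \<omega>'|P (X q \<omega>). g (X (max 0 u) \<omega>')))) \<in> borel_measurable (exponential_law r)"
      using m1 by (intro Px.borel_measurable_lebesgue_integral) (simp add: case_prod_beta)
  qed
  also have "\<dots> = (LINT \<omega>|P x. LINT u|exponential_law r. exp (- r * q) * (indicator A \<omega> * (LINT \<omega>'|P (X q \<omega>). g (X (max 0 u) \<omega>'))))"
  proof (rule Fubini_integral[symmetric])
    show "integrable (exponential_law r \<Otimes>\<^sub>M P x) (\<lambda>(u, \<omega>). exp (- r * q) * (indicator A \<omega> * (LINT \<omega>'|P (X q \<omega>). g (X (max 0 u) \<omega>'))))"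
    proof (rule integrable_const_bound[where B = "exp (- r * q) * C"])
      show "(\<lambda>(u, \<omega>). exp (- r * q) * (indicator A \<omega> * (LINT \<omega>'|P (X q \<omega>). g (X (max 0 u) \<omega>')))) \<in> borel_measurable (exponential_law r \<Otimes>\<^sub>M P x)"
        using m1 by (simp add: case_prod_beta)
      show "AE z in exponential_law r \<Otimes>\<^sub>M P x. norm (case z of (u, \<omega>) \<Rightarrow> exp (- r * q) * (indicator A \<omega> * (LINT \<omega>'|P (X q \<omega>). g (X (max 0 u) \<omega>')))) \<le> exp (- r * q) * C"
      proof (rule AE_I2)
        fix z assume "z \<in> space (exponential_law r \<Otimes>\<^sub>M P x)"
        then have "X q (snd z) \<in> S" using assms by (auto simp: space_pair_measure X_in_S)
        from bK[OF this] C0 show "norm (case z of (u, \<omega>) \<Rightarrow> exp (- r * q) * (indicator A \<omega> * (LINT \<omega>'|P (X q \<omega>). g (X (max 0 u) \<omega>')))) \<le> exp (- r * q) * C"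
          by (auto simp: indicator_def abs_mult split: prod.splits)
      qed
    qed
  qed
  also have "\<dots> = (LINT \<omega>:A|P x. exp (- r * q) * (LINT y|resolvent_law r (X q \<omega>). g y))"
    unfolding set_lebesgue_integral_def
  proof (intro Bochner_Integration.integral_cong refl)
    fix \<omega> assume "\<omega> \<in> space (P x)"
    then have "X q \<omega> \<in> S" using assms by (auto simp: X_in_S)
    from resolvent_law_space_first[OF assms(1) this assms(5,6)]
    show "(LINT u|exponential_law r. exp (- r * q) * (indicator A \<omega> * (LINT \<omega>'|P (X q \<omega>). g (X (max 0 u) \<omega>')))) =
      indicator A \<omega> *\<^sub>R (exp (- r * q) * (LINT y|resolvent_law r (X q \<omega>). g y))"
      by simp
  qed
  finally show ?thesis .
qed

section \<open>Hitting times\<close>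

lemma hitting_time_nonneg: "0 \<le> hitting_time X D \<omega>"
  unfolding hitting_time_def by (rule Inf_greatest) auto

text \<open>Closedness of \<open>D\<close> and continuity of paths make a finite infimum a minimum.
  The event therefore depends on the path up to time \<open>t\<close> alone, without looking
  infinitesimally ahead.\<close>

lemma hitting_time_le_iff:
  assumes \<omega>: "\<omega> \<in> space N" and D: "closed D"
  shows "hitting_time X D \<omega> \<le> ereal t \<longleftrightarrow> (\<exists>u\<in>{0..t}. X u \<omega> \<in> D)"
proof
  assume le: "hitting_time X D \<omega> \<le> ereal t"
  then have t: "0 \<le> t" using hitting_time_nonneg[of D \<omega>] by (metis ereal_less_eq(5) order_trans)
  \<comment> \<open>The margin 1 matters: an infimum at most \<open>t\<close> yields a hit before
    \<open>t + 1\<close>, not at once one by time \<open>t\<close>. Compactness of \<open>K\<close>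
    then provides the earliest hit.\<close>
  define K where "K = {u\<in>{0..t + 1}. X u \<omega> \<in> D}"
  have "continuous_on {0..t + 1} (\<lambda>u. X u \<omega>)"
    by (rule continuous_on_subset[OF continuous_paths[OF \<omega>]]) auto
  then have "closed ({0..t + 1} \<inter> (\<lambda>u. X u \<omega>) -` D)"
    using D by (intro continuous_closed_preimage) auto
  moreover have "{0..t + 1} \<inter> (\<lambda>u. X u \<omega>) -` D = K" by (auto simp: K_def)
  ultimately have "closed K" by simp
  moreover have "bounded K" by (rule bounded_subset[of "{0..t + 1}"]) (auto simp: K_def)
  ultimately have "compact K" by (simp add: compact_eq_bounded_closed)
  have "\<exists>u\<ge>0. ereal u < ereal (t + 1) \<and> X u \<omega> \<in> D"
  proof (rule ccontr)
    assume "\<not> ?thesis"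
    then have "ereal (t + 1) \<le> hitting_time X D \<omega>"
      unfolding hitting_time_def by (intro Inf_greatest) (auto simp: not_less)
    from order_trans[OF this le] show False by simp
  qed
  then have "K \<noteq> {}" by (auto simp: K_def intro: less_imp_le)
  then obtain m where m: "m \<in> K" "\<And>u. u \<in> K \<Longrightarrow> m \<le> u"
    using compact_attains_inf[OF \<open>compact K\<close>] by blast
  have "ereal m \<le> hitting_time X D \<omega>"
    unfolding hitting_time_def
  proof (rule Inf_greatest)
    fix z assume "z \<in> {ereal t |t. 0 \<le> t \<and> X t \<omega> \<in> D}"
    then obtain u where u: "z = ereal u" "0 \<le> u" "X u \<omega> \<in> D" by auto
    show "ereal m \<le> z"
    proof (cases "u \<le> t + 1")
      case True then show ?thesis using u m(2)[of u] by (auto simp: K_def)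
    next
      case False
      have "m \<le> t + 1" using m(1) by (auto simp: K_def)
      with False u show ?thesis by simp
    qed
  qed
  with le have "ereal m \<le> ereal t" by (rule order_trans[rotated])
  then have "m \<le> t" by simp
  with m(1) show "\<exists>u\<in>{0..t}. X u \<omega> \<in> D" by (auto simp: K_def)
next
  assume "\<exists>u\<in>{0..t}. X u \<omega> \<in> D"
  then obtain u where u: "0 \<le> u" "u \<le> t" "X u \<omega> \<in> D" by auto
  then have "hitting_time X D \<omega> \<le> ereal u"
    unfolding hitting_time_def by (intro Inf_lower) auto
  also have "ereal u \<le> ereal t" using u by simp
  finally show "hitting_time X D \<omega> \<le> ereal t" .
qed

text \<open>A continuous path starting below \<open>b\<close> enters the half-line through its
  endpoint: the intermediate value theorem gives a time with value \<open>b\<close>, and all values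
  before the hitting time are below \<open>b\<close>.\<close>

lemma hitting_time_level:
  assumes \<omega>: "\<omega> \<in> space N" and start: "X 0 \<omega> < b" and T: "hitting_time X {b..} \<omega> = ereal t"
  shows "0 < t" "X t \<omega> = b"
proof -
  have t0: "0 \<le> t" using hitting_time_nonneg[of "{b..}" \<omega>] T by simp
  have nb: "X u \<omega> < b" if "0 \<le> u" "u < t" for u
    using hitting_time_le_iff[OF \<omega>, of "{b..}" u] T that by (auto simp: not_le[symmetric])
  obtain u where "u \<in> {0..t}" "X u \<omega> \<ge> b"
    using hitting_time_le_iff[OF \<omega>, of "{b..}" t] T by auto
  with nb have Xt: "X t \<omega> \<ge> b" by (metis atLeastAtMost_iff linorder_not_le order_le_less)
  show "0 < t" using Xt start t0 by (cases "t = 0") auto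
  obtain u where u: "0 \<le> u" "u \<le> t" "X u \<omega> = b"
    using IVT'[of "\<lambda>u. X u \<omega>" 0 b t] start Xt t0
      continuous_on_subset[OF continuous_paths[OF \<omega>], of "{0..t}"] by force
  with nb[of u] have "u = t" by fastforce
  with u show "X t \<omega> = b" by simp
qed

text \<open>By \<open>hitting_time_le_iff\<close> the event says that the maximum over [0,t] reaches
  \<open>b\<close>. Approximating the level from below and the times by a countable dense set
  expresses it through countably many coordinates up to \<open>t\<close>.\<close>

lemma hitting_time_le_sets:
  "{\<omega>\<in>space N. hitting_time X {b..} \<omega> \<le> ereal t} \<in> sets (F t)"
proof (cases "0 \<le> t")
  case False
  then have "{\<omega>\<in>space N. hitting_time X {b..} \<omega> \<le> ereal t} = {}"
    using hitting_time_le_iff[of _ "{b..}" t] by auto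
  then show ?thesis by (simp only: sets.empty_sets)
next
  case True
  have sets: "{\<omega>\<in>space N. a < X u \<omega>} \<in> sets (F t)" if "u \<in> {0..t}" for u a
    using measurable_sets[OF measurable_natural_filtration, of u t "{a<..}" X "space N"] that
    by (auto simp: vimage_def Int_def conj_commute)
  \<comment> \<open>The times are rational fractions \<open>q * t\<close> of \<open>t\<close>, so
    both endpoints are among them even for irrational \<open>t\<close>.\<close>
  have "{\<omega>\<in>space N. hitting_time X {b..} \<omega> \<le> ereal t} =
      (\<Inter>n. \<Union>q\<in>\<rat> \<inter> {0..1}. {\<omega>\<in>space N. b - inverse (real (Suc n)) < X (q * t) \<omega>})" (is "?L = ?R")
  proof (intro set_eqI iffI)
    fix \<omega> assume "\<omega> \<in> ?L"
    then have \<omega>: "\<omega> \<in> space N" and "hitting_time X {b..} \<omega> \<le> ereal t" by auto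
    then obtain u where u: "u \<in> {0..t}" "b \<le> X u \<omega>" using hitting_time_le_iff[OF \<omega>, of "{b..}" t] by auto
    show "\<omega> \<in> ?R"
    proof (rule INT_I)
      fix n
      define c where "c = b - inverse (real (Suc n))"
      have "c < X u \<omega>" using u by (auto simp: c_def intro: less_le_trans[of _ b])
      show "\<omega> \<in> (\<Union>q\<in>\<rat> \<inter> {0..1}. {\<omega>\<in>space N. c < X (q * t) \<omega>})"
      proof (cases "t = 0")
        case True then show ?thesis using u \<omega> \<open>c < X u \<omega>\<close> by (auto intro!: bexI[of _ 0])
      next
        case False
        define v where "v = u / t"
        have v: "v \<in> {0..1}" "u = v * t" using u False \<open>0 \<le> t\<close> by (auto simp: v_def)
        have "continuous_on {0..1} (\<lambda>q. X (q * t) \<omega>)"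
          using \<open>0 \<le> t\<close> by (intro continuous_on_compose2[OF continuous_paths[OF \<omega>]] continuous_intros) auto
        then have "((\<lambda>q. X (q * t) \<omega>) \<longlongrightarrow> X u \<omega>) (at v within {0..1})"
          using v by (auto simp: continuous_on_def)
        then have "\<forall>\<^sub>F q in at v within {0..1}. c < X (q * t) \<omega>"
          using \<open>c < X u \<omega>\<close> by (rule order_tendstoD)
        then obtain d where d: "d > 0" "\<And>q. q \<in> {0..1} \<Longrightarrow> q \<noteq> v \<Longrightarrow> dist q v < d \<Longrightarrow> c < X (q * t) \<omega>"
          by (auto simp: eventually_at)
        have "max 0 (v - d) < min 1 (v + d)" using v d by auto
        then obtain q where q: "q \<in> \<rat>" "max 0 (v - d) < q" "q < min 1 (v + d)"
          using Rats_dense_in_real by blast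
        then have "c < X (q * t) \<omega>"
          using d(2)[of q] v \<open>c < X u \<omega>\<close> by (cases "q = v") (auto simp: dist_real_def)
        with q \<omega> show ?thesis by auto
      qed
    qed
  next
    fix \<omega> assume R: "\<omega> \<in> ?R"
    then have \<omega>: "\<omega> \<in> space N" by auto
    have cont: "continuous_on {0..t} (\<lambda>u. X u \<omega>)"
      by (rule continuous_on_subset[OF continuous_paths[OF \<omega>]]) auto
    \<comment> \<open>Values above b - 1/(n+1) for every n only bound the supremum below by b; on
      the compact interval it is attained.\<close>
    obtain m where m: "m \<in> {0..t}" "\<And>u. u \<in> {0..t} \<Longrightarrow> X u \<omega> \<le> X m \<omega>"
      using continuous_attains_sup[OF _ _ cont] \<open>0 \<le> t\<close> by auto
    have "b - inverse (real (Suc n)) \<le> X m \<omega>" for n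
    proof -
      have "\<omega> \<in> (\<Union>q\<in>\<rat> \<inter> {0..1}. {\<omega>\<in>space N. b - inverse (real (Suc n)) < X (q * t) \<omega>})"
        using R by (rule INT_D) simp
      then obtain q where q: "q \<in> {0..1}" "b - inverse (real (Suc n)) < X (q * t) \<omega>" by blast
      then have "q * t \<in> {0..t}" using \<open>0 \<le> t\<close> by (auto simp: mult_left_le_one_le)
      from m(2)[OF this] q show ?thesis by simp
    qed
    moreover have "(\<lambda>n. b - inverse (real (Suc n))) \<longlonglongrightarrow> b"
      using tendsto_diff[OF tendsto_const LIMSEQ_inverse_real_of_nat, of b] by simp
    ultimately have "b \<le> X m \<omega>" by (intro LIMSEQ_le_const2) auto
    then show "\<omega> \<in> ?L" using hitting_time_le_iff[OF \<omega>, of "{b..}" t] m \<omega> by auto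
  qed
  also have "\<dots> \<in> sets (F t)"
    using \<open>0 \<le> t\<close> countable_rat
    by (intro sets.countable_INT'[OF _ ] sets.countable_UN'' sets)
       (auto simp: mult_left_le_one_le intro!: sets.countable_UN' sets)
  finally show ?thesis .
qed

lemma measurable_hitting_time [measurable]: "hitting_time X {b..} \<in> borel_measurable N"
  unfolding borel_measurable_iff_Iic_ereal
proof
  fix a :: ereal
  have eq: "hitting_time X {b..} -` {..a} \<inter> space N = {\<omega>\<in>space N. hitting_time X {b..} \<omega> \<le> a}" by auto
  show "hitting_time X {b..} -` {..a} \<inter> space N \<in> sets N"
  proof (cases a)
    case (real t)
    then show ?thesis using hitting_time_le_sets[of b t] sets_F_N[of t] unfolding eq by auto
  next
    case MInf
    have "\<not> hitting_time X {b..} \<omega> \<le> - \<infinity>" for \<omega> using hitting_time_nonneg[of "{b..}" \<omega>] by auto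
    then have "{\<omega>\<in>space N. hitting_time X {b..} \<omega> \<le> a} = {}" using MInf by blast
    then show ?thesis unfolding eq by (simp only: sets.empty_sets)
  next
    case PInf
    then have "{\<omega>\<in>space N. hitting_time X {b..} \<omega> \<le> a} = space N" by simp
    then show ?thesis unfolding eq by (simp only: sets.top)
  qed
qed

lemma killed_resolvent_eq:
  fixes g :: "real \<Rightarrow> real"
  assumes "r > 0" "x \<in> S" and [measurable]: "g \<in> borel_measurable borel"
  shows "killed_resolvent P X r D g x =
    (LINT \<omega>|P x. (1 / r) * (LINT s|exponential_law r. indicator {s. ereal s < hitting_time X D \<omega>} s * g (X (max 0 s) \<omega>)))"
  unfolding killed_resolvent_def
proof (intro Bochner_Integration.integral_cong refl)
  fix \<omega> assume "\<omega> \<in> space (P x)"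
  then have [measurable]: "(\<lambda>t. X (max 0 t) \<omega>) \<in> borel_measurable borel"
    using assms(2) by (intro measurable_path) simp
  have "(LBINT s=0..hitting_time X D \<omega>. exp (- r * s) * g (X s \<omega>)) =
      (LBINT s=0..hitting_time X D \<omega>. exp (- r * s) * g (X (max 0 s) \<omega>))"
    using hitting_time_nonneg[of D \<omega>]
    by (intro interval_integral_cong) (auto simp: einterval_def max_def min_def zero_ereal_def)
  also have "\<dots> = (1 / r) * (LINT s|exponential_law r. indicator {s. ereal s < hitting_time X D \<omega>} s * g (X (max 0 s) \<omega>))"
    using assms(1) hitting_time_nonneg by (subst interval_integral_exponential_law) auto
  finally show "(LBINT s=0..hitting_time X D \<omega>. exp (- r * s) * g (X s \<omega>)) = \<dots>" .
qed

section \<open>Strong Markov property at the hitting time\<close>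

lemma start_AE: "x \<in> S \<Longrightarrow> AE \<omega> in P x. \<omega> \<in> space N \<and> X 0 \<omega> = x"
  using start by (auto simp: AE_conj_iff intro: AE_I2)

text \<open>On the event that the hitting time falls into a given dyadic interval, the fixed-time
  Markov property is used at the right endpoint. The position there is only near \<open>b\<close>,
  so the limit rests on \<open>cont\<close>.\<close>

lemma Markov_at_hitting_time:
  fixes g :: "real \<Rightarrow> real"
  assumes r: "r > 0" and x: "x \<in> S" "x < b"
    and g[measurable]: "g \<in> borel_measurable borel" and bg: "bounded (range g)"
    and cont: "continuous_on S (\<lambda>y. LINT z|resolvent_law r y. g z)"
  defines "T \<equiv> hitting_time X {b..}"
  shows "(LINT \<omega>|P x. LINT s|exponential_law r. indicator {s. T \<omega> < ereal s} s * g (X (max 0 s) \<omega>)) =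
    (LINT y|resolvent_law r b. g y) * (LINT \<omega>|P x. (if T \<omega> = \<infinity> then 0 else exp (- r * real_of_ereal (T \<omega>))))"
proof -
  interpret E: prob_space "exponential_law r" using r by (rule prob_space_exponential_density)
  interpret Px: prob_space "P x" using x by (intro kernel_prob_space)
  interpret pair_prob_space "exponential_law r" "P x" ..
  obtain C where C: "\<And>y. \<bar>g y\<bar> \<le> C" using bg by (auto simp: bounded_iff)
  have C0: "0 \<le> C" using C[of 0] by linarith
  define V where "V y = (LINT z|resolvent_law r y. g z)" for y
  define J where "J q \<omega> = (LINT s|exponential_law r. indicator {q<..} s * g (X (max 0 s) \<omega>))" for q \<omega>
  \<comment> \<open>\<open>q n k\<close> is the right endpoint of the interval (k/2^n, (k+1)/2^n],
    and \<open>E n k\<close> says that the hitting time lies in it, which is known at time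
    \<open>q n k\<close>.\<close>
  define q where "q n k = real (Suc k) / 2 ^ n" for n k
  define E where "E n k = {\<omega>\<in>space N. T \<omega> \<le> ereal (q n k)} - {\<omega>\<in>space N. T \<omega> \<le> ereal (real k / 2 ^ n)}" for n k
  have q0: "0 \<le> q n k" for n k by (simp add: q_def)
  have E_F: "E n k \<in> sets (F (q n k))" for n k
  proof -
    have "real k / 2 ^ n \<le> q n k" unfolding q_def by (intro divide_right_mono) auto
    then have mono: "sets (F (real k / 2 ^ n)) \<subseteq> sets (F (q n k))"
      by (intro sets_natural_filtration_subset measurable_natural_filtration) auto
    show ?thesis unfolding E_def T_def using mono by (intro sets.Diff hitting_time_le_sets) (auto intro: hitting_time_le_sets)
  qed
  have E_N[measurable]: "E n k \<in> sets (P x)" for n k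
    using E_F sets_F_N x by auto
  have bV: "\<bar>V y\<bar> \<le> C" if "y \<in> S" for y
  proof -
    interpret prob_space "resolvent_law r y" using r that by (rule prob_space_resolvent_law)
    show ?thesis unfolding V_def using C by (intro abs_integral_le_const) auto
  qed
  have bJ: "\<bar>J q \<omega>\<bar> \<le> C" for q \<omega>
    unfolding J_def using C C0 by (intro E.abs_integral_le_const) (auto simp: indicator_def)
  \<comment> \<open>The half-open intervals partition the positive times, so a finite positive
    hitting time selects exactly one \<open>k\<close>.\<close>
  have T_eq: "\<omega> \<in> E n k \<longleftrightarrow> k = nat (\<lceil>t * 2 ^ n\<rceil> - 1)" if "\<omega> \<in> space N" "T \<omega> = ereal t" "0 < t" for \<omega> t n k
  proof -
    have "\<omega> \<in> E n k \<longleftrightarrow> real k < t * 2 ^ n \<and> t * 2 ^ n \<le> real (Suc k)"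
      using that by (auto simp: E_def q_def field_simps)
    also have "\<dots> \<longleftrightarrow> \<lceil>t * 2 ^ n\<rceil> = int k + 1"
      by (subst ceiling_eq_iff) auto
    also have "\<dots> \<longleftrightarrow> k = nat (\<lceil>t * 2 ^ n\<rceil> - 1)"
    proof -
      have "0 < t * 2 ^ n" using that by simp
      then have "0 < \<lceil>t * 2 ^ n\<rceil>" by simp
      then show ?thesis by auto
    qed
    finally show ?thesis .
  qed
  \<comment> \<open>The time rounded up to the grid of level \<open>n\<close>. It never precedes
    \<open>t\<close>, so nothing about the hitting time is anticipated.\<close>
  define c where "c n t = real_of_int \<lceil>t * 2 ^ n\<rceil> / 2 ^ n" for n and t :: real
  have c_ge: "t \<le> c n t" for n t unfolding c_def by (simp add: field_simps)
  have c_lim: "(\<lambda>n. c n t) \<longlonglongrightarrow> t" for t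
  proof (rule tendsto_sandwich)
    show "\<forall>\<^sub>F n in sequentially. t \<le> c n t" using c_ge by simp
    show "\<forall>\<^sub>F n in sequentially. c n t \<le> t + (1 / 2) ^ n"
    proof (intro always_eventually allI)
      fix n
      have "real_of_int \<lceil>t * 2 ^ n\<rceil> \<le> t * 2 ^ n + 1" by linarith
      then show "c n t \<le> t + (1 / 2) ^ n" by (simp add: c_def field_simps)
    qed
    have "(\<lambda>n. t + (1 / 2) ^ n) \<longlonglongrightarrow> t + 0" by (intro tendsto_intros LIMSEQ_power_zero) auto
    then show "(\<lambda>n. t + (1 / 2) ^ n) \<longlonglongrightarrow> t" by simp
  qed simp
  \<comment> \<open>The range k < n 2^n covers the times up to \<open>n\<close>, which includes any
    finite hitting time once \<open>n\<close> is large.\<close>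
  have sum_eq: "(\<Sum>k<n * 2 ^ n. indicator (E n k) \<omega> * G (q n k)) = G (c n t)"
    if "\<omega> \<in> space N" "T \<omega> = ereal t" "0 < t" "t \<le> real n" for G :: "real \<Rightarrow> real" and \<omega> t n
  proof -
    define k0 where "k0 = nat (\<lceil>t * 2 ^ n\<rceil> - 1)"
    have pos: "0 < \<lceil>t * 2 ^ n\<rceil>" using that by simp
    have "t * 2 ^ n \<le> real_of_int (int (n * 2 ^ n))" using that by simp
    then have "\<lceil>t * 2 ^ n\<rceil> \<le> int (n * 2 ^ n)" by (simp only: ceiling_le_iff)
    then have "\<lceil>t * 2 ^ n\<rceil> - 1 < int (n * 2 ^ n)" by linarith
    then have k0: "k0 < n * 2 ^ n" unfolding k0_def using pos by linarith
    have "(\<Sum>k<n * 2 ^ n. indicator (E n k) \<omega> * G (q n k)) = (\<Sum>k<n * 2 ^ n. if k = k0 then G (q n k) else 0)"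
      using T_eq[OF that(1-3)] by (intro sum.cong) (auto simp: k0_def)
    also have "\<dots> = G (q n k0)" using k0 by simp
    also have "q n k0 = c n t" using pos by (simp add: q_def c_def k0_def)
    finally show ?thesis .
  qed
  have sum_eq_inf: "(\<Sum>k<n * 2 ^ n. indicator (E n k) \<omega> * G (q n k)) = 0" if "T \<omega> = \<infinity>" for G :: "real \<Rightarrow> real" and \<omega> n
    using that by (intro sum.neutral) (auto simp: E_def)
  \<comment> \<open>At most one summand is nonzero, so the sum inherits the bound of a single term;
    this is the dominating constant of both limits below.\<close>
  have sum_bound: "\<bar>\<Sum>k<n * 2 ^ n. indicator (E n k) \<omega> * G (q n k)\<bar> \<le> C"
    if "\<And>k. \<bar>G (q n k)\<bar> \<le> C" "\<omega> \<in> space N" "0 < T \<omega>" for G :: "real \<Rightarrow> real" and \<omega> n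
  proof (cases "T \<omega>")
    case (real t)
    with that have "0 < t" by simp
    define k0 where "k0 = nat (\<lceil>t * 2 ^ n\<rceil> - 1)"
    have "(\<Sum>k<n * 2 ^ n. indicator (E n k) \<omega> * G (q n k)) = (\<Sum>k<n * 2 ^ n. if k = k0 then G (q n k) else 0)"
      using T_eq[OF that(2) real \<open>0 < t\<close>] by (intro sum.cong) (auto simp: k0_def)
    also have "\<bar>\<dots>\<bar> \<le> C" using that(1)[of k0] C0 by simp
    finally show ?thesis .
  next
    case PInf then show ?thesis using sum_eq_inf C0 by simp
  qed (use that in auto)
  define Z where "Z \<omega> = (LINT s|exponential_law r. indicator {s. T \<omega> < ereal s} s * g (X (max 0 s) \<omega>))" for \<omega>
  \<comment> \<open>The start below \<open>b\<close> rules out the hitting time 0, which lies in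
    none of the left-open intervals.\<close>
  have good: "AE \<omega> in P x. \<omega> \<in> space N \<and> 0 < T \<omega> \<and> (\<forall>t. T \<omega> = ereal t \<longrightarrow> 0 < t \<and> X t \<omega> = b)"
    using start_AE[OF x(1)]
  proof eventually_elim
    case (elim \<omega>)
    then have *: "0 < t \<and> X t \<omega> = b" if "T \<omega> = ereal t" for t
      using hitting_time_level[of \<omega> b t] x that by (auto simp: T_def)
    then have "T \<omega> \<noteq> 0" using zero_ereal_def by force
    with * elim show ?case using hitting_time_nonneg[of "{b..}" \<omega>] by (auto simp: T_def)
  qed
  have Z_lim: "(\<lambda>n. \<Sum>k<n * 2 ^ n. indicator (E n k) \<omega> * J (q n k) \<omega>) \<longlonglongrightarrow> Z \<omega>"
    if "\<omega> \<in> space N" "0 < T \<omega>" for \<omega>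
  proof (cases "T \<omega>")
    case (real t)
    have t: "0 < t" using that real by simp
    have m[measurable]: "(\<lambda>t. X (max 0 t) \<omega>) \<in> borel_measurable borel"
      using that by (intro measurable_path) simp
    have "(\<lambda>n. J (c n t) \<omega>) \<longlonglongrightarrow> Z \<omega>"
      unfolding J_def Z_def
    proof (rule integral_dominated_convergence[where w = "\<lambda>_. C"])
      show "AE s in exponential_law r. (\<lambda>n. indicator {c n t<..} s * g (X (max 0 s) \<omega>)) \<longlonglongrightarrow>
          indicator {s. T \<omega> < ereal s} s * g (X (max 0 s) \<omega>)"
      proof (rule AE_I2)
        fix s
        show "(\<lambda>n. indicator {c n t<..} s * g (X (max 0 s) \<omega>)) \<longlonglongrightarrow>
          indicator {s. T \<omega> < ereal s} s * g (X (max 0 s) \<omega>)"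
        proof (rule tendsto_eventually)
          show "\<forall>\<^sub>F n in sequentially. indicator {c n t<..} s * g (X (max 0 s) \<omega>) =
            indicator {s. T \<omega> < ereal s} s * g (X (max 0 s) \<omega>)"
          \<comment> \<open>Approximation from the right makes the indicators agree eventually at
            every \<open>s\<close>; at s = t both vanish because \<open>c n t\<close> is at least
            \<open>t\<close>.\<close>
          proof (cases "t < s")
            case True
            have "\<forall>\<^sub>F n in sequentially. c n t < s" using c_lim True by (rule order_tendstoD)
            then show ?thesis by eventually_elim (use True real in auto)
          next
            case False
            then have "\<not> c n t < s" for n using c_ge[of t n] by simp
            with False real show ?thesis by simp
          qed
        qed
      qed
      show "AE s in exponential_law r. norm (indicator {c n t<..} s * g (X (max 0 s) \<omega>)) \<le> C" for n
        using C C0 by (auto simp: indicator_def)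
      show "(\<lambda>s. indicator {s. T \<omega> < ereal s} s * g (X (max 0 s) \<omega>)) \<in> borel_measurable (exponential_law r)"
        using real by simp
    qed measurable
    moreover have "\<forall>\<^sub>F n in sequentially. J (c n t) \<omega> = (\<Sum>k<n * 2 ^ n. indicator (E n k) \<omega> * J (q n k) \<omega>)"
    proof -
      obtain n0 where "t \<le> real n0" using real_arch_simple by blast
      have "\<forall>\<^sub>F n in sequentially. n \<ge> n0" by (rule eventually_ge_at_top)
      then show ?thesis
        by eventually_elim (use \<open>t \<le> real n0\<close> in \<open>intro sum_eq[symmetric] that real t, linarith\<close>)
    qed
    ultimately show ?thesis by (rule Lim_transform_eventually)
  next
    case PInf
    then show ?thesis using sum_eq_inf[OF PInf, of _ "\<lambda>q. J q \<omega>"] by (simp add: Z_def)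
  qed (use that in auto)
  define Y where "Y \<omega> = V b * (if T \<omega> = \<infinity> then 0 else exp (- r * real_of_ereal (T \<omega>)))" for \<omega>
  have Y_lim: "(\<lambda>n. \<Sum>k<n * 2 ^ n. indicator (E n k) \<omega> * (exp (- r * q n k) * V (X (q n k) \<omega>))) \<longlonglongrightarrow> Y \<omega>"
    if \<omega>: "\<omega> \<in> space N" "0 < T \<omega>" "\<forall>t. T \<omega> = ereal t \<longrightarrow> 0 < t \<and> X t \<omega> = b" for \<omega>
  proof (cases "T \<omega>")
    case (real t)
    then have t: "0 < t" "X t \<omega> = b" using that by auto
    have c0: "0 \<le> c n t" for n using c_ge[of t n] t by linarith
    then have cX: "(\<lambda>n. X (c n t) \<omega>) \<longlonglongrightarrow> X t \<omega>"
      using continuous_on_tendsto_compose[OF continuous_paths[OF \<omega>(1)] c_lim[of t]] t by auto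
    have "b \<in> S" using X_in_S[of t \<omega>] \<omega> t by simp
    \<comment> \<open>Here the position at the rounded time, near \<open>b\<close> but in general
      different from it, is replaced by \<open>b\<close>: path continuity together with
      \<open>cont\<close>.\<close>
    have "(\<lambda>n. V (X (c n t) \<omega>)) \<longlonglongrightarrow> V b"
    proof (rule continuous_on_tendsto_compose[OF cont[folded V_def] _ \<open>b \<in> S\<close>])
      show "(\<lambda>n. X (c n t) \<omega>) \<longlonglongrightarrow> b" using cX t by simp
      show "\<forall>\<^sub>F n in sequentially. X (c n t) \<omega> \<in> S"
        using c0 \<omega> by (intro always_eventually allI X_in_S) auto
    qed
    then have "(\<lambda>n. exp (- r * c n t) * V (X (c n t) \<omega>)) \<longlonglongrightarrow> exp (- r * t) * V b"
      by (intro tendsto_intros c_lim)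
    moreover have "\<forall>\<^sub>F n in sequentially. exp (- r * c n t) * V (X (c n t) \<omega>) =
        (\<Sum>k<n * 2 ^ n. indicator (E n k) \<omega> * (exp (- r * q n k) * V (X (q n k) \<omega>)))"
    proof -
      obtain n0 where n0: "t \<le> real n0" using real_arch_simple by blast
      have "\<forall>\<^sub>F n in sequentially. n \<ge> n0" by (rule eventually_ge_at_top)
      then show ?thesis
      proof eventually_elim
        case (elim n)
        then have "t \<le> real n" using n0 by linarith
        from sum_eq[OF \<omega>(1) real t(1) this, of "\<lambda>q. exp (- r * q) * V (X q \<omega>)"]
        show ?case by simp
      qed
    qed
    ultimately show ?thesis unfolding Y_def using real by (auto dest: Lim_transform_eventually simp: mult.commute)
  next
    case PInf
    then show ?thesis using sum_eq_inf[OF PInf, of _ "\<lambda>q. exp (- r * q) * V (X q \<omega>)"] by (simp add: Y_def)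
  qed (use that in auto)
  have "(\<lambda>z. (snd z, fst z)) \<in> P x \<Otimes>\<^sub>M exponential_law r \<rightarrow>\<^sub>M exponential_law r \<Otimes>\<^sub>M P x" by measurable
  from measurable_compose[OF measurable_compose[OF this measurable_joint_kernel[OF x(1)]] g]
  have gX[measurable]: "(\<lambda>z. g (X (max 0 (snd z)) (fst z))) \<in> borel_measurable (P x \<Otimes>\<^sub>M exponential_law r)" by (simp add: case_prod_beta)
  have snd_meas[measurable]: "(\<lambda>z. snd z) \<in> borel_measurable (P x \<Otimes>\<^sub>M exponential_law r)"
    using measurable_snd[of "P x" "exponential_law r"] by (simp cong: measurable_cong_sets)
  have J_meas[measurable]: "J q \<in> borel_measurable (P x)" for q
  proof -
    have "(\<lambda>z. indicator {q<..} (snd z) * g (X (max 0 (snd z)) (fst z))) \<in> borel_measurable (P x \<Otimes>\<^sub>M exponential_law r)"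
      using gX unfolding indicator_def by measurable
    then show ?thesis unfolding J_def
      by (intro E.borel_measurable_lebesgue_integral) (simp add: case_prod_unfold)
  qed
  have V_meas[measurable]: "(\<lambda>\<omega>. V (X (q n k) \<omega>)) \<in> borel_measurable (P x)" for n k
  proof -
    have "V \<in> borel_measurable (restrict_space borel S)"
      using cont[folded V_def] by (rule borel_measurable_continuous_on_restrict)
    moreover have "X (q n k) \<in> P x \<rightarrow>\<^sub>M restrict_space borel S"
      using q0 X_in_S measurable_X x by (intro measurable_restrict_space2) (auto cong: measurable_cong_sets)
    ultimately show ?thesis by (rule measurable_compose[rotated])
  qed
  have T_meas[measurable]: "T \<in> borel_measurable (P x)"
    using measurable_hitting_time x by (simp add: T_def cong: measurable_cong_sets)
  have Z_meas: "Z \<in> borel_measurable (P x)"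
  proof -
    have [measurable]: "(\<lambda>z. T (fst z)) \<in> borel_measurable (P x \<Otimes>\<^sub>M exponential_law r)"
      by (rule measurable_compose[OF measurable_fst T_meas])
    have "(\<lambda>z. indicator {s. T (fst z) < ereal s} (snd z) * g (X (max 0 (snd z)) (fst z))) \<in> borel_measurable (P x \<Otimes>\<^sub>M exponential_law r)"
      using gX unfolding indicator_def by measurable
    then show ?thesis unfolding Z_def
      by (intro E.borel_measurable_lebesgue_integral) (simp add: case_prod_unfold)
  qed
  have "(\<lambda>n. LINT \<omega>|P x. (\<Sum>k<n * 2 ^ n. indicator (E n k) \<omega> * J (q n k) \<omega>)) \<longlonglongrightarrow> (LINT \<omega>|P x. Z \<omega>)"
  proof (rule integral_dominated_convergence[where w = "\<lambda>_. C"])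
    show "AE \<omega> in P x. (\<lambda>n. \<Sum>k<n * 2 ^ n. indicator (E n k) \<omega> * J (q n k) \<omega>) \<longlonglongrightarrow> Z \<omega>"
      using good by eventually_elim (intro Z_lim, auto)
    show "AE \<omega> in P x. norm (\<Sum>k<n * 2 ^ n. indicator (E n k) \<omega> * J (q n k) \<omega>) \<le> C" for n
      using good by eventually_elim (unfold real_norm_def, intro sum_bound[of "\<lambda>q. J q _"] bJ, auto)
  next
    show "(\<lambda>\<omega>. \<Sum>k<n * 2 ^ n. indicator (E n k) \<omega> * J (q n k) \<omega>) \<in> borel_measurable (P x)" for n
      by (intro borel_measurable_sum borel_measurable_times J_meas borel_measurable_indicator E_N)
  qed (use Z_meas in simp_all)
  moreover have "(\<lambda>n. LINT \<omega>|P x. (\<Sum>k<n * 2 ^ n. indicator (E n k) \<omega> * (exp (- r * q n k) * V (X (q n k) \<omega>)))) \<longlonglongrightarrow> (LINT \<omega>|P x. Y \<omega>)"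
  proof (rule integral_dominated_convergence[where w = "\<lambda>_. C"])
    show "AE \<omega> in P x. (\<lambda>n. \<Sum>k<n * 2 ^ n. indicator (E n k) \<omega> * (exp (- r * q n k) * V (X (q n k) \<omega>))) \<longlonglongrightarrow> Y \<omega>"
      using good by eventually_elim (intro Y_lim, auto)
    show "AE \<omega> in P x. norm (\<Sum>k<n * 2 ^ n. indicator (E n k) \<omega> * (exp (- r * q n k) * V (X (q n k) \<omega>))) \<le> C" for n
      using good
    proof eventually_elim
      case (elim \<omega>)
      have "\<bar>exp (- r * q n k) * V (X (q n k) \<omega>)\<bar> \<le> C" for k
      proof -
        have "exp (- r * q n k) \<le> 1" using r q0[of n k] by simp
        then have "exp (- r * q n k) * \<bar>V (X (q n k) \<omega>)\<bar> \<le> 1 * C"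
          using bV[of "X (q n k) \<omega>"] X_in_S[OF q0] elim by (intro mult_mono) auto
        then show ?thesis by (simp add: abs_mult)
      qed
      then show ?case using sum_bound[of "\<lambda>q. exp (- r * q) * V (X q \<omega>)" n \<omega>] elim by simp
    qed
  next
    show "Y \<in> borel_measurable (P x)" unfolding Y_def by measurable
    show "(\<lambda>\<omega>. \<Sum>k<n * 2 ^ n. indicator (E n k) \<omega> * (exp (- r * q n k) * V (X (q n k) \<omega>))) \<in> borel_measurable (P x)" for n
      by (intro borel_measurable_sum borel_measurable_times borel_measurable_const V_meas borel_measurable_indicator E_N)
  qed simp
  \<comment> \<open>For each \<open>n\<close> the two approximations have equal integrals, term by
    term, by the Markov property at time \<open>q n k\<close> on the event
    \<open>E n k\<close>.\<close>
  moreover have "(LINT \<omega>|P x. (\<Sum>k<n * 2 ^ n. indicator (E n k) \<omega> * J (q n k) \<omega>)) =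
      (LINT \<omega>|P x. (\<Sum>k<n * 2 ^ n. indicator (E n k) \<omega> * (exp (- r * q n k) * V (X (q n k) \<omega>))))" for n
  proof -
    have 1: "integrable (P x) (\<lambda>\<omega>. indicator (E n k) \<omega> * J (q n k) \<omega>)" for k
      by (rule Px.integrable_const_bound[where B = C]) (use bJ C0 in \<open>auto simp: indicator_def\<close>)
    have 2: "integrable (P x) (\<lambda>\<omega>. indicator (E n k) \<omega> * (exp (- r * q n k) * V (X (q n k) \<omega>)))" for k
    proof (rule Px.integrable_const_bound[where B = C])
      show "AE \<omega> in P x. norm (indicator (E n k) \<omega> * (exp (- r * q n k) * V (X (q n k) \<omega>))) \<le> C"
      proof (rule AE_I2)
        fix \<omega> assume "\<omega> \<in> space (P x)"
        then have \<omega>: "\<omega> \<in> space N" using x by simp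
        have "exp (- r * q n k) \<le> 1" using r q0[of n k] by simp
        then have "exp (- r * q n k) * \<bar>V (X (q n k) \<omega>)\<bar> \<le> 1 * C"
          using bV[of "X (q n k) \<omega>"] X_in_S[OF q0] \<omega> by (intro mult_mono) auto
        then show "norm (indicator (E n k) \<omega> * (exp (- r * q n k) * V (X (q n k) \<omega>))) \<le> C"
          using C0 by (auto simp: abs_mult indicator_def)
      qed
    qed measurable
    show ?thesis
      unfolding Bochner_Integration.integral_sum[OF 1] Bochner_Integration.integral_sum[OF 2]
    proof (rule sum.cong)
      fix k
      show "(LINT \<omega>|P x. indicator (E n k) \<omega> * J (q n k) \<omega>) =
          (LINT \<omega>|P x. indicator (E n k) \<omega> * (exp (- r * q n k) * V (X (q n k) \<omega>)))"
        using Markov_resolvent[OF r x(1) q0 E_F g bg, of n k]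
        by (simp only: set_lebesgue_integral_def J_def V_def real_scaleR_def)
    qed simp
  qed
  ultimately have "(LINT \<omega>|P x. Z \<omega>) = (LINT \<omega>|P x. Y \<omega>)"
    using LIMSEQ_unique by simp
  then show ?thesis by (simp add: Z_def Y_def V_def)
qed

text \<open>The killed resolvent collects the time before the hitting time, so the difference is the
  discounted integral after it, which \<open>Markov_at_hitting_time\<close> evaluates.\<close>

lemma reflected_minus_killed_resolvent:
  fixes g :: "real \<Rightarrow> real"
  assumes r: "r > 0" and x: "x \<in> S" "x < b"
    and g[measurable]: "g \<in> borel_measurable borel" and bg: "bounded (range g)"
    and cont: "continuous_on S (\<lambda>y. LINT z|resolvent_law r y. g z)"
  shows "reflected_resolvent P X r g x - killed_resolvent P X r {b..} g x =
    (1 / r) * (LINT y|resolvent_law r b. g y) *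
      (LINT \<omega>|P x. (if hitting_time X {b..} \<omega> = \<infinity> then 0 else exp (- r * real_of_ereal (hitting_time X {b..} \<omega>))))"
proof -
  interpret E: prob_space "exponential_law r" using r by (rule prob_space_exponential_density)
  interpret Px: prob_space "P x" using x by (intro kernel_prob_space)
  obtain C where C: "\<And>y. \<bar>g y\<bar> \<le> C" using bg by (auto simp: bounded_iff)
  have C0: "0 \<le> C" using C[of 0] by linarith
  define T where "T = hitting_time X {b..}"
  have T_meas[measurable]: "T \<in> borel_measurable (P x)"
    using measurable_hitting_time x by (simp add: T_def cong: measurable_cong_sets)
  have "(\<lambda>z. (snd z, fst z)) \<in> P x \<Otimes>\<^sub>M exponential_law r \<rightarrow>\<^sub>M exponential_law r \<Otimes>\<^sub>M P x" by measurable
  from measurable_compose[OF measurable_compose[OF this measurable_joint_kernel[OF x(1)]] g]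
  have gX[measurable]: "(\<lambda>z. g (X (max 0 (snd z)) (fst z))) \<in> borel_measurable (P x \<Otimes>\<^sub>M exponential_law r)" by (simp add: case_prod_beta)
  define A where "A \<omega> = (LINT s|exponential_law r. g (X (max 0 s) \<omega>))" for \<omega>
  define B where "B \<omega> = (LINT s|exponential_law r. indicator {s. ereal s < T \<omega>} s * g (X (max 0 s) \<omega>))" for \<omega>
  have [measurable]: "A \<in> borel_measurable (P x)" unfolding A_def
    using gX by (intro E.borel_measurable_lebesgue_integral) (simp add: case_prod_unfold)
  have [measurable]: "(\<lambda>z. T (fst z)) \<in> borel_measurable (P x \<Otimes>\<^sub>M exponential_law r)"
    by (rule measurable_compose[OF measurable_fst T_meas])
  have [measurable]: "(\<lambda>z. snd z) \<in> borel_measurable (P x \<Otimes>\<^sub>M exponential_law r)"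
    using measurable_snd[of "P x" "exponential_law r"] by (simp cong: measurable_cong_sets)
  have "(\<lambda>z. indicator {s. ereal s < T (fst z)} (snd z) * g (X (max 0 (snd z)) (fst z))) \<in> borel_measurable (P x \<Otimes>\<^sub>M exponential_law r)"
    using gX unfolding indicator_def by measurable
  then have [measurable]: "B \<in> borel_measurable (P x)" unfolding B_def
    by (intro E.borel_measurable_lebesgue_integral) (simp add: case_prod_unfold)
  have iA: "integrable (P x) A"
    by (rule Px.integrable_const_bound[where B = C]) (use C in \<open>auto simp: A_def intro!: E.abs_integral_le_const\<close>)
  have iB: "integrable (P x) B"
    by (rule Px.integrable_const_bound[where B = C])
       (use C C0 in \<open>auto simp: B_def indicator_def intro!: E.abs_integral_le_const\<close>)
  have AB: "A \<omega> - B \<omega> = (LINT s|exponential_law r. indicator {s. T \<omega> < ereal s} s * g (X (max 0 s) \<omega>))"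
    if "\<omega> \<in> space (P x)" for \<omega>
  proof -
    have [measurable]: "(\<lambda>t. X (max 0 t) \<omega>) \<in> borel_measurable borel"
      using that x by (intro measurable_path) simp
    have i1: "integrable (exponential_law r) (\<lambda>s. g (X (max 0 s) \<omega>))"
      by (rule E.integrable_const_bound[where B = C]) (use C in auto)
    have i2: "integrable (exponential_law r) (\<lambda>s. indicator {s. ereal s < T \<omega>} s * g (X (max 0 s) \<omega>))"
      by (rule E.integrable_const_bound[where B = C]) (use C C0 in \<open>auto simp: indicator_def\<close>)
    have "A \<omega> - B \<omega> = (LINT s|exponential_law r. g (X (max 0 s) \<omega>) - indicator {s. ereal s < T \<omega>} s * g (X (max 0 s) \<omega>))"
      unfolding A_def B_def using i1 i2 by simp
    also have "\<dots> = (LINT s|exponential_law r. indicator {s. T \<omega> < ereal s} s * g (X (max 0 s) \<omega>))"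
    proof (rule integral_cong_AE)
      \<comment> \<open>Neither indicator covers s equal to the hitting time. For an infinite
        hitting time \<open>real_of_ereal\<close> returns 0, and excluding that point is
        harmless.\<close>
      have "AE s in lborel. s \<noteq> real_of_ereal (T \<omega>)" by (rule AE_lborel_singleton)
      then have "AE s in exponential_law r. s \<noteq> real_of_ereal (T \<omega>)"
        by (subst AE_density) auto
      then show "AE s in exponential_law r. g (X (max 0 s) \<omega>) - indicator {s. ereal s < T \<omega>} s * g (X (max 0 s) \<omega>) =
          indicator {s. T \<omega> < ereal s} s * g (X (max 0 s) \<omega>)"
      proof eventually_elim
        case (elim s)
        then show ?case by (cases "T \<omega>") (auto simp: indicator_def)
      qed
    qed measurable
    finally show ?thesis .
  qed
  have "reflected_resolvent P X r g x - killed_resolvent P X r {b..} g x = (1 / r) * (LINT \<omega>|P x. A \<omega>) - (1 / r) * (LINT \<omega>|P x. B \<omega>)"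
    using reflected_resolvent_eq[OF r x(1) g bg] resolvent_law_time_first[OF r x(1) g bg] killed_resolvent_eq[OF r x(1) g, of "{b..}"]
    by (simp add: A_def B_def T_def)
  also have "\<dots> = (1 / r) * (LINT \<omega>|P x. A \<omega> - B \<omega>)" using iA iB by (simp add: right_diff_distrib)
  also have "(LINT \<omega>|P x. A \<omega> - B \<omega>) =
      (LINT \<omega>|P x. LINT s|exponential_law r. indicator {s. T \<omega> < ereal s} s * g (X (max 0 s) \<omega>))"
    using AB by (intro Bochner_Integration.integral_cong) auto
  finally show ?thesis using Markov_at_hitting_time[OF r x g bg cont] by (simp add: T_def)
qed

end

section \<open>The law of reflected Brownian motion at an exponential time\<close>

text \<open>Continuation by a constant stays differentiable because the slope at 0 vanishes. Applied
  to a function and then to its derivative, it glues twice differentiably.\<close>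

lemma has_real_derivative_comp_max:
  fixes g g' :: "real \<Rightarrow> real"
  assumes g: "\<And>v. 0 \<le> v \<Longrightarrow> (g has_real_derivative g' v) (at v)" and "g' 0 = 0"
  shows "((\<lambda>v. g (max 0 v)) has_real_derivative g' (max 0 v)) (at v)"
proof -
  consider "v < 0" | "v = 0" | "0 < v" by linarith
  then show ?thesis
  proof cases
    case 1
    have "((\<lambda>v. g 0) has_real_derivative 0) (at v)" by simp
    then have "((\<lambda>v. g (max 0 v)) has_real_derivative 0) (at v)"
      by (rule has_field_derivative_transform_within_open[where S = "{..<0}"]) (use 1 in auto)
    then show ?thesis using 1 assms by simp
  next
    case 3
    have "(g has_real_derivative g' v) (at v)" using 3 by (intro g) simp
    then have "((\<lambda>v. g (max 0 v)) has_real_derivative g' v) (at v)"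
      by (rule has_field_derivative_transform_within_open[where S = "{0<..}"]) (use 3 in auto)
    then show ?thesis using 3 by simp
  next
    case 2
    have "((\<lambda>v. g 0) has_real_derivative 0) (at 0 within {..0})" by simp
    then have l: "((\<lambda>v. g (max 0 v)) has_real_derivative 0) (at 0 within {..0})"
      by (rule has_field_derivative_transform_within[where d = 1]) auto
    have "(g has_real_derivative 0) (at 0 within {0..})"
      using g[of 0] assms(2) by (auto intro: has_field_derivative_at_within)
    then have r: "((\<lambda>v. g (max 0 v)) has_real_derivative 0) (at 0 within {0..})"
      by (rule has_field_derivative_transform_within[where d = 1]) auto
    have "{..0} \<union> {0..} = (UNIV :: real set)" by auto
    then have "((\<lambda>v. g (max 0 v)) has_real_derivative 0) (at 0)"
      using Lim_Un[OF l[unfolded has_field_derivative_iff] r[unfolded has_field_derivative_iff]]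
      by (simp add: has_field_derivative_iff)
    then show ?thesis using 2 assms by simp
  qed
qed

lemma borel_measurable_comp_max:
  fixes g :: "real \<Rightarrow> real"
  assumes "continuous_on {0..} g" shows "(\<lambda>y. g (max 0 y)) \<in> borel_measurable borel"
proof (rule borel_measurable_continuous_onI)
  have "continuous_on UNIV (\<lambda>y :: real. max 0 y)" by (intro continuous_intros)
  then show "continuous_on UNIV (\<lambda>y. g (max 0 y))"
    by (rule continuous_on_compose2[OF assms]) auto
qed

text \<open>The Laplace transform of an antiderivative: by Fubini each \<open>s\<close> is weighted
  by the probability exp(-r s) that the exponential time exceeds it, which is 1/r times the
  density.\<close>

lemma exponential_law_integral_antiderivative:
  fixes \<phi> :: "real \<Rightarrow> real"
  assumes r: "r > 0" and [measurable]: "\<phi> \<in> borel_measurable borel" and C: "\<And>s. \<bar>\<phi> s\<bar> \<le> C"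
  shows "(LINT t|exponential_law r. (LBINT s:{0..t}. \<phi> s)) = (1 / r) * (LINT s|exponential_law r. \<phi> s)"
proof -
  interpret E: prob_space "exponential_law r" using r by (rule prob_space_exponential_density)
  interpret pair_sigma_finite lborel "exponential_law r" ..
  have C0: "0 \<le> C" using C[of 0] by linarith
  have iE: "integrable lborel (exponential_density r)"
  proof (rule integrableI_nonneg)
    show "(\<integral>\<^sup>+ x. ennreal (exponential_density r x) \<partial>lborel) < \<infinity>"
      using E.emeasure_space_1 by (simp add: emeasure_density)
  qed (use r in \<open>auto simp: exponential_density_nonneg\<close>)
  \<comment> \<open>Half-open at \<open>t\<close>, so that the section in \<open>t\<close> is
    \<open>{s<..}\<close>, whose mass memorylessness gives directly.\<close>
  define F where "F s t = indicator {0..<t} s * \<phi> s" for s t :: real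
  have Fm[measurable]: "case_prod F \<in> borel_measurable (lborel \<Otimes>\<^sub>M exponential_law r)"
  proof -
    have "case_prod F = (\<lambda>z. (if 0 \<le> fst z \<and> fst z < snd z then 1 else 0) * \<phi> (fst z))"
      by (auto simp: F_def indicator_def)
    also have "\<dots> \<in> borel_measurable (borel \<Otimes>\<^sub>M borel)" by measurable
    also have "borel_measurable (borel \<Otimes>\<^sub>M borel) = borel_measurable (lborel \<Otimes>\<^sub>M exponential_law r)"
      by (intro measurable_cong_sets sets_pair_measure_cong) auto
    finally show ?thesis .
  qed
  have tail: "(LINT t|exponential_law r. indicator {s<..} t) = exp (- r * s)" if "0 \<le> s" for s
    using exponential_law_memoryless[OF r that, of "\<lambda>_. 1"] E.prob_space by simp
  have F_eq: "F s t = (indicator {0..} s * \<phi> s) * indicator {s<..} t" for s t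
    by (auto simp: F_def indicator_def)
  have inner: "(LINT t|exponential_law r. F s t) = (1 / r) * (exponential_density r s * \<phi> s)" for s
    using tail[of s] r by (cases "0 \<le> s") (auto simp: F_eq exponential_density_def mult_ac)
  have innern: "(LINT t|exponential_law r. norm (F s t)) = (1 / r) * (exponential_density r s * \<bar>\<phi> s\<bar>)" for s
    using tail[of s] r by (cases "0 \<le> s") (auto simp: F_eq abs_mult exponential_density_def mult_ac)
  have bounded_int: "integrable lborel (\<lambda>s. exponential_density r s * \<psi> s)"
    if [measurable]: "\<psi> \<in> borel_measurable borel" and "\<And>s. \<bar>\<psi> s\<bar> \<le> C" for \<psi> :: "real \<Rightarrow> real"
  proof (rule Bochner_Integration.integrable_bound[OF integrable_mult_right[OF iE, of C]])
    show "AE s in lborel. norm (exponential_density r s * \<psi> s) \<le> norm (C * exponential_density r s)"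
      using that(2) r C0 by (intro AE_I2) (simp add: abs_mult exponential_density_nonneg mult.commute[of C] mult_left_mono)
  qed measurable
  have int: "integrable (lborel \<Otimes>\<^sub>M exponential_law r) (case_prod F)"
  proof (rule Fubini_integrable)
    show "integrable lborel (\<lambda>s. LINT t|exponential_law r. norm (case (s, t) of (s, t) \<Rightarrow> F s t))"
      using bounded_int[of "\<lambda>s. \<bar>\<phi> s\<bar>"] C by (simp add: innern del: real_norm_def)
    have "integrable (exponential_law r) (\<lambda>t. indicator {s<..} t :: real)" for s
      by (intro E.integrable_const_bound[where B = 1]) auto
    then show "AE s in lborel. integrable (exponential_law r) (\<lambda>t. case (s, t) of (s, t) \<Rightarrow> F s t)"
      by (auto simp: F_eq)
  qed measurable
  have "(LINT t|exponential_law r. (LBINT s:{0..t}. \<phi> s)) = (LINT t|exponential_law r. LINT s|lborel. F s t)"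
  proof (intro Bochner_Integration.integral_cong refl)
    fix t
    show "(LBINT s:{0..t}. \<phi> s) = (LINT s|lborel. F s t)"
      unfolding set_lebesgue_integral_def F_def
    proof (rule integral_cong_AE)
      show "AE s in lborel. indicator {0..t} s *\<^sub>R \<phi> s = indicator {0..<t} s * \<phi> s"
        using AE_lborel_singleton[of t] by eventually_elim (auto simp: indicator_def)
    qed measurable
  qed
  also have "\<dots> = (LINT s|lborel. LINT t|exponential_law r. F s t)"
    by (rule Fubini_integral[OF int])
  also have "\<dots> = (1 / r) * (LINT s|exponential_law r. \<phi> s)"
    using r by (simp add: inner integral_real_density exponential_density_nonneg)
  finally show ?thesis .
qed

section \<open>Dynkin's formula and its Laplace transform\<close>

locale reflected_brownian = reflected_diffusion "{0..}" "\<lambda>_. 0" "\<lambda>_. 1" N P X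
  for N :: "'w measure" and P X
begin

text \<open>Dynkin's formula: the martingale of the \<open>generator\<close> axiom has the same
  expectation at 0 and at \<open>t\<close>, and Fubini moves the expectation inside the time
  integral.\<close>

lemma expectation_test_function:
  assumes x: "0 \<le> x" and t: "0 \<le> t" and f: "neumann_test_function {0..} f f' f''"
    and C: "\<And>y. 0 \<le> y \<Longrightarrow> \<bar>f y\<bar> \<le> C" "\<And>y. 0 \<le> y \<Longrightarrow> \<bar>f'' y\<bar> \<le> C"
  shows "(LINT \<omega>|P x. f (X t \<omega>)) - (LBINT s:{0..t}. (LINT \<omega>|P x. f'' (X (max 0 s) \<omega>)) / 2) = f x"
proof -
  have xS: "x \<in> {0..}" using x by simp
  interpret Px: prob_space "P x" using xS by (rule kernel_prob_space)
  interpret sf: sigma_finite_subalgebra "P x" "F 0" by (rule sigma_finite_subalgebra_F[OF xS])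
  interpret pair_sigma_finite lborel "P x" ..
  have C0: "0 \<le> C" using C(1)[of 0] by simp
  have cf: "continuous_on {0..} f" "continuous_on {0..} f''"
    using f by (auto simp: neumann_test_function_def intro!: DERIV_continuous_on)
  have fm[measurable]: "(\<lambda>y. f (max 0 y)) \<in> borel_measurable borel" "(\<lambda>y. f'' (max 0 y)) \<in> borel_measurable borel"
    using cf by (auto intro: borel_measurable_comp_max)
  have sets_eq: "sets (lborel \<Otimes>\<^sub>M P x) = sets (borel \<Otimes>\<^sub>M N)"
    using xS by (intro sets_pair_measure_cong) auto
  have fX: "f (X t \<omega>) = f (max 0 (X t \<omega>))" if "0 \<le> t" "\<omega> \<in> space N" for t \<omega>
    using X_in_S[OF that] by simp
  define Z where "Z t \<omega> = f (X t \<omega>) - (LBINT s:{0..t}. (1 :: real)\<^sup>2 / 2 * f'' (X s \<omega>) + 0 * f' (X s \<omega>))" for t \<omega>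
  have "martingale (P x) (natural_filtration (space N) X) Z"
    unfolding Z_def by (rule generator[OF xS f])
  then have "AE \<omega> in P x. real_cond_exp (P x) (F 0) (Z t) \<omega> = Z 0 \<omega>" and int: "integrable (P x) (Z t)" "integrable (P x) (Z 0)"
    using t by (auto simp: martingale_def)
  then have "(LINT \<omega>|P x. Z t \<omega>) = (LINT \<omega>|P x. Z 0 \<omega>)"
    using sf.real_cond_exp_int[OF int(1)] integral_cong_AE[of "real_cond_exp (P x) (F 0) (Z t)" "P x" "Z 0"] by auto
  also have "\<dots> = (LINT \<omega>|P x. f x)"
  proof (rule integral_cong_AE)
    show "AE \<omega> in P x. Z 0 \<omega> = f x"
      using start[OF xS]
    proof eventually_elim
      case (elim \<omega>)
      have "(LBINT s:{0..0}. (1 :: real)\<^sup>2 / 2 * f'' (X s \<omega>) + 0 * f' (X s \<omega>)) = 0"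
        unfolding set_lebesgue_integral_def
        by (rule integral_eq_zero_AE, rule AE_mp[OF AE_lborel_singleton[of 0]]) (auto simp: indicator_def)
      with elim show ?case by (simp add: Z_def)
    qed
  qed (use int in auto)
  finally have EZ: "(LINT \<omega>|P x. Z t \<omega>) = f x" by (simp add: Px.prob_space)
  \<comment> \<open>Clamping both time and state keeps \<open>H\<close> measurable and bounded
    everywhere, since \<open>f''\<close> is controlled only on the half-line; for times in [0,t] it
    does not change the value along a path.\<close>
  define H where "H s \<omega> = indicator {0..t} s * (f'' (max 0 (X (max 0 s) \<omega>)) / 2)" for s \<omega>
  have Hm[measurable]: "case_prod H \<in> borel_measurable (lborel \<Otimes>\<^sub>M P x)"
  proof -
    have "(\<lambda>z. (\<lambda>y. f'' (max 0 y)) (case z of (s, \<omega>) \<Rightarrow> X (max 0 s) \<omega>)) \<in> borel_measurable (borel \<Otimes>\<^sub>M N)"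
      by (rule measurable_compose[OF measurable_joint fm(2)])
    then have f''X[measurable]: "(\<lambda>z. f'' (max 0 (X (max 0 (fst z)) (snd z)))) \<in> borel_measurable (lborel \<Otimes>\<^sub>M P x)"
      unfolding measurable_cong_sets[OF sets_eq refl] by (simp only: case_prod_unfold)
    have [measurable]: "(\<lambda>z. fst z) \<in> borel_measurable (lborel \<Otimes>\<^sub>M P x)"
      using measurable_fst[of lborel "P x"] by simp
    show ?thesis using f''X unfolding H_def case_prod_unfold indicator_def by measurable
  qed
  have bH: "\<bar>H s \<omega>\<bar> \<le> indicator {0..t} s * C" for s \<omega>
    using C(2)[of "max 0 (X (max 0 s) \<omega>)"] C0 by (auto simp: H_def indicator_def)
  have iI: "integrable lborel (\<lambda>s. indicator {0..t} s * C)"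
    using t by (intro integrable_mult_left integrable_real_indicator) auto
  have Hint: "integrable (lborel \<Otimes>\<^sub>M P x) (case_prod H)"
  proof (rule Fubini_integrable)
    show "integrable lborel (\<lambda>s. LINT \<omega>|P x. norm (case (s, \<omega>) of (s, \<omega>) \<Rightarrow> H s \<omega>))"
    proof (rule Bochner_Integration.integrable_bound[OF iI])
      show "AE s in lborel. norm (LINT \<omega>|P x. norm (case (s, \<omega>) of (s, \<omega>) \<Rightarrow> H s \<omega>)) \<le> norm (indicator {0..t} s * C)"
      proof (rule AE_I2)
        fix s
        have "\<bar>LINT \<omega>|P x. \<bar>H s \<omega>\<bar>\<bar> \<le> indicator {0..t} s * C"
          by (rule Px.abs_integral_le_const) (use bH in simp)
        then show "norm (LINT \<omega>|P x. norm (case (s, \<omega>) of (s, \<omega>) \<Rightarrow> H s \<omega>)) \<le> norm (indicator {0..t} s * C)"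
          using C0 by (simp add: abs_mult)
      qed
    qed measurable
    show "AE s in lborel. integrable (P x) (\<lambda>\<omega>. case (s, \<omega>) of (s, \<omega>) \<Rightarrow> H s \<omega>)"
    proof (rule AE_I2)
      fix s
      have "H s \<in> borel_measurable (P x)" using measurable_Pair2[OF Hm, of s] by simp
      then show "integrable (P x) (\<lambda>\<omega>. case (s, \<omega>) of (s, \<omega>) \<Rightarrow> H s \<omega>)"
        using bH[of s] by (intro Px.integrable_const_bound[where B = "indicator {0..t} s * C"]) auto
    qed
  qed measurable
  have Xt[measurable]: "X t \<in> borel_measurable (P x)"
    using measurable_X[OF t] xS by (simp cong: measurable_cong_sets)
  have i1: "integrable (P x) (\<lambda>\<omega>. f (max 0 (X t \<omega>)))"
    by (rule Px.integrable_const_bound[where B = C]) (use C in auto)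
  have i2: "integrable (P x) (\<lambda>\<omega>. LINT s|lborel. H s \<omega>)"
    using integrable_snd[OF Hint] .
  have "(LINT \<omega>|P x. Z t \<omega>) = (LINT \<omega>|P x. f (max 0 (X t \<omega>)) - (LINT s|lborel. H s \<omega>))"
  proof (intro Bochner_Integration.integral_cong refl)
    fix \<omega> assume "\<omega> \<in> space (P x)"
    then have \<omega>: "\<omega> \<in> space N" using xS by simp
    have "(LBINT s:{0..t}. (1 :: real)\<^sup>2 / 2 * f'' (X s \<omega>) + 0 * f' (X s \<omega>)) = (LINT s|lborel. H s \<omega>)"
      unfolding set_lebesgue_integral_def H_def
      using X_in_S[OF _ \<omega>] by (intro Bochner_Integration.integral_cong) (auto simp: indicator_def)
    then show "Z t \<omega> = f (max 0 (X t \<omega>)) - (LINT s|lborel. H s \<omega>)"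
      using fX[OF t \<omega>] by (simp add: Z_def)
  qed
  also have "\<dots> = (LINT \<omega>|P x. f (max 0 (X t \<omega>))) - (LINT \<omega>|P x. LINT s|lborel. H s \<omega>)"
    using i1 i2 by simp
  also have "(LINT \<omega>|P x. LINT s|lborel. H s \<omega>) = (LINT s|lborel. LINT \<omega>|P x. H s \<omega>)"
    by (rule Fubini_integral[OF Hint])
  also have "\<dots> = (LBINT s:{0..t}. (LINT \<omega>|P x. f'' (X (max 0 s) \<omega>)) / 2)"
    unfolding set_lebesgue_integral_def
  proof (intro Bochner_Integration.integral_cong refl)
    fix s
    have "(LINT \<omega>|P x. f'' (X (max 0 s) \<omega>)) = (LINT \<omega>|P x. f'' (max 0 (X (max 0 s) \<omega>)))"
      using X_in_S[of "max 0 s"] xS by (intro Bochner_Integration.integral_cong) auto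
    then show "(LINT \<omega>|P x. H s \<omega>) = indicator {0..t} s *\<^sub>R ((LINT \<omega>|P x. f'' (X (max 0 s) \<omega>)) / 2)"
      by (simp add: H_def)
  qed
  also have "(LINT \<omega>|P x. f (max 0 (X t \<omega>))) = (LINT \<omega>|P x. f (X t \<omega>))"
    using fX[OF t] xS by (intro Bochner_Integration.integral_cong) auto
  finally show ?thesis using EZ by simp
qed

text \<open>Dynkin's formula averaged over the exponential time, where the time integral contributes
  a factor 1/r. The clamp \<open>max 0 y\<close> appears because \<open>resolvent_law\<close> is a
  measure on the whole line.\<close>

lemma resolvent_law_test_function:
  assumes r: "r > 0" and x: "0 \<le> x" and f: "neumann_test_function {0..} f f' f''"
    and C: "\<And>y. 0 \<le> y \<Longrightarrow> \<bar>f y\<bar> \<le> C" "\<And>y. 0 \<le> y \<Longrightarrow> \<bar>f'' y\<bar> \<le> C"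
  shows "r * (LINT y|resolvent_law r x. f (max 0 y)) - (LINT y|resolvent_law r x. f'' (max 0 y)) / 2 = r * f x"
proof -
  have xS: "x \<in> {0..}" using x by simp
  interpret E: prob_space "exponential_law r" using r by (rule prob_space_exponential_density)
  interpret Px: prob_space "P x" using xS by (rule kernel_prob_space)
  have C0: "0 \<le> C" using C(1)[of 0] by simp
  have cf: "continuous_on {0..} f" "continuous_on {0..} f''"
    using f by (auto simp: neumann_test_function_def intro!: DERIV_continuous_on)
  have fm[measurable]: "(\<lambda>y. f (max 0 y)) \<in> borel_measurable borel" "(\<lambda>y. f'' (max 0 y)) \<in> borel_measurable borel"
    using cf by (auto intro: borel_measurable_comp_max)
  have bf: "bounded (range (\<lambda>y. f (max 0 y)))" "bounded (range (\<lambda>y. f'' (max 0 y)))"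
    using C by (auto intro!: boundedI[where B = C])
  define v where "v s = (LINT \<omega>|P x. f'' (max 0 (X (max 0 s) \<omega>)))" for s
  define u where "u s = (LINT \<omega>|P x. f (max 0 (X (max 0 s) \<omega>)))" for s
  have meas: "(\<lambda>s. LINT \<omega>|P x. g (max 0 (X (max 0 s) \<omega>))) \<in> borel_measurable borel"
    if "(\<lambda>y. g (max 0 y)) \<in> borel_measurable borel" for g :: "real \<Rightarrow> real"
  proof -
    have "(\<lambda>z. (\<lambda>y. g (max 0 y)) (case z of (s, \<omega>) \<Rightarrow> X (max 0 s) \<omega>)) \<in> borel_measurable (borel \<Otimes>\<^sub>M P x)"
      unfolding measurable_cong_sets[OF sets_pair_measure_cong[OF refl sets_kernel[OF xS]] refl]
      by (rule measurable_compose[OF measurable_joint that])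
    then show ?thesis by (intro Px.borel_measurable_lebesgue_integral) (simp add: case_prod_unfold)
  qed
  have [measurable]: "v \<in> borel_measurable borel" "u \<in> borel_measurable borel"
    unfolding v_def u_def by (intro meas fm)+
  have bv: "\<bar>v s / 2\<bar> \<le> C" for s
  proof -
    have "\<bar>v s\<bar> \<le> C" unfolding v_def using C by (intro Px.abs_integral_le_const) auto
    with C0 show ?thesis by simp
  qed
  have bu: "\<bar>u s\<bar> \<le> C" for s unfolding u_def using C by (intro Px.abs_integral_le_const) auto
  have iu: "integrable (exponential_law r) u"
    by (rule E.integrable_const_bound[where B = C]) (use bu in auto)
  have max_X: "max 0 (X (max 0 s) \<omega>) = X (max 0 s) \<omega>" if "\<omega> \<in> space (P x)" for s \<omega>
    using X_in_S[of "max 0 s" \<omega>] that xS by simp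
  have "(LINT t|exponential_law r. (LBINT s:{0..t}. v s / 2)) = (LINT t|exponential_law r. u t - f x)"
  proof (rule integral_cong_AE)
    have "AE t in exponential_law r. 0 \<le> t"
      by (auto simp: AE_density exponential_density_def intro!: AE_I2)
    then show "AE t in exponential_law r. (LBINT s:{0..t}. v s / 2) = u t - f x"
    proof eventually_elim
      case (elim t)
      have "u t = (LINT \<omega>|P x. f (X t \<omega>))" "\<And>s. v s = (LINT \<omega>|P x. f'' (X (max 0 s) \<omega>))"
        unfolding u_def v_def using elim max_X[of _ t] max_X by (auto intro!: Bochner_Integration.integral_cong)
      then show ?case using expectation_test_function[OF x elim f C] by simp
    qed
    show "(\<lambda>t. LBINT s:{0..t}. v s / 2) \<in> borel_measurable (exponential_law r)"
    proof -
      have "(\<lambda>z. (if 0 \<le> snd z \<and> snd z \<le> fst z then 1 else 0) * (v (snd z) / 2)) \<in> borel_measurable (borel \<Otimes>\<^sub>M borel)"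
        by measurable
      also have "borel_measurable (borel \<Otimes>\<^sub>M borel) = borel_measurable (exponential_law r \<Otimes>\<^sub>M lborel)"
        by (intro measurable_cong_sets sets_pair_measure_cong) auto
      finally show ?thesis
        unfolding set_lebesgue_integral_def
        by (intro lborel.borel_measurable_lebesgue_integral) (simp add: case_prod_unfold indicator_def)
    qed
  qed measurable
  also have "\<dots> = (LINT t|exponential_law r. u t) - f x"
    using iu E.prob_space by simp
  also have "(LINT t|exponential_law r. (LBINT s:{0..t}. v s / 2)) = (1 / r) * (LINT s|exponential_law r. v s / 2)"
    by (rule exponential_law_integral_antiderivative[OF r _ bv]) measurable
  finally have "(1 / r) * ((LINT s|exponential_law r. v s) / 2) = (LINT t|exponential_law r. u t) - f x" by simp
  then have "(LINT s|exponential_law r. v s) / 2 = r * ((LINT t|exponential_law r. u t) - f x)"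
    using r by (simp add: field_simps)
  moreover have "(LINT y|resolvent_law r x. f (max 0 y)) = (LINT t|exponential_law r. u t)"
    using resolvent_law_space_first[OF r xS fm(1) bf(1)] by (simp add: u_def)
  moreover have "(LINT y|resolvent_law r x. f'' (max 0 y)) = (LINT t|exponential_law r. v t)"
    using resolvent_law_space_first[OF r xS fm(2) bf(2)] by (simp add: v_def)
  ultimately show ?thesis by (simp add: right_diff_distrib diff_divide_distrib)
qed

text \<open>The cutoffs \<open>(max 0 (1 - (y/n)\<^sup>2))\<^sup>3\<close> are twice continuously differentiable, have compact support
  and satisfy the Neumann condition at \<open>0\<close>.\<close>

lemma resolvent_law_bounded_function:
  assumes r: "r > 0" and x: "0 \<le> x"
    and d1: "\<And>y. 0 \<le> y \<Longrightarrow> (h has_real_derivative h' y) (at y within {0..})"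
    and d2: "\<And>y. 0 \<le> y \<Longrightarrow> (h' has_real_derivative h'' y) (at y within {0..})"
    and cont: "continuous_on {0..} h''" and neumann: "h' 0 = 0"
    and C: "\<And>y. 0 \<le> y \<Longrightarrow> \<bar>h y\<bar> \<le> C" "\<And>y. 0 \<le> y \<Longrightarrow> \<bar>h' y\<bar> \<le> C" "\<And>y. 0 \<le> y \<Longrightarrow> \<bar>h'' y\<bar> \<le> C"
  shows "r * (LINT y|resolvent_law r x. h (max 0 y)) - (LINT y|resolvent_law r x. h'' (max 0 y)) / 2 = r * h x"
proof -
  have xS: "x \<in> {0..}" using x by simp
  interpret \<mu>: prob_space "resolvent_law r x" using r xS by (rule prob_space_resolvent_law)
  have C0: "0 \<le> C" using C(1)[of 0] by simp
  \<comment> \<open>The shift keeps the radius at least 1: no division by 0, and bounds on the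
    derivatives of the cutoffs that are uniform in \<open>n\<close>.\<close>
  define N' where "N' n = real (Suc n)" for n
  define m where "m n y = max 0 (1 - (y / N' n)\<^sup>2)" for n y
  define \<psi>0 where "\<psi>0 n y = (m n y) ^ 3" for n y
  define \<psi>1 where "\<psi>1 n y = 3 * (m n y)\<^sup>2 * (- 2 * y / (N' n)\<^sup>2)" for n y
  define \<psi>2 where "\<psi>2 n y = 6 * m n y * (- 2 * y / (N' n)\<^sup>2)\<^sup>2 + 3 * (m n y)\<^sup>2 * (- 2 / (N' n)\<^sup>2)" for n y
  have N'1: "1 \<le> N' n" for n by (simp add: N'_def)
  have inner: "((\<lambda>y. 1 - (y / N' n)\<^sup>2) has_real_derivative - 2 * y / (N' n)\<^sup>2) (at y)" for n y
    using N'1[of n] by (auto intro!: derivative_eq_intros simp: power2_eq_square field_simps)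
  \<comment> \<open>The cube is the lowest integer power of the positive part with a continuous
    second derivative; a square would leave a jump at the edge of the support.\<close>
  have cube: "((\<lambda>v :: real. (max 0 v) ^ 3) has_real_derivative 3 * (max 0 v)\<^sup>2) (at v)"
    and square: "((\<lambda>v :: real. (max 0 v)\<^sup>2) has_real_derivative 2 * max 0 v) (at v)" for v
    by (rule has_real_derivative_comp_max; auto intro!: derivative_eq_intros)+
  have D0: "(\<psi>0 n has_real_derivative \<psi>1 n y) (at y)" for n y
    using DERIV_chain2[OF cube inner, of n y] by (simp add: \<psi>0_def[abs_def] \<psi>1_def m_def[abs_def])
  have D1: "(\<psi>1 n has_real_derivative \<psi>2 n y) (at y)" for n y
  proof -
    have sq: "((\<lambda>y. (m n y)\<^sup>2) has_real_derivative 2 * m n y * (- 2 * y / (N' n)\<^sup>2)) (at y)"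
      using DERIV_chain2[OF square inner, of n y] by (simp add: m_def[abs_def])
    have "((\<lambda>y. - 2 * y / (N' n)\<^sup>2) has_real_derivative - 2 / (N' n)\<^sup>2) (at y)"
      by (rule DERIV_cdivide) (auto intro!: derivative_eq_intros)
    from DERIV_mult'[OF DERIV_cmult[OF sq, of 3] this]
    show ?thesis by (simp add: \<psi>1_def[abs_def] \<psi>2_def power2_eq_square algebra_simps)
  qed
  have m_bounds: "0 \<le> m n y" "m n y \<le> 1" for n y by (auto simp: m_def)
  have m_zero: "m n y = 0" if "N' n \<le> y" for n y
  proof -
    have "1 \<le> y / N' n" using that N'1[of n] by simp
    then have "1 \<le> (y / N' n)\<^sup>2" by (rule one_le_power)
    then show ?thesis by (simp add: m_def)
  qed
  have b0: "\<bar>\<psi>0 n y\<bar> \<le> 1" for n y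
    using m_bounds[of n y] by (simp add: \<psi>0_def power_le_one)
  have slope: "\<bar>- 2 * y / (N' n)\<^sup>2\<bar> \<le> 2" if "0 \<le> y" "y \<le> N' n" for n y
  proof -
    have "y \<le> (N' n)\<^sup>2" using that N'1[of n] by (simp add: power2_eq_square) (metis mult_right_mono mult_1 order_trans zero_le_one)
    then show ?thesis using that N'1[of n] by (simp add: abs_mult divide_le_eq)
  qed
  have b1: "\<bar>\<psi>1 n y\<bar> \<le> 6" if "0 \<le> y" for n y
  proof (cases "N' n \<le> y")
    case False
    have "\<bar>\<psi>1 n y\<bar> = 3 * (m n y)\<^sup>2 * \<bar>- 2 * y / (N' n)\<^sup>2\<bar>" by (simp add: \<psi>1_def abs_mult)
    also have "\<dots> \<le> 3 * 1 * 2"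
      using m_bounds[of n y] slope[of y n] that False by (intro mult_mono) (auto simp: power_le_one)
    finally show ?thesis by simp
  qed (simp add: \<psi>1_def m_zero)
  \<comment> \<open>30 = 6 * 1 * 2^2 + 3 * 1 * 2, from \<open>m n y \<le> 1\<close> and the slope
    bound 2.\<close>
  have b2: "\<bar>\<psi>2 n y\<bar> \<le> 30" if "0 \<le> y" for n y
  proof (cases "N' n \<le> y")
    case False
    have s4: "(- 2 * y / (N' n)\<^sup>2)\<^sup>2 \<le> 2\<^sup>2"
      using slope[of y n] that False by (subst abs_le_square_iff[symmetric]) auto
    have "2 / (N' n)\<^sup>2 \<le> 2" using N'1[of n] by (simp add: divide_le_eq one_le_power)
    have "\<bar>\<psi>2 n y\<bar> \<le> \<bar>6 * m n y * (- 2 * y / (N' n)\<^sup>2)\<^sup>2\<bar> + \<bar>3 * (m n y)\<^sup>2 * (- 2 / (N' n)\<^sup>2)\<bar>"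
      unfolding \<psi>2_def by (rule abs_triangle_ineq)
    also have "\<dots> = 6 * m n y * (- 2 * y / (N' n)\<^sup>2)\<^sup>2 + 3 * (m n y)\<^sup>2 * (2 / (N' n)\<^sup>2)"
      using m_bounds[of n y] by (simp add: abs_mult)
    also have "\<dots> \<le> 6 * 1 * 2\<^sup>2 + 3 * 1 * 2"
      using m_bounds[of n y] s4 \<open>2 / (N' n)\<^sup>2 \<le> 2\<close> by (intro add_mono mult_mono) (auto simp: power_le_one)
    finally show ?thesis by simp
  qed (simp add: \<psi>2_def m_zero)
  have N'_lim: "filterlim N' at_top sequentially"
    unfolding N'_def by (rule filterlim_compose[OF filterlim_real_sequentially filterlim_Suc])
  have inv_lim: "(\<lambda>n. c / (N' n) ^ k) \<longlonglongrightarrow> 0" if "0 < k" for c and k :: nat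
    by (rule tendsto_divide_0[OF tendsto_const]) (rule filterlim_at_top_imp_at_infinity[OF filterlim_pow_at_top[OF that N'_lim]])
  have m_lim: "(\<lambda>n. m n y) \<longlonglongrightarrow> 1" for y
  proof -
    have "(\<lambda>n. max 0 (1 - y\<^sup>2 / (N' n)\<^sup>2)) \<longlonglongrightarrow> max 0 (1 - 0)" by (intro tendsto_intros inv_lim) simp
    then show ?thesis by (simp add: m_def power_divide)
  qed
  have l0: "(\<lambda>n. \<psi>0 n y) \<longlonglongrightarrow> 1" for y
    using tendsto_power[OF m_lim, of y 3] by (simp add: \<psi>0_def)
  have slope_lim: "(\<lambda>n. - 2 * y / (N' n)\<^sup>2) \<longlonglongrightarrow> 0" for y by (rule inv_lim) simp
  have l1: "(\<lambda>n. \<psi>1 n y) \<longlonglongrightarrow> 0" for y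
    using tendsto_mult[OF tendsto_mult[OF tendsto_const[of 3] tendsto_power[OF m_lim, of y 2]] slope_lim[of y]] by (simp add: \<psi>1_def)
  have l2: "(\<lambda>n. \<psi>2 n y) \<longlonglongrightarrow> 0" for y
  proof -
    have "(\<lambda>n. 6 * m n y * (- 2 * y / (N' n)\<^sup>2)\<^sup>2 + 3 * (m n y)\<^sup>2 * (- 2 / (N' n)\<^sup>2)) \<longlonglongrightarrow> 6 * 1 * 0\<^sup>2 + 3 * 1\<^sup>2 * 0"
      by (intro tendsto_intros m_lim slope_lim inv_lim) simp
    then show ?thesis by (simp add: \<psi>2_def)
  qed
  define f0 where "f0 n y = h y * \<psi>0 n y" for n y
  define f1 where "f1 n y = h' y * \<psi>0 n y + h y * \<psi>1 n y" for n y
  define f2 where "f2 n y = h'' y * \<psi>0 n y + 2 * h' y * \<psi>1 n y + h y * \<psi>2 n y" for n y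
  have ch: "continuous_on {0..} h" "continuous_on {0..} h'"
    using d1 d2 by (auto intro!: DERIV_continuous_on)
  have c\<psi>: "continuous_on A (\<psi>0 n)" "continuous_on A (\<psi>1 n)" "continuous_on A (\<psi>2 n)" for n A
    unfolding \<psi>0_def[abs_def] \<psi>1_def[abs_def] \<psi>2_def[abs_def] m_def[abs_def]
    using N'1[of n] by (auto intro!: continuous_intros)
  have test: "neumann_test_function {0..} (f0 n) (f1 n) (f2 n)" for n
    unfolding neumann_test_function_def
  proof (intro conjI ballI)
    fix y :: real assume "y \<in> {0..}"
    then have y: "0 \<le> y" by simp
    note D0' = has_field_derivative_at_within[OF D0] and D1' = has_field_derivative_at_within[OF D1]
    show "(f0 n has_real_derivative f1 n y) (at y within {0..})"
      unfolding f0_def[abs_def] f1_def using DERIV_mult'[OF d1[OF y] D0'[of n y]] by (simp add: add.commute)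
    show "(f1 n has_real_derivative f2 n y) (at y within {0..})"
      unfolding f1_def[abs_def] f2_def
      using DERIV_add[OF DERIV_mult'[OF d2[OF y] D0'[of n y]] DERIV_mult'[OF d1[OF y] D1'[of n y]]]
      by (simp add: algebra_simps)
  next
    show "continuous_on {0..} (f2 n)" unfolding f2_def[abs_def]
      by (intro continuous_on_add continuous_on_mult continuous_on_const cont ch c\<psi>)
    have "{y \<in> {0..}. f0 n y \<noteq> 0} \<subseteq> {0..N' n}"
      using m_zero[of n] by (auto simp: f0_def \<psi>0_def not_le[symmetric] intro!: leI)
    then show "bounded {y \<in> {0..}. f0 n y \<noteq> 0}" by (rule bounded_subset[OF bounded_closed_interval])
  next
    fix y :: real assume "y \<in> frontier {0..}"
    then have "y = 0" by (simp add: frontier_def)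
    then show "f1 n y = 0" using neumann by (simp add: f1_def \<psi>1_def)
  qed
  \<comment> \<open>43 = 1 + 2 * 6 + 30 collects the bounds of the cutoffs in the three terms of
    \<open>f2\<close>; the same constant serves for \<open>f0\<close>.\<close>
  have bf0: "\<bar>f0 n y\<bar> \<le> 43 * C" if "0 \<le> y" for n y
  proof -
    have "\<bar>f0 n y\<bar> \<le> C * 1" unfolding f0_def abs_mult using C(1)[OF that] b0[of n y] C0 by (intro mult_mono) auto
    then show ?thesis using C0 by simp
  qed
  have bf2: "\<bar>f2 n y\<bar> \<le> 43 * C" if "0 \<le> y" for n y
  proof -
    have "\<bar>h'' y * \<psi>0 n y\<bar> \<le> C * 1" unfolding abs_mult using C(3)[OF that] b0[of n y] C0 by (intro mult_mono) auto
    moreover have "\<bar>h' y * \<psi>1 n y\<bar> \<le> C * 6" unfolding abs_mult using C(2)[OF that] b1[OF that, of n] C0 by (intro mult_mono) auto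
    moreover have "\<bar>h y * \<psi>2 n y\<bar> \<le> C * 30" unfolding abs_mult using C(1)[OF that] b2[OF that, of n] C0 by (intro mult_mono) auto
    ultimately show ?thesis unfolding f2_def abs_le_iff by auto
  qed
  have eq: "r * (LINT y|resolvent_law r x. f0 n (max 0 y)) - (LINT y|resolvent_law r x. f2 n (max 0 y)) / 2 = r * f0 n x" for n
    by (rule resolvent_law_test_function[OF r x test bf0 bf2])
  have meas: "(\<lambda>y. g (max 0 y)) \<in> borel_measurable (resolvent_law r x)" if "continuous_on {0..} g" for g :: "real \<Rightarrow> real"
    using borel_measurable_comp_max[OF that] by (simp cong: measurable_cong_sets)
  \<comment> \<open>As the cutoffs widen, they tend to 1 and their derivatives to 0 under uniform
    bounds, so dominated convergence carries the identity over to \<open>h\<close>.\<close>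
  have "(\<lambda>n. LINT y|resolvent_law r x. f0 n (max 0 y)) \<longlonglongrightarrow> (LINT y|resolvent_law r x. h (max 0 y))"
  proof (rule integral_dominated_convergence[where w = "\<lambda>_. 43 * C"])
    show "AE y in resolvent_law r x. (\<lambda>n. f0 n (max 0 y)) \<longlonglongrightarrow> h (max 0 y)"
      using tendsto_mult[OF tendsto_const l0] by (auto simp: f0_def)
    show "AE y in resolvent_law r x. norm (f0 n (max 0 y)) \<le> 43 * C" for n using bf0 by auto
    show "(\<lambda>y. f0 n (max 0 y)) \<in> borel_measurable (resolvent_law r x)" for n
      unfolding f0_def by (rule meas) (intro continuous_on_mult ch c\<psi>)
  qed (simp_all add: meas ch)
  moreover have "(\<lambda>n. LINT y|resolvent_law r x. f2 n (max 0 y)) \<longlonglongrightarrow> (LINT y|resolvent_law r x. h'' (max 0 y))"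
  proof (rule integral_dominated_convergence[where w = "\<lambda>_. 43 * C"])
    show "AE y in resolvent_law r x. (\<lambda>n. f2 n (max 0 y)) \<longlonglongrightarrow> h'' (max 0 y)"
    proof (rule AE_I2)
      fix y
      have "(\<lambda>n. h'' (max 0 y) * \<psi>0 n (max 0 y) + 2 * h' (max 0 y) * \<psi>1 n (max 0 y) + h (max 0 y) * \<psi>2 n (max 0 y))
          \<longlonglongrightarrow> h'' (max 0 y) * 1 + 2 * h' (max 0 y) * 0 + h (max 0 y) * 0"
        by (intro tendsto_intros l0 l1 l2)
      then show "(\<lambda>n. f2 n (max 0 y)) \<longlonglongrightarrow> h'' (max 0 y)" by (simp add: f2_def)
    qed
    show "AE y in resolvent_law r x. norm (f2 n (max 0 y)) \<le> 43 * C" for n using bf2 by auto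
    show "(\<lambda>y. f2 n (max 0 y)) \<in> borel_measurable (resolvent_law r x)" for n
      unfolding f2_def by (rule meas) (intro continuous_on_add continuous_on_mult continuous_on_const cont ch c\<psi>)
  qed (simp_all add: meas cont)
  ultimately have "(\<lambda>n. r * (LINT y|resolvent_law r x. f0 n (max 0 y)) - (LINT y|resolvent_law r x. f2 n (max 0 y)) / 2)
      \<longlonglongrightarrow> r * (LINT y|resolvent_law r x. h (max 0 y)) - (LINT y|resolvent_law r x. h'' (max 0 y)) / 2"
    by (intro tendsto_intros) simp_all
  moreover have "(\<lambda>n. r * f0 n x) \<longlonglongrightarrow> r * h x"
    using tendsto_mult[OF tendsto_const[of r] tendsto_mult[OF tendsto_const[of "h x"] l0[of x]]] by (simp add: f0_def)
  ultimately show ?thesis using LIMSEQ_unique by (simp add: eq)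
qed

section \<open>Distribution function of the law at an exponential time\<close>

lemma AE_resolvent_law_nonneg: "0 \<le> x \<Longrightarrow> AE y in resolvent_law r x. 0 \<le> y"
proof -
  assume x: "0 \<le> x"
  then have xS: "x \<in> {0..}" by simp
  have "AE z in exponential_law r \<Otimes>\<^sub>M P x. 0 \<le> (case z of (t, \<omega>) \<Rightarrow> X (max 0 t) \<omega>)"
  proof (rule AE_I2)
    fix z assume "z \<in> space (exponential_law r \<Otimes>\<^sub>M P x)"
    then show "0 \<le> (case z of (t, \<omega>) \<Rightarrow> X (max 0 t) \<omega>)"
      using X_in_S[of "max 0 (fst z)" "snd z"] xS by (auto simp: space_pair_measure)
  qed
  then show ?thesis unfolding resolvent_law_def
    by (subst AE_distr_iff[OF measurable_joint_kernel[OF xS]]) auto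
qed

text \<open>The function \<open>h\<close> solves \<open>r h - h''/2 = exp (- \<kappa> max 0 (y - b))\<close>; the coefficients of \<open>G\<close> make
  \<open>G\<close>, \<open>G'\<close>, \<open>G''\<close> vanish at \<open>0\<close>, and \<open>c\<close> removes the growing exponential from \<open>h\<close>.\<close>

lemma resolvent_law_exponential:
  assumes r: "r > 0" and x: "0 \<le> x" and b: "0 \<le> b" and \<theta>: "\<theta> = sqrt (2 * r)" and \<kappa>: "\<theta> < \<kappa>"
  defines "\<delta> \<equiv> 2 / (\<kappa>\<^sup>2 - \<theta>\<^sup>2)"
  defines "\<alpha> \<equiv> (2 / \<theta>\<^sup>2 + \<delta> - \<kappa> * \<delta> / \<theta>) / 2" and "\<beta> \<equiv> (2 / \<theta>\<^sup>2 + \<delta> + \<kappa> * \<delta> / \<theta>) / 2"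
  shows "(LINT y|resolvent_law r x. exp (- \<kappa> * max 0 (y - b))) =
    r * (2 / \<theta>\<^sup>2 - 2 * \<alpha> * exp (- \<theta> * b) * cosh (\<theta> * x) + (\<alpha> * exp (\<theta> * max 0 (x - b)) + \<beta> * exp (- \<theta> * max 0 (x - b))
      - 2 / \<theta>\<^sup>2 - \<delta> * exp (- \<kappa> * max 0 (x - b))))"
proof -
  have \<theta>0: "0 < \<theta>" and \<theta>2: "\<theta>\<^sup>2 = 2 * r" using r \<theta> by auto
  have \<kappa>2: "\<kappa>\<^sup>2 - \<theta>\<^sup>2 > 0" using \<kappa> \<theta>0 by (simp add: power_strict_mono)
  have \<delta>: "\<delta> * (\<kappa>\<^sup>2 - \<theta>\<^sup>2) = 2"
  proof -
    have "2 / d * d = 2" if "d > 0" for d :: real using that by simp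
    from this[OF \<kappa>2] show ?thesis by (simp only: \<delta>_def)
  qed
  define c where "c = 2 * \<alpha> * exp (- \<theta> * b)"
  define G where "G v = \<alpha> * exp (\<theta> * v) + \<beta> * exp (- \<theta> * v) - 2 / \<theta>\<^sup>2 - \<delta> * exp (- \<kappa> * v)" for v
  define G1 where "G1 v = \<theta> * \<alpha> * exp (\<theta> * v) - \<theta> * \<beta> * exp (- \<theta> * v) + \<kappa> * \<delta> * exp (- \<kappa> * v)" for v
  define G2 where "G2 v = \<theta>\<^sup>2 * \<alpha> * exp (\<theta> * v) + \<theta>\<^sup>2 * \<beta> * exp (- \<theta> * v) - \<kappa>\<^sup>2 * \<delta> * exp (- \<kappa> * v)" for v
  define h where "h y = 2 / \<theta>\<^sup>2 - c * cosh (\<theta> * y) + G (max 0 (y - b))" for y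
  define h1 where "h1 y = - c * \<theta> * sinh (\<theta> * y) + G1 (max 0 (y - b))" for y
  define h2 where "h2 y = - c * \<theta>\<^sup>2 * cosh (\<theta> * y) + G2 (max 0 (y - b))" for y
  \<comment> \<open>\<open>\<alpha>\<close> and \<open>\<beta>\<close> solve these two equations,
    which express G(0) = 0 and G'(0) = 0; the choice of \<open>\<delta>\<close> then gives G''(0) =
    0.\<close>
  have ab: "\<alpha> + \<beta> = 2 / \<theta>\<^sup>2 + \<delta>" "\<alpha> - \<beta> = - (\<kappa> * \<delta> / \<theta>)" unfolding \<alpha>_def \<beta>_def by (simp_all add: field_simps)
  have G1_0: "G1 0 = 0"
  proof -
    have "G1 0 = \<theta> * (\<alpha> - \<beta>) + \<kappa> * \<delta>" by (simp add: G1_def algebra_simps)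
    then show ?thesis using \<theta>0 by (simp add: ab)
  qed
  have G2_0: "G2 0 = 0"
  proof -
    have "G2 0 = \<theta>\<^sup>2 * (\<alpha> + \<beta>) - \<kappa>\<^sup>2 * \<delta>" by (simp add: G2_def algebra_simps)
    also have "\<dots> = 2 + \<theta>\<^sup>2 * \<delta> - \<kappa>\<^sup>2 * \<delta>" using \<theta>0 unfolding ab(1) by (simp add: distrib_left)
    also have "\<dots> = 2 - \<delta> * (\<kappa>\<^sup>2 - \<theta>\<^sup>2)" by (simp add: algebra_simps)
    finally show ?thesis by (simp add: \<delta>)
  qed
  have dG: "(G has_real_derivative G1 v) (at v)" for v
    unfolding G_def[abs_def] G1_def by (auto intro!: derivative_eq_intros)
  have dG1: "(G1 has_real_derivative G2 v) (at v)" for v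
    unfolding G1_def[abs_def] G2_def by (auto intro!: derivative_eq_intros simp: power2_eq_square)
  have shift: "((\<lambda>y. y - b) has_real_derivative 1) (at y)" for y by (auto intro!: derivative_eq_intros)
  have dGm: "((\<lambda>y. G (max 0 (y - b))) has_real_derivative G1 (max 0 (y - b))) (at y)" for y
    using DERIV_chain2[OF has_real_derivative_comp_max[of G G1, OF dG G1_0] shift, of y] by simp
  have dG1m: "((\<lambda>y. G1 (max 0 (y - b))) has_real_derivative G2 (max 0 (y - b))) (at y)" for y
    using DERIV_chain2[OF has_real_derivative_comp_max[of G1 G2, OF dG1 G2_0] shift, of y] by simp
  have d1: "(h has_real_derivative h1 y) (at y within {0..})" for y
    unfolding h_def[abs_def] h1_def
    by (rule has_field_derivative_at_within) (auto intro!: derivative_eq_intros dGm)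
  have d2: "(h1 has_real_derivative h2 y) (at y within {0..})" for y
    unfolding h1_def[abs_def] h2_def
    by (rule has_field_derivative_at_within) (auto intro!: derivative_eq_intros dG1m simp: power2_eq_square)
  have cont: "continuous_on {0..} h2"
    unfolding h2_def[abs_def] G2_def[abs_def] cosh_def by (intro continuous_intros)
  have neumann: "h1 0 = 0" using b G1_0 by (simp add: h1_def)
  \<comment> \<open>The operator \<theta>^2 - d^2/dy^2 annihilates the cosh and the exponentials of
    rate \<theta>; the constants contribute 2 - 2 and the \<open>\<delta>\<close> term contributes 2
    exp(-\<kappa> v).\<close>
  have ode: "r * h y - h2 y / 2 = exp (- \<kappa> * max 0 (y - b))" for y
  proof -
    define v where "v = max 0 (y - b)"
    have "r * h y - h2 y / 2 = (\<theta>\<^sup>2 * h y - h2 y) / 2" using \<theta>2 by simp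
    also have "\<theta>\<^sup>2 * h y - h2 y = 2 + (\<theta>\<^sup>2 * G v - G2 v)"
      using \<theta>0 by (simp add: h_def h2_def v_def[symmetric] algebra_simps)
    also have "\<theta>\<^sup>2 * G v - G2 v = \<delta> * (\<kappa>\<^sup>2 - \<theta>\<^sup>2) * exp (- \<kappa> * v) - 2"
      using \<theta>0 by (simp add: G_def G2_def algebra_simps)
    finally show ?thesis by (simp add: \<delta> v_def)
  qed
  \<comment> \<open>The identity behind the choice of \<open>c\<close>: beyond \<open>b\<close> the
    growing parts of c cosh(\<theta> y) and of G(y - b) coincide and cancel in \<open>h\<close>,
    which leaves decaying exponentials.\<close>
  have growth: "c * exp (\<theta> * y) / 2 = \<alpha> * exp (\<theta> * (y - b))" for y
  proof -
    have "exp (- \<theta> * b) * exp (\<theta> * y) = exp (\<theta> * (y - b))" by (simp add: mult_exp_exp algebra_simps)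
    then show ?thesis by (simp add: c_def algebra_simps)
  qed
  have exp_le: "exp (- (a * v)) \<le> 1" if "0 \<le> v" "0 \<le> a" for a v :: real using that by simp
  have far: "h y = \<beta> * exp (- \<theta> * (y - b)) - \<delta> * exp (- \<kappa> * (y - b)) - c / 2 * exp (- \<theta> * y)"
      "h1 y = c / 2 * \<theta> * exp (- \<theta> * y) - \<theta> * \<beta> * exp (- \<theta> * (y - b)) + \<kappa> * \<delta> * exp (- \<kappa> * (y - b))"
      "h2 y = \<theta>\<^sup>2 * \<beta> * exp (- \<theta> * (y - b)) - \<kappa>\<^sup>2 * \<delta> * exp (- \<kappa> * (y - b)) - c / 2 * \<theta>\<^sup>2 * exp (- \<theta> * y)" if "b \<le> y" for y
  proof -
    have m: "max 0 (y - b) = y - b" using that by simp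
    have ch: "c * cosh (\<theta> * y) = \<alpha> * exp (\<theta> * (y - b)) + c / 2 * exp (- \<theta> * y)"
      using growth[of y] by (simp add: cosh_def field_simps)
    have sh: "c * sinh (\<theta> * y) = \<alpha> * exp (\<theta> * (y - b)) - c / 2 * exp (- \<theta> * y)"
      using growth[of y] by (simp add: sinh_def field_simps)
    show "h y = \<beta> * exp (- \<theta> * (y - b)) - \<delta> * exp (- \<kappa> * (y - b)) - c / 2 * exp (- \<theta> * y)"
      unfolding h_def G_def m ch by simp
    have "- c * \<theta> * sinh (\<theta> * y) = - \<theta> * (c * sinh (\<theta> * y))" by simp
    then show "h1 y = c / 2 * \<theta> * exp (- \<theta> * y) - \<theta> * \<beta> * exp (- \<theta> * (y - b)) + \<kappa> * \<delta> * exp (- \<kappa> * (y - b))"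
      unfolding h1_def G1_def m sh by (simp add: algebra_simps)
    have "- c * \<theta>\<^sup>2 * cosh (\<theta> * y) = - \<theta>\<^sup>2 * (c * cosh (\<theta> * y))" by simp
    then show "h2 y = \<theta>\<^sup>2 * \<beta> * exp (- \<theta> * (y - b)) - \<kappa>\<^sup>2 * \<delta> * exp (- \<kappa> * (y - b)) - c / 2 * \<theta>\<^sup>2 * exp (- \<theta> * y)"
      unfolding h2_def G2_def m ch by (simp add: algebra_simps)
  qed
  have combo: "\<bar>A * exp (- (\<theta> * (y - b)))\<bar> \<le> \<bar>A\<bar>" "\<bar>A * exp (- (\<kappa> * (y - b)))\<bar> \<le> \<bar>A\<bar>" "\<bar>A * exp (- (\<theta> * y))\<bar> \<le> \<bar>A\<bar>"
    if "b \<le> y" for y A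
    using that b \<theta>0 \<kappa> by (auto simp: abs_mult intro!: mult_right_le_one_le)
  \<comment> \<open>Decay gives the bound beyond \<open>b\<close>, compactness gives it on
    [0,b].\<close>
  have bdd: "\<exists>C. \<forall>y\<ge>0. \<bar>g y\<bar> \<le> C" if c: "continuous_on {0..} g" and far: "\<And>y. b \<le> y \<Longrightarrow> \<bar>g y\<bar> \<le> B" for g :: "real \<Rightarrow> real" and B
  proof -
    have "compact (g ` {0..b})"
      by (intro compact_continuous_image continuous_on_subset[OF c]) auto
    then obtain B' where B': "\<And>y. y \<in> {0..b} \<Longrightarrow> \<bar>g y\<bar> \<le> B'"
      using compact_imp_bounded by (fastforce simp: bounded_iff)
    have "\<bar>g y\<bar> \<le> max B B'" if "0 \<le> y" for y
      using far[of y] B'[of y] that by (cases "b \<le> y") auto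
    then show ?thesis by blast
  qed
  have chh: "continuous_on {0..} h" "continuous_on {0..} h1"
    using d1 d2 by (auto intro!: DERIV_continuous_on)
  obtain C0 where C0: "\<And>y. 0 \<le> y \<Longrightarrow> \<bar>h y\<bar> \<le> C0"
  proof -
    have "\<bar>h y\<bar> \<le> \<bar>\<beta>\<bar> + \<bar>\<delta>\<bar> + \<bar>c / 2\<bar>" if "b \<le> y" for y
      using combo(1)[OF that, of \<beta>] combo(2)[OF that, of \<delta>] combo(3)[OF that, of "c / 2"] far(1)[OF that]
      by (simp add: abs_le_iff)
    from bdd[OF chh(1) this] show ?thesis using that by blast
  qed
  obtain C1 where C1: "\<And>y. 0 \<le> y \<Longrightarrow> \<bar>h1 y\<bar> \<le> C1"
  proof -
    have "\<bar>h1 y\<bar> \<le> \<bar>c / 2 * \<theta>\<bar> + \<bar>\<theta> * \<beta>\<bar> + \<bar>\<kappa> * \<delta>\<bar>" if "b \<le> y" for y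
      using combo(1)[OF that, of "\<theta> * \<beta>"] combo(2)[OF that, of "\<kappa> * \<delta>"] combo(3)[OF that, of "c / 2 * \<theta>"]
      unfolding far(2)[OF that] minus_mult_left[symmetric] by linarith
    from bdd[OF chh(2) this] show ?thesis using that by blast
  qed
  obtain C2 where C2: "\<And>y. 0 \<le> y \<Longrightarrow> \<bar>h2 y\<bar> \<le> C2"
  proof -
    have "\<bar>h2 y\<bar> \<le> \<bar>\<theta>\<^sup>2 * \<beta>\<bar> + \<bar>\<kappa>\<^sup>2 * \<delta>\<bar> + \<bar>c / 2 * \<theta>\<^sup>2\<bar>" if "b \<le> y" for y
      using combo(1)[OF that, of "\<theta>\<^sup>2 * \<beta>"] combo(2)[OF that, of "\<kappa>\<^sup>2 * \<delta>"] combo(3)[OF that, of "c / 2 * \<theta>\<^sup>2"]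
      unfolding far(3)[OF that] minus_mult_left[symmetric] by linarith
    from bdd[OF cont this] show ?thesis using that by blast
  qed
  define C where "C = max C0 (max C1 C2)"
  have C: "\<And>y. 0 \<le> y \<Longrightarrow> \<bar>h y\<bar> \<le> C" "\<And>y. 0 \<le> y \<Longrightarrow> \<bar>h1 y\<bar> \<le> C" "\<And>y. 0 \<le> y \<Longrightarrow> \<bar>h2 y\<bar> \<le> C"
    using C0 C1 C2 by (auto simp: C_def le_max_iff_disj)
  have xS: "x \<in> {0..}" using x by simp
  interpret \<mu>: prob_space "resolvent_law r x" using r xS by (rule prob_space_resolvent_law)
  have i: "integrable (resolvent_law r x) (\<lambda>y. g (max 0 y))"
    if "continuous_on {0..} g" "\<And>y. 0 \<le> y \<Longrightarrow> \<bar>g y\<bar> \<le> C" for g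
    using borel_measurable_comp_max[OF that(1)] that(2)
    by (intro \<mu>.integrable_const_bound[where B = C]) (auto cong: measurable_cong_sets)
  have "r * h x = r * (LINT y|resolvent_law r x. h (max 0 y)) - (LINT y|resolvent_law r x. h2 (max 0 y)) / 2"
    by (rule resolvent_law_bounded_function[OF r x d1 d2 cont neumann C, symmetric])
  also have "\<dots> = (LINT y|resolvent_law r x. r * h (max 0 y) - h2 (max 0 y) / 2)"
    using i[OF chh(1) C(1)] i[OF cont C(3)] by simp
  also have "\<dots> = (LINT y|resolvent_law r x. exp (- \<kappa> * max 0 (y - b)))"
  proof (rule Bochner_Integration.integral_cong)
    fix y
    have "max 0 (max 0 y - b) = max 0 (y - b)" using b by auto
    then show "r * h (max 0 y) - h2 (max 0 y) / 2 = exp (- \<kappa> * max 0 (y - b))" by (simp add: ode)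
  qed simp
  finally show ?thesis by (simp add: h_def G_def c_def)
qed

text \<open>As \<kappa> grows, exp(-\<kappa> (y - b)^+) tends to the indicator of y \<le> b, so the
  formula is the limit of \<open>resolvent_law_exponential\<close>.\<close>

lemma resolvent_law_atMost:
  assumes r: "r > 0" and x: "0 \<le> x" and b: "0 \<le> b" and \<theta>: "\<theta> = sqrt (2 * r)"
  shows "measure (resolvent_law r x) {..b} = cosh (\<theta> * max 0 (x - b)) - exp (- \<theta> * b) * cosh (\<theta> * x)"
proof -
  have xS: "x \<in> {0..}" using x by simp
  interpret \<mu>: prob_space "resolvent_law r x" using r xS by (rule prob_space_resolvent_law)
  have \<theta>0: "0 < \<theta>" and \<theta>2: "\<theta>\<^sup>2 = 2 * r" using r \<theta> by auto
  \<comment> \<open>Chosen above \<open>\<theta>\<close> and tending to infinity so that \<kappa>^2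
    - \<theta>^2 factors as \<theta>^2 (n + 1) (n + 3) and the exponentials become powers of one
    base.\<close>
  define \<kappa> where "\<kappa> n = \<theta> * (real n + 2)" for n
  define \<delta> where "\<delta> n = 2 / ((\<kappa> n)\<^sup>2 - \<theta>\<^sup>2)" for n
  define \<alpha> where "\<alpha> n = (2 / \<theta>\<^sup>2 + \<delta> n - \<kappa> n * \<delta> n / \<theta>) / 2" for n
  define \<beta> where "\<beta> n = (2 / \<theta>\<^sup>2 + \<delta> n + \<kappa> n * \<delta> n / \<theta>) / 2" for n
  define v where "v = max 0 (x - b)"
  have \<kappa>: "\<theta> < \<kappa> n" for n using \<theta>0 mult_strict_left_mono[of 1 "real n + 2" \<theta>] by (simp add: \<kappa>_def)
  have \<delta>_eq: "\<delta> n = 2 / (\<theta>\<^sup>2 * ((real n + 1) * (real n + 3)))" for n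
    unfolding \<delta>_def \<kappa>_def by (simp add: power2_eq_square algebra_simps)
  have \<kappa>\<delta>_eq: "\<kappa> n * \<delta> n / \<theta> = 2 / \<theta>\<^sup>2 * ((real n + 2) / ((real n + 1) * (real n + 3)))" for n
    using \<theta>0 by (simp add: \<delta>_eq \<kappa>_def)
  have \<kappa>\<delta>_lim: "(\<lambda>n. \<kappa> n * \<delta> n / \<theta>) \<longlonglongrightarrow> 0"
  proof (rule tendsto_sandwich[where f = "\<lambda>_. 0" and h = "\<lambda>n. 2 / \<theta>\<^sup>2 * inverse (real (Suc n))"])
    show "\<forall>\<^sub>F n in sequentially. \<kappa> n * \<delta> n / \<theta> \<le> 2 / \<theta>\<^sup>2 * inverse (real (Suc n))"
    proof (intro always_eventually allI)
      fix n
      have "(real n + 2) / ((real n + 1) * (real n + 3)) \<le> inverse (real (Suc n))"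
        by (simp add: divide_simps) (simp add: algebra_simps)
      then show "\<kappa> n * \<delta> n / \<theta> \<le> 2 / \<theta>\<^sup>2 * inverse (real (Suc n))"
        unfolding \<kappa>\<delta>_eq by (intro mult_left_mono) auto
    qed
    show "(\<lambda>n. 2 / \<theta>\<^sup>2 * inverse (real (Suc n))) \<longlonglongrightarrow> 0"
      using tendsto_mult[OF tendsto_const[of "2 / \<theta>\<^sup>2"] LIMSEQ_inverse_real_of_nat] by simp
  qed (auto simp: \<kappa>\<delta>_eq)
  have \<delta>_nonneg: "0 \<le> \<delta> n" for n by (simp add: \<delta>_eq)
  have \<delta>_lim: "\<delta> \<longlonglongrightarrow> 0"
  proof (rule tendsto_sandwich[OF _ _ tendsto_const \<kappa>\<delta>_lim])
    show "\<forall>\<^sub>F n in sequentially. \<delta> n \<le> \<kappa> n * \<delta> n / \<theta>"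
    proof (intro always_eventually allI)
      fix n
      have "\<kappa> n * \<delta> n / \<theta> = (real n + 2) * \<delta> n" using \<theta>0 by (simp add: \<kappa>_def)
      moreover have "1 * \<delta> n \<le> (real n + 2) * \<delta> n" by (intro mult_right_mono \<delta>_nonneg) auto
      ultimately show "\<delta> n \<le> \<kappa> n * \<delta> n / \<theta>" by simp
    qed
  qed (use \<delta>_nonneg in auto)
  \<comment> \<open>Since \<delta> and \<kappa> \<delta> vanish in the limit, both coefficients tend
    to 1/\<theta>^2, and the two exponentials of rate \<theta> combine to a hyperbolic
    cosine.\<close>
  have \<alpha>_lim: "\<alpha> \<longlonglongrightarrow> 1 / \<theta>\<^sup>2" and \<beta>_lim: "\<beta> \<longlonglongrightarrow> 1 / \<theta>\<^sup>2"
  proof -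
    have "(\<lambda>n. (2 / \<theta>\<^sup>2 + \<delta> n - \<kappa> n * \<delta> n / \<theta>) / 2) \<longlonglongrightarrow> (2 / \<theta>\<^sup>2 + 0 - 0) / 2"
      by (intro tendsto_intros \<delta>_lim \<kappa>\<delta>_lim) simp
    then show "\<alpha> \<longlonglongrightarrow> 1 / \<theta>\<^sup>2" by (simp add: \<alpha>_def[abs_def])
    have "(\<lambda>n. (2 / \<theta>\<^sup>2 + \<delta> n + \<kappa> n * \<delta> n / \<theta>) / 2) \<longlonglongrightarrow> (2 / \<theta>\<^sup>2 + 0 + 0) / 2"
      by (intro tendsto_intros \<delta>_lim \<kappa>\<delta>_lim) simp
    then show "\<beta> \<longlonglongrightarrow> 1 / \<theta>\<^sup>2" by (simp add: \<beta>_def[abs_def])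
  qed
  have tail_lim: "(\<lambda>n. \<delta> n * exp (- \<kappa> n * v)) \<longlonglongrightarrow> 0"
  proof (rule tendsto_sandwich[OF _ _ tendsto_const \<delta>_lim])
    have "exp (- \<kappa> n * v) \<le> 1" for n using \<theta>0 by (auto simp: \<kappa>_def v_def)
    then show "\<forall>\<^sub>F n in sequentially. \<delta> n * exp (- \<kappa> n * v) \<le> \<delta> n"
      by (intro always_eventually allI mult_right_le_one_le \<delta>_nonneg) auto
  qed (use \<delta>_nonneg in auto)
  have "(\<lambda>n. r * (2 / \<theta>\<^sup>2 - 2 * \<alpha> n * exp (- \<theta> * b) * cosh (\<theta> * x) + (\<alpha> n * exp (\<theta> * v) + \<beta> n * exp (- \<theta> * v)
      - 2 / \<theta>\<^sup>2 - \<delta> n * exp (- \<kappa> n * v)))) \<longlonglongrightarrow>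
      r * (2 / \<theta>\<^sup>2 - 2 * (1 / \<theta>\<^sup>2) * exp (- \<theta> * b) * cosh (\<theta> * x) + ((1 / \<theta>\<^sup>2) * exp (\<theta> * v) + (1 / \<theta>\<^sup>2) * exp (- \<theta> * v)
      - 2 / \<theta>\<^sup>2 - 0))" (is "_ \<longlonglongrightarrow> ?L")
    by (intro tendsto_intros \<alpha>_lim \<beta>_lim tail_lim)
  also have "?L = cosh (\<theta> * v) - exp (- \<theta> * b) * cosh (\<theta> * x)"
  proof -
    have eq: "r * (2 / t - 2 * (1 / t) * e * k + ((1 / t) * e1 + (1 / t) * e2 - 2 / t - 0)) = (2 * r / t) * ((e1 + e2) / 2 - e * k)"
      for t e k e1 e2 :: real by (cases "t = 0") (auto simp: field_simps)
    have "2 * r / \<theta>\<^sup>2 = 1" using r \<theta>2 by simp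
    then show ?thesis unfolding eq using r by (simp add: cosh_def)
  qed
  finally have lim1: "(\<lambda>n. LINT y|resolvent_law r x. exp (- \<kappa> n * max 0 (y - b))) \<longlonglongrightarrow> cosh (\<theta> * v) - exp (- \<theta> * b) * cosh (\<theta> * x)"
    using resolvent_law_exponential[OF r x b \<theta> \<kappa>] by (simp only: \<alpha>_def \<beta>_def \<delta>_def v_def)
  have "(\<lambda>n. LINT y|resolvent_law r x. exp (- \<kappa> n * max 0 (y - b))) \<longlonglongrightarrow> (LINT y|resolvent_law r x. indicator {..b} y)"
  proof (rule integral_dominated_convergence[where w = "\<lambda>_. 1"])
    show "AE y in resolvent_law r x. (\<lambda>n. exp (- \<kappa> n * max 0 (y - b))) \<longlonglongrightarrow> indicator {..b} y"
    proof (rule AE_I2)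
      fix y
      show "(\<lambda>n. exp (- \<kappa> n * max 0 (y - b))) \<longlonglongrightarrow> indicator {..b} y"
      proof (cases "y \<le> b")
        case True then show ?thesis by simp
      next
        case False
        define q where "q = exp (- (\<theta> * (y - b)))"
        have "0 < \<theta> * (y - b)" using \<theta>0 False by simp
        then have q: "0 \<le> q" "q < 1" by (auto simp: q_def)
        have "exp (- \<kappa> n * max 0 (y - b)) = q ^ (n + 2)" for n
          unfolding q_def exp_of_nat_mult[symmetric] using False by (simp add: \<kappa>_def algebra_simps)
        moreover have "(\<lambda>n. q ^ (n + 2)) \<longlonglongrightarrow> 0"
          by (rule LIMSEQ_ignore_initial_segment[OF LIMSEQ_power_zero]) (use q in simp)
        ultimately show ?thesis using False by simp
      qed
    qed
    show "AE y in resolvent_law r x. norm (exp (- \<kappa> n * max 0 (y - b))) \<le> 1" for n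
      using \<theta>0 by (intro AE_I2) (auto simp: \<kappa>_def)
  qed measurable
  with lim1 show ?thesis using LIMSEQ_unique by (fastforce simp: v_def)
qed

text \<open>There is no atom at \<open>b\<close>: the formula for closed half-lines is continuous in
  the endpoint, so endpoints increasing to \<open>b\<close> squeeze the mass of the open
  half-line.\<close>

lemma resolvent_law_lessThan:
  assumes r: "r > 0" and x: "0 \<le> x" and b: "0 < b" and \<theta>: "\<theta> = sqrt (2 * r)"
  shows "measure (resolvent_law r x) {..<b} = cosh (\<theta> * max 0 (x - b)) - exp (- \<theta> * b) * cosh (\<theta> * x)"
    (is "_ = ?M b")
proof (rule antisym)
  have xS: "x \<in> {0..}" using x by simp
  interpret \<mu>: prob_space "resolvent_law r x" using r xS by (rule prob_space_resolvent_law)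
  show "measure (resolvent_law r x) {..<b} \<le> ?M b"
    unfolding resolvent_law_atMost[OF r x less_imp_le[OF b] \<theta>, symmetric]
    by (rule \<mu>.finite_measure_mono) auto
  define c where "c n = b - b * inverse (real (Suc n))" for n
  have c: "0 \<le> c n" "c n < b" for n
    using b mult_left_mono[of "inverse (real (Suc n))" 1 b] by (auto simp: c_def inverse_le_1_iff)
  have "?M (c n) \<le> measure (resolvent_law r x) {..<b}" for n
    unfolding resolvent_law_atMost[OF r x c(1) \<theta>, symmetric]
    by (rule \<mu>.finite_measure_mono) (use c[of n] in auto)
  moreover have "(\<lambda>n. ?M (c n)) \<longlonglongrightarrow> ?M b"
  proof -
    have "c \<longlonglongrightarrow> b"
      using tendsto_diff[OF tendsto_const[of b] tendsto_mult[OF tendsto_const[of b] LIMSEQ_inverse_real_of_nat]] by (simp add: c_def[abs_def])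
    then show ?thesis unfolding cosh_def by (intro tendsto_intros)
  qed
  ultimately show "?M b \<le> measure (resolvent_law r x) {..<b}" by (intro LIMSEQ_le_const2) auto
qed

text \<open>The factor cosh(\<theta> x)/cosh(\<theta> b) is the Laplace transform \<open>L\<close>
  of the hitting time, and (1 - exp(-2 \<theta> b))/2 is the mass that the exponential-time law
  started in \<open>b\<close> gives to [0,b).\<close>

lemma resolvent_difference:
  assumes r: "r > 0" and b: "b > 0" and \<theta>: "\<theta> = sqrt (2 * r)" and x: "0 \<le> x" "x < b"
  shows "reflected_resolvent P X r (indicator {0..<b}) x - killed_resolvent P X r {b..} (indicator {0..<b}) x =
    cosh (\<theta> * x) / r * ((1 - exp (- 2 * \<theta> * b)) / (2 * cosh (\<theta> * b)))"
proof -
  define \<Phi> where "\<Phi> y = cosh (\<theta> * max 0 (y - b)) - exp (- \<theta> * b) * cosh (\<theta> * y)" for y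
  define L where "L = (LINT \<omega>|P x. (if hitting_time X {b..} \<omega> = \<infinity> then 0 else exp (- r * real_of_ereal (hitting_time X {b..} \<omega>))))"
  have xS: "x \<in> {0..}" and bS: "b \<in> {0..}" using x b by auto
  have below: "(LINT z|resolvent_law r y. indicator {0..<b} z) = \<Phi> y" if y: "y \<in> {0..}" for y
  proof -
    interpret \<mu>: prob_space "resolvent_law r y" using r y by (rule prob_space_resolvent_law)
    have "(LINT z|resolvent_law r y. indicator {0..<b} z :: real) = (LINT z|resolvent_law r y. indicator {..<b} z)"
    proof (rule integral_cong_AE)
      show "AE z in resolvent_law r y. indicator {0..<b} z = indicator {..<b} z"
        using AE_resolvent_law_nonneg[of y r] y by (auto simp: indicator_def)
    qed measurable
    also have "\<dots> = measure (resolvent_law r y) {..<b}" by simp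
    finally show ?thesis using resolvent_law_lessThan[OF r _ b \<theta>, of y] y by (simp add: \<Phi>_def)
  qed
  have above: "(LINT z|resolvent_law r y. indicator {b..} z) = 1 - \<Phi> y" if y: "y \<in> {0..}" for y
  proof -
    interpret \<mu>: prob_space "resolvent_law r y" using r y by (rule prob_space_resolvent_law)
    have sp: "space (resolvent_law r y) = UNIV" using sets_eq_imp_space_eq[OF sets_resolvent_law] by simp
    have "{b..} = UNIV - {..<b}" by auto
    then have "measure (resolvent_law r y) {b..} = 1 - measure (resolvent_law r y) {..<b}"
      using \<mu>.prob_compl[of "{..<b}"] by (simp add: sp)
    then show ?thesis using resolvent_law_lessThan[OF r _ b \<theta>, of y] y by (simp add: \<Phi>_def sp)
  qed
  have cont_\<Phi>: "continuous_on {0..} \<Phi>" unfolding \<Phi>_def[abs_def] cosh_def by (intro continuous_intros)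
  have ind: "indicator A \<in> borel_measurable borel" "bounded (range (indicator A :: real \<Rightarrow> real))" if "A \<in> sets borel" for A :: "real set"
    using that by (auto intro!: boundedI[where B = 1] simp: indicator_def)
  have f: "indicator {0..<b} \<in> borel_measurable borel" "bounded (range (indicator {0..<b} :: real \<Rightarrow> real))"
    and g: "indicator {b..} \<in> borel_measurable borel" "bounded (range (indicator {b..} :: real \<Rightarrow> real))"
    by (intro ind; simp)+
  \<comment> \<open>The closed form \<open>\<Phi>\<close> provides the continuity in the starting
    point that the diffusion axioms do not state.\<close>
  have cf: "continuous_on {0..} (\<lambda>y. LINT z|resolvent_law r y. (indicator {0..<b} z :: real))"
    using cont_\<Phi> by (subst continuous_on_cong[OF refl, where g = \<Phi>]) (auto intro!: below simp del: Bochner_Integration.integral_indicator)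
  have cg: "continuous_on {0..} (\<lambda>y. LINT z|resolvent_law r y. (indicator {b..} z :: real))"
    using continuous_on_diff[OF continuous_on_const[of _ 1] cont_\<Phi>] by (subst continuous_on_cong[OF refl, where g = "\<lambda>y. 1 - \<Phi> y"]) (auto intro!: above simp del: Bochner_Integration.integral_indicator)
  have kg: "killed_resolvent P X r {b..} (indicator {b..}) x = 0"
  proof -
    have "(LINT s|exponential_law r. indicator {s. ereal s < hitting_time X {b..} \<omega>} s * indicator {b..} (X (max 0 s) \<omega>) :: real) = 0"
      if \<omega>: "\<omega> \<in> space N" "X 0 \<omega> = x" for \<omega>
    proof -
      \<comment> \<open>Before the hitting time the path stays below \<open>b\<close>. Negative
        \<open>s\<close> satisfy the condition too; for them the clamped time is 0 and the start
        below \<open>b\<close> decides.\<close>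
      have "\<not> b \<le> X (max 0 s) \<omega>" if s: "ereal s < hitting_time X {b..} \<omega>" for s
      proof
        assume le: "b \<le> X (max 0 s) \<omega>"
        then have "hitting_time X {b..} \<omega> \<le> ereal (max 0 s)"
          by (subst hitting_time_le_iff[OF \<omega>(1)]) (auto intro!: bexI[of _ "max 0 s"])
        with s le x \<omega> show False by (cases "0 \<le> s") (auto simp: max_def)
      qed
      then have "indicator {s. ereal s < hitting_time X {b..} \<omega>} s * indicator {b..} (X (max 0 s) \<omega>) = (0 :: real)" for s
        by (auto simp: indicator_def)
      then show ?thesis by (intro integral_eq_zero_AE AE_I2)
    qed
    then have "AE \<omega> in P x. (1 / r) * (LINT s|exponential_law r. indicator {s. ereal s < hitting_time X {b..} \<omega>} s * indicator {b..} (X (max 0 s) \<omega>)) = 0"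
      using start_AE[OF xS] by auto
    then show ?thesis unfolding killed_resolvent_eq[OF r xS g(1)] by (rule integral_eq_zero_AE)
  qed
  \<comment> \<open>As the killed part vanishes, this is a linear equation for the single unknown
    \<open>L\<close>.\<close>
  have "(1 / r) * (1 - \<Phi> x) = (1 / r) * (1 - \<Phi> b) * L"
    using reflected_minus_killed_resolvent[OF r xS x(2) g cg] reflected_resolvent_eq[OF r xS g] above[OF xS] above[OF bS] kg
    by (simp add: L_def)
  then have L: "1 - \<Phi> x = (1 - \<Phi> b) * L" using r by simp
  have \<Phi>: "\<Phi> x = 1 - exp (- \<theta> * b) * cosh (\<theta> * x)" "\<Phi> b = 1 - exp (- \<theta> * b) * cosh (\<theta> * b)"
    using x by (auto simp: \<Phi>_def)
  have ch: "cosh (\<theta> * b) > 0" by (rule cosh_real_pos)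
  have "exp (- \<theta> * b) * cosh (\<theta> * x) = exp (- \<theta> * b) * (cosh (\<theta> * b) * L)" using L by (simp add: \<Phi> algebra_simps)
  then have "cosh (\<theta> * x) = cosh (\<theta> * b) * L" by simp
  then have L_eq: "L = cosh (\<theta> * x) / cosh (\<theta> * b)" using ch by (simp add: field_simps)
  have "exp (- \<theta> * b) * cosh (\<theta> * b) = (1 + exp (- 2 * \<theta> * b)) / 2"
  proof -
    have "exp (- \<theta> * b) * cosh (\<theta> * b) = (exp (- \<theta> * b) * exp (\<theta> * b) + exp (- \<theta> * b) * exp (- (\<theta> * b))) / 2"
      by (simp add: cosh_def algebra_simps)
    also have "\<dots> = (1 + exp (- 2 * \<theta> * b)) / 2" unfolding mult_exp_exp by simp
    finally show ?thesis .
  qed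
  then have \<Phi>b: "\<Phi> b = (1 - exp (- 2 * \<theta> * b)) / 2" unfolding \<Phi> by (simp add: field_simps)
  have "reflected_resolvent P X r (indicator {0..<b}) x - killed_resolvent P X r {b..} (indicator {0..<b}) x = (1 / r) * \<Phi> b * L"
    using reflected_minus_killed_resolvent[OF r xS x(2) f cf] below[OF bS] by (simp add: L_def)
  also have "\<dots> = cosh (\<theta> * x) / r * ((1 - exp (- 2 * \<theta> * b)) / (2 * cosh (\<theta> * b)))"
    unfolding \<Phi>b L_eq by (simp add: ac_simps)
  finally show ?thesis .
qed

end

section \<open>Brownian motion on the dyadic rationals\<close>

abbreviation gaussian_sequence :: "(nat \<Rightarrow> real) measure" where
  "gaussian_sequence \<equiv> PiM UNIV (\<lambda>_. std_normal_distribution)"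

lemma prob_space_gaussian_sequence: "prob_space gaussian_sequence"
  by (intro prob_space_PiM prob_space_normal_density) simp

lemma sets_gaussian_sequence: "sets gaussian_sequence = sets (PiM UNIV (\<lambda>_. borel))"
  by (rule sets_PiM_cong) auto

lemma space_gaussian_sequence [simp]: "space gaussian_sequence = UNIV"
  by (simp add: space_PiM)

lemma measurable_gaussian_coordinate [measurable]: "(\<lambda>\<omega>. \<omega> i) \<in> borel_measurable gaussian_sequence"
  unfolding measurable_cong_sets[OF sets_gaussian_sequence refl] by (rule measurable_component_singleton) simp

lemma distr_gaussian_coordinate: "distr gaussian_sequence borel (\<lambda>\<omega>. \<omega> i) = std_normal_distribution"
proof -
  have "distr gaussian_sequence borel (\<lambda>\<omega>. \<omega> i) = distr gaussian_sequence std_normal_distribution (\<lambda>\<omega>. \<omega> i)"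
    by (rule distr_cong) auto
  also have "\<dots> = std_normal_distribution"
    by (rule distr_PiM_component) (auto intro: prob_space_normal_density)
  finally show ?thesis .
qed

lemma indep_gaussian_coordinates:
  "prob_space.indep_vars gaussian_sequence (\<lambda>_. borel) (\<lambda>i \<omega>. \<omega> i) UNIV"
proof -
  interpret prob_space gaussian_sequence by (rule prob_space_gaussian_sequence)
  have "distr gaussian_sequence (PiM UNIV (\<lambda>_. borel)) (\<lambda>\<omega>. \<lambda>i\<in>UNIV. \<omega> i) = gaussian_sequence"
    using distr_id2[OF sets_gaussian_sequence[symmetric]] by (simp add: restrict_def)
  then show ?thesis
    by (subst indep_vars_iff_distr_eq_PiM') (simp_all add: distr_gaussian_coordinate)
qed

text \<open>The steps of the walk at level \<open>n\<close> are pair averages of those at level \<open>n + 1\<close>, which makes the laws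
  of the walks consistent.\<close>

definition pair_average :: "(nat \<Rightarrow> real) \<Rightarrow> nat \<Rightarrow> real" where
  "pair_average \<omega> k = (\<omega> (2 * k) + \<omega> (2 * k + 1)) / sqrt 2"

lemma measurable_pair_average: "pair_average \<in> gaussian_sequence \<rightarrow>\<^sub>M PiM UNIV (\<lambda>_. borel)"
  by (rule measurable_PiM_single') (auto simp: pair_average_def)

text \<open>Disjoint pairs are independent, and the sum of two independent standard normals divided
  by the square root of 2 is standard normal again.\<close>

lemma distr_pair_average: "distr gaussian_sequence (PiM UNIV (\<lambda>_. borel)) pair_average = gaussian_sequence"
proof -
  interpret prob_space gaussian_sequence by (rule prob_space_gaussian_sequence)
  have coord: "distributed gaussian_sequence lborel (\<lambda>\<omega>. \<omega> i) (normal_density 0 1)" for i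
    unfolding distributed_def
  proof (intro conjI)
    show "distr gaussian_sequence lborel (\<lambda>\<omega>. \<omega> i) = std_normal_distribution"
      using distr_gaussian_coordinate[of i] by (simp cong: distr_cong)
  qed auto
  have "distributed gaussian_sequence lborel (\<lambda>\<omega>. pair_average \<omega> k) (normal_density 0 1)" for k
  proof -
    have "indep_var borel ((\<lambda>x. x (2 * k)) \<circ> (\<lambda>\<omega>. restrict (\<lambda>i. \<omega> i) {2 * k})) borel ((\<lambda>x. x (2 * k + 1)) \<circ> (\<lambda>\<omega>. restrict (\<lambda>i. \<omega> i) {2 * k + 1}))"
      by (rule indep_var_compose[OF indep_var_restrict[OF indep_gaussian_coordinates]]) auto
    then have "indep_var borel (\<lambda>\<omega>. \<omega> (2 * k)) borel (\<lambda>\<omega>. \<omega> (2 * k + 1))" by (simp add: comp_def)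
    from add_indep_normal[OF this _ _ coord coord]
    have sum: "distributed gaussian_sequence lborel (\<lambda>\<omega>. \<omega> (2 * k) + \<omega> (2 * k + 1)) (normal_density 0 (sqrt 2))" by simp
    from normal_density_affine[OF this, of "1 / sqrt 2" 0]
    show ?thesis by (simp add: pair_average_def)
  qed
  then have marg: "distr gaussian_sequence borel (\<lambda>\<omega>. pair_average \<omega> k) = std_normal_distribution" for k
    using distributed_distr_eq_density[of gaussian_sequence lborel "\<lambda>\<omega>. pair_average \<omega> k"] by (simp cong: distr_cong)
  have "indep_vars (\<lambda>k. PiM {2 * k, 2 * k + 1} (\<lambda>_. borel)) (\<lambda>k \<omega>. restrict (\<lambda>i. \<omega> i) {2 * k, 2 * k + 1}) (UNIV :: nat set)"
  proof (rule indep_vars_restrict[OF indep_gaussian_coordinates])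
    show "disjoint_family_on (\<lambda>k. {2 * k, 2 * k + 1}) (UNIV :: nat set)"
      by (auto simp: disjoint_family_on_def)
  qed auto
  then have "indep_vars (\<lambda>_. borel) (\<lambda>k \<omega>. (\<lambda>x. (x (2 * k) + x (2 * k + 1)) / sqrt 2) (restrict (\<lambda>i. \<omega> i) {2 * k, 2 * k + 1})) (UNIV :: nat set)"
    by (rule indep_vars_compose2) auto
  then have "indep_vars (\<lambda>_. borel) (\<lambda>k \<omega>. pair_average \<omega> k) UNIV" by (simp add: pair_average_def)
  then have "distr gaussian_sequence (PiM UNIV (\<lambda>_. borel)) (\<lambda>\<omega>. \<lambda>k\<in>UNIV. pair_average \<omega> k) =
      PiM UNIV (\<lambda>k. distr gaussian_sequence borel (\<lambda>\<omega>. pair_average \<omega> k))"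
    by (subst (asm) indep_vars_iff_distr_eq_PiM') (simp_all add: measurable_pair_average[THEN measurable_compose, OF measurable_component_singleton])
  then show ?thesis by (simp add: marg restrict_def)
qed

section \<open>Dyadic times and scaled Gaussian walks\<close>

definition dyadics :: "nat \<Rightarrow> real set" where
  "dyadics n = range (\<lambda>k :: nat. real k / 2 ^ n)"

definition dyadic_floor :: "nat \<Rightarrow> real \<Rightarrow> real" where
  "dyadic_floor n t = real (nat \<lfloor>2 ^ n * t\<rfloor>) / 2 ^ n"

text \<open>Scaled steps have variance 2^(-n), so at k/2^n the walk has variance k/2^n, as Brownian
  motion does; other times are rounded down to the grid.\<close>

definition gaussian_walk :: "nat \<Rightarrow> real \<Rightarrow> (nat \<Rightarrow> real) \<Rightarrow> real" where
  "gaussian_walk n t \<omega> = (\<Sum>j<nat \<lfloor>2 ^ n * t\<rfloor>. \<omega> j) / sqrt 2 ^ n"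

lemma dyadics_nonneg: "t \<in> dyadics n \<Longrightarrow> 0 \<le> t"
  by (auto simp: dyadics_def)

lemma dyadics_Suc: "dyadics n \<subseteq> dyadics (Suc n)"
proof
  fix t assume "t \<in> dyadics n"
  then obtain k where "t = real k / 2 ^ n" by (auto simp: dyadics_def)
  then have "t = real (2 * k) / 2 ^ Suc n" by simp
  then show "t \<in> dyadics (Suc n)" unfolding dyadics_def by blast
qed

lemma dyadics_mono: "n \<le> m \<Longrightarrow> dyadics n \<subseteq> dyadics m"
  by (rule lift_Suc_mono_le[of dyadics, OF dyadics_Suc])

lemma finite_dyadics_level:
  assumes "finite J" "J \<subseteq> (\<Union>n. dyadics n)" obtains n where "J \<subseteq> dyadics n"
  using assms
proof (induction arbitrary: thesis rule: finite_induct)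
  case (insert x F)
  obtain n where "F \<subseteq> dyadics n" using insert by blast
  moreover obtain m where "x \<in> dyadics m" using insert by blast
  ultimately have "insert x F \<subseteq> dyadics (max n m)"
    using dyadics_mono[of n "max n m"] dyadics_mono[of m "max n m"] by auto
  then show ?case using insert by blast
qed auto

lemma dyadic_floor_in: "dyadic_floor n t \<in> dyadics n"
  by (auto simp: dyadic_floor_def dyadics_def)

lemma dyadic_floor_le: "0 \<le> t \<Longrightarrow> dyadic_floor n t \<le> t"
  by (simp add: dyadic_floor_def divide_le_eq mult.commute)

lemma dyadic_floor_gt: "0 \<le> t \<Longrightarrow> t - (1 / 2) ^ n < dyadic_floor n t"
proof -
  assume "0 \<le> t"
  then have "2 ^ n * t - 1 < real (nat \<lfloor>2 ^ n * t\<rfloor>)" by simp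
  then have "(2 ^ n * t - 1) / 2 ^ n < real (nat \<lfloor>2 ^ n * t\<rfloor>) / 2 ^ n" by (intro divide_strict_right_mono) auto
  then show ?thesis by (simp add: dyadic_floor_def diff_divide_distrib power_one_over)
qed

lemma dyadic_floor_eq: "t \<in> dyadics n \<Longrightarrow> dyadic_floor n t = t"
  by (auto simp: dyadic_floor_def dyadics_def)

lemma dyadic_floor_mono: "s \<le> t \<Longrightarrow> dyadic_floor n s \<le> dyadic_floor n t"
  by (auto simp: dyadic_floor_def intro!: divide_right_mono nat_mono floor_mono mult_left_mono)

lemma dyadic_floor_tendsto: "0 \<le> t \<Longrightarrow> (\<lambda>n. dyadic_floor n t) \<longlonglongrightarrow> t"
proof (rule tendsto_sandwich)
  assume t: "0 \<le> t"
  show "\<forall>\<^sub>F n in sequentially. t - (1 / 2) ^ n \<le> dyadic_floor n t"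
    using dyadic_floor_gt[OF t] by (intro always_eventually allI) (simp add: less_imp_le)
  show "\<forall>\<^sub>F n in sequentially. dyadic_floor n t \<le> t" using dyadic_floor_le[OF t] by simp
  have "(\<lambda>n. t - (1 / 2) ^ n) \<longlonglongrightarrow> t - 0" by (intro tendsto_intros LIMSEQ_power_zero) auto
  then show "(\<lambda>n. t - (1 / 2) ^ n) \<longlonglongrightarrow> t" by simp
qed simp

lemma measurable_gaussian_walk [measurable]: "gaussian_walk n t \<in> borel_measurable gaussian_sequence"
  unfolding gaussian_walk_def by measurable

text \<open>At a point of grid \<open>n\<close> the number of steps exactly doubles on the next
  grid, and pairs regroup the finer steps; the square root of 2 in \<open>pair_average\<close> is
  the additional scaling factor.\<close>

lemma gaussian_walk_pair_average:
  assumes "t \<in> dyadics n" shows "gaussian_walk n t (pair_average \<omega>) = gaussian_walk (Suc n) t \<omega>"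
proof -
  obtain k where t: "t = real k / 2 ^ n" using assms by (auto simp: dyadics_def)
  have k: "nat \<lfloor>2 ^ n * t\<rfloor> = k" "nat \<lfloor>2 ^ Suc n * t\<rfloor> = 2 * k"
  proof -
    have "2 ^ n * t = real k" "2 ^ Suc n * t = real (2 * k)" using t by simp_all
    then show "nat \<lfloor>2 ^ n * t\<rfloor> = k" "nat \<lfloor>2 ^ Suc n * t\<rfloor> = 2 * k" by (simp_all only: floor_of_nat nat_int)
  qed
  have "(\<Sum>j<2 * k. \<omega> j) = (\<Sum>j<k. \<omega> (2 * j) + \<omega> (2 * j + 1))"
    by (induction k) (auto simp: numeral_2_eq_2)
  then show ?thesis
    unfolding gaussian_walk_def k by (simp add: pair_average_def sum_divide_distrib)
qed

definition walk_law :: "nat \<Rightarrow> real set \<Rightarrow> (real \<Rightarrow> real) measure" where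
  "walk_law n J = distr gaussian_sequence (PiM J (\<lambda>_. borel)) (\<lambda>\<omega>. \<lambda>t\<in>J. gaussian_walk n t \<omega>)"

lemma measurable_walk: "(\<lambda>\<omega>. \<lambda>t\<in>J. gaussian_walk n t \<omega>) \<in> gaussian_sequence \<rightarrow>\<^sub>M PiM J (\<lambda>_. borel)"
  by (rule measurable_restrict) measurable

text \<open>\<open>pair_average\<close> preserves the law of the sequence and, on the coarse grid,
  carries the walk of level \<open>n\<close> to that of level \<open>n + 1\<close>.\<close>

lemma walk_law_Suc: "J \<subseteq> dyadics n \<Longrightarrow> walk_law (Suc n) J = walk_law n J"
proof -
  assume J: "J \<subseteq> dyadics n"
  have m: "(\<lambda>\<omega>. \<lambda>t\<in>J. gaussian_walk n t \<omega>) \<in> PiM UNIV (\<lambda>_. borel) \<rightarrow>\<^sub>M PiM J (\<lambda>_. borel)"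
    using measurable_walk unfolding measurable_cong_sets[OF sets_gaussian_sequence refl] .
  have "walk_law n J = distr (distr gaussian_sequence (PiM UNIV (\<lambda>_. borel)) pair_average) (PiM J (\<lambda>_. borel)) (\<lambda>\<omega>. \<lambda>t\<in>J. gaussian_walk n t \<omega>)"
    by (simp add: walk_law_def distr_pair_average)
  also have "\<dots> = distr gaussian_sequence (PiM J (\<lambda>_. borel)) (\<lambda>\<omega>. \<lambda>t\<in>J. gaussian_walk n t (pair_average \<omega>))"
    by (subst distr_distr[OF m measurable_pair_average]) (simp add: comp_def)
  also have "\<dots> = walk_law (Suc n) J"
  proof -
    have "(\<lambda>t\<in>J. gaussian_walk n t (pair_average \<omega>)) = (\<lambda>t\<in>J. gaussian_walk (Suc n) t \<omega>)" for \<omega>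
      using J gaussian_walk_pair_average by (auto simp: restrict_def fun_eq_iff subset_eq)
    then show ?thesis by (simp add: walk_law_def)
  qed
  finally show ?thesis ..
qed

lemma walk_law_level: "J \<subseteq> dyadics n \<Longrightarrow> n \<le> m \<Longrightarrow> walk_law m J = walk_law n J"
proof (induction m)
  case (Suc m)
  show ?case
  proof (cases "n = Suc m")
    case False
    with Suc have "n \<le> m" "J \<subseteq> dyadics m" using dyadics_mono[of n m] by auto
    with Suc show ?thesis using walk_law_Suc by simp
  qed simp
qed simp

text \<open>Kolmogorov's extension theorem. The law on a finite set of dyadic times is read off the
  walk on any grid containing them, and \<open>walk_law_level\<close> makes the choice of the grid
  immaterial.\<close>

theorem dyadic_gaussian_process_exists:
  "\<exists>L :: (real \<Rightarrow> real) measure. prob_space L \<and> sets L = sets (PiM (\<Union>n. dyadics n) (\<lambda>_. borel)) \<and>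
    (\<forall>J n. finite J \<longrightarrow> J \<subseteq> dyadics n \<longrightarrow> distr L (PiM J (\<lambda>_. borel)) (\<lambda>\<omega>. restrict \<omega> J) = walk_law n J)"
proof -
  define lev where "lev J = (SOME n. J \<subseteq> dyadics n)" for J
  define P where "P J = walk_law (lev J) J" for J
  have lev: "J \<subseteq> dyadics (lev J)" if "finite J" "J \<subseteq> (\<Union>n. dyadics n)" for J
    unfolding lev_def by (rule someI_ex) (use finite_dyadics_level[OF that] in blast)
  have P_eq: "P J = walk_law n J" if "finite J" "J \<subseteq> dyadics n" for J n
    unfolding P_def using walk_law_level[of J "lev J" "max (lev J) n"] walk_law_level[of J n "max (lev J) n"] lev[of J] that
    by fastforce
  interpret polish_projective "\<Union>n. dyadics n" P
  proof (unfold polish_projective_def projective_family_def, intro conjI allI impI)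
    fix J H :: "real set" assume JH: "J \<subseteq> H" "finite H" "H \<subseteq> (\<Union>n. dyadics n)"
    \<comment> \<open>For consistency both laws are computed on a grid fine enough for the larger
      set.\<close>
    have H: "H \<subseteq> dyadics (lev H)" using JH lev by simp
    have fJ: "finite J" using JH finite_subset by blast
    have "distr (P H) (PiM J (\<lambda>_. borel)) (\<lambda>f. restrict f J) =
        distr gaussian_sequence (PiM J (\<lambda>_. borel)) ((\<lambda>f. restrict f J) \<circ> (\<lambda>\<omega>. \<lambda>t\<in>H. gaussian_walk (lev H) t \<omega>))"
      unfolding P_def walk_law_def
      by (rule distr_distr[OF measurable_restrict_subset[OF JH(1)] measurable_walk])
    also have "(\<lambda>f. restrict f J) \<circ> (\<lambda>\<omega>. \<lambda>t\<in>H. gaussian_walk (lev H) t \<omega>) = (\<lambda>\<omega>. \<lambda>t\<in>J. gaussian_walk (lev H) t \<omega>)"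
      using JH(1) by (auto simp: fun_eq_iff restrict_def)
    also have "distr gaussian_sequence (PiM J (\<lambda>_. borel)) \<dots> = P J"
      using P_eq[OF fJ, of "lev H"] JH(1) H by (simp add: walk_law_def)
    finally show "P J = distr (P H) (PiM J (\<lambda>_. borel)) (\<lambda>f. restrict f J)" ..
  next
    fix J :: "real set" assume "finite J" "J \<subseteq> (\<Union>n. dyadics n)"
    show "prob_space (P J)" unfolding P_def walk_law_def
      by (rule prob_space.prob_space_distr[OF prob_space_gaussian_sequence measurable_walk])
  qed
  show ?thesis
  proof (intro exI[of _ lim] conjI allI impI)
    show "prob_space lim" by (rule P.prob_space_axioms)
    show "sets lim = sets (PiM (\<Union>n. dyadics n) (\<lambda>_. borel))" by simp
    fix J n assume J: "finite J" "J \<subseteq> dyadics n"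
    then have J': "J \<subseteq> (\<Union>n. dyadics n)" by auto
    have r: "(\<lambda>\<omega>. restrict \<omega> J) \<in> lim \<rightarrow>\<^sub>M PiM J (\<lambda>_. borel)"
      using measurable_restrict_subset[OF J'] by (simp cong: measurable_cong_sets)
    show "distr lim (PiM J (\<lambda>_. borel)) (\<lambda>\<omega>. restrict \<omega> J) = walk_law n J"
    proof (rule measure_eqI)
      fix A assume "A \<in> sets (distr lim (PiM J (\<lambda>_. borel)) (\<lambda>\<omega>. restrict \<omega> J))"
      then have A: "A \<in> sets (PiM J (\<lambda>_. borel))" by simp
      have "emeasure (distr lim (PiM J (\<lambda>_. borel)) (\<lambda>\<omega>. restrict \<omega> J)) A = emeasure lim ((\<lambda>\<omega>. restrict \<omega> J) -` A \<inter> space lim)"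
        by (rule emeasure_distr[OF r A])
      also have "(\<lambda>\<omega>. restrict \<omega> J) -` A \<inter> space lim = prod_emb (\<Union>n. dyadics n) (\<lambda>_. borel) J A"
        by (auto simp: prod_emb_def space_PiM)
      also have "emeasure lim \<dots> = emeasure (P J) A" by (rule emeasure_lim_emb[OF J' J(1) A])
      finally show "emeasure (distr lim (PiM J (\<lambda>_. borel)) (\<lambda>\<omega>. restrict \<omega> J)) A = emeasure (walk_law n J) A"
        unfolding P_eq[OF J] .
    qed (simp add: walk_law_def)
  qed
qed

section \<open>Independent increments through characteristic functions\<close>

lemma sets_Collect_finite_mem:
  assumes "finite J" "\<And>q. q \<in> J \<Longrightarrow> f q \<in> borel_measurable M" "\<And>q. q \<in> J \<Longrightarrow> A q \<in> sets borel"
  shows "{x\<in>space M. \<forall>q\<in>J. f q x \<in> A q} \<in> sets M"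
proof (rule sets.sets_Collect_finite_All)
  fix q assume "q \<in> J"
  then have "f q -` A q \<inter> space M \<in> sets M" using assms by (intro measurable_sets) auto
  then show "{x\<in>space M. f q x \<in> A q} \<in> sets M" by (simp add: vimage_def Int_def conj_commute)
qed (rule assms)

lemma borel_measurable_indicator_Collect:
  assumes "{x\<in>space M. Q x} \<in> sets M"
  shows "(\<lambda>x. indicator {x. Q x} x :: real) \<in> borel_measurable M"
proof -
  have "(indicator {x\<in>space M. Q x} :: _ \<Rightarrow> real) \<in> borel_measurable M" using assms by (rule borel_measurable_indicator)
  then show ?thesis by (rule measurable_cong[THEN iffD1, rotated]) (auto simp: indicator_def)
qed

lemma borel_measurable_complex_of_real:
  "f \<in> borel_measurable M \<Longrightarrow> (\<lambda>x. complex_of_real (f x)) \<in> borel_measurable M"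
  by (erule measurable_compose, rule borel_measurable_continuous_onI) (intro continuous_intros)

text \<open>Up to \<open>s\<close> the walk uses coordinates below \<open>a\<close>, the increment
  only those from \<open>a\<close> to \<open>b - 1\<close>. Independence splits the expectation, and
  the increment contributes b - a equal Gaussian factors. Keeping an event of the past in the
  formula yields independence and normality together.\<close>

lemma gaussian_walk_increment_char:
  fixes A :: "real \<Rightarrow> real set"
  assumes st: "s \<in> dyadics n" "t \<in> dyadics n" "s \<le> t"
    and J: "finite J" "J \<subseteq> dyadics n" "\<And>q. q \<in> J \<Longrightarrow> q \<le> s" and A: "\<And>q. q \<in> J \<Longrightarrow> A q \<in> sets borel"
  shows "(LINT \<omega>|gaussian_sequence. complex_of_real (indicator {\<omega>. \<forall>q\<in>J. gaussian_walk n q \<omega> \<in> A q} \<omega>) *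
      iexp (u * (gaussian_walk n t \<omega> - gaussian_walk n s \<omega>))) =
    complex_of_real (measure gaussian_sequence {\<omega>. \<forall>q\<in>J. gaussian_walk n q \<omega> \<in> A q} * exp (- (u\<^sup>2 * (t - s)) / 2))"
proof -
  interpret prob_space gaussian_sequence by (rule prob_space_gaussian_sequence)
  define a b where "a = nat \<lfloor>2 ^ n * s\<rfloor>" and "b = nat \<lfloor>2 ^ n * t\<rfloor>"
  define c where "c = u / sqrt 2 ^ n"
  have ab: "a \<le> b" unfolding a_def b_def using st by (intro nat_mono floor_mono mult_left_mono) auto
  have s_eq: "s = real a / 2 ^ n" and t_eq: "t = real b / 2 ^ n"
    using dyadic_floor_eq[OF st(1)] dyadic_floor_eq[OF st(2)] by (simp_all add: a_def b_def dyadic_floor_def)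
  have incr: "u * (gaussian_walk n t \<omega> - gaussian_walk n s \<omega>) = (\<Sum>j\<in>{a..<b}. c * \<omega> j)" for \<omega>
  proof -
    have "(\<Sum>j<b. \<omega> j) - (\<Sum>j<a. \<omega> j) = (\<Sum>j\<in>{a..<b}. \<omega> j)"
      using sum_diff_nat_ivl[of 0 a b \<omega>] ab by (simp add: atLeast0LessThan)
    then show ?thesis
      unfolding gaussian_walk_def a_def[symmetric] b_def[symmetric] c_def
        diff_divide_distrib[symmetric] sum_distrib_left[symmetric] by simp
  qed
  have qa: "nat \<lfloor>2 ^ n * q\<rfloor> \<le> a" if "q \<in> J" for q
    unfolding a_def using J(3)[OF that] by (intro nat_mono floor_mono mult_left_mono) auto
  define E where "E = {\<omega>. \<forall>q\<in>J. gaussian_walk n q \<omega> \<in> A q}"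
  have E_sets[measurable]: "E \<in> sets gaussian_sequence"
  proof -
    have "{\<omega>\<in>space gaussian_sequence. \<forall>q\<in>J. gaussian_walk n q \<omega> \<in> A q} \<in> sets gaussian_sequence"
      using J(1) A by (intro sets_Collect_finite_mem measurable_gaussian_walk) auto
    then show ?thesis by (simp add: E_def)
  qed
  \<comment> \<open>Independence of blocks concerns functions of restrictions, so the past event and
    the increment are rewritten as functionals on the two blocks of coordinates.\<close>
  define \<phi>1 where "\<phi>1 x = complex_of_real (indicator {x. \<forall>q\<in>J. (\<Sum>j<nat \<lfloor>2 ^ n * q\<rfloor>. x j) / sqrt 2 ^ n \<in> A q} x)" for x :: "nat \<Rightarrow> real"
  define \<phi>2 where "\<phi>2 x = iexp (\<Sum>j\<in>{a..<b}. c * x j)" for x :: "nat \<Rightarrow> real"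
  have m1: "\<phi>1 \<in> borel_measurable (PiM {..<a} (\<lambda>_. borel))"
  proof -
    have "(\<lambda>x. (\<Sum>j<nat \<lfloor>2 ^ n * q\<rfloor>. x j) / sqrt 2 ^ n) \<in> borel_measurable (PiM {..<a} (\<lambda>_. borel))" if "q \<in> J" for q
      using qa[OF that] by (intro borel_measurable_divide borel_measurable_sum borel_measurable_const measurable_component_singleton) auto
    then have "{x\<in>space (PiM {..<a} (\<lambda>_. borel)). \<forall>q\<in>J. (\<Sum>j<nat \<lfloor>2 ^ n * q\<rfloor>. x j) / sqrt 2 ^ n \<in> A q} \<in> sets (PiM {..<a} (\<lambda>_. borel))"
      using J(1) A by (intro sets_Collect_finite_mem) auto
    then show ?thesis unfolding \<phi>1_def
      by (intro borel_measurable_complex_of_real borel_measurable_indicator_Collect)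
  qed
  have m2: "\<phi>2 \<in> borel_measurable (PiM {a..<b} (\<lambda>_. borel))"
    unfolding \<phi>2_def by measurable
  have ind: "indep_var borel (\<phi>1 \<circ> (\<lambda>\<omega>. restrict (\<lambda>i. \<omega> i) {..<a})) borel (\<phi>2 \<circ> (\<lambda>\<omega>. restrict (\<lambda>i. \<omega> i) {a..<b}))"
    by (rule indep_var_compose[OF indep_var_restrict[OF indep_gaussian_coordinates] m1 m2]) auto
  have \<phi>1_eq: "(\<phi>1 \<circ> (\<lambda>\<omega>. restrict (\<lambda>i. \<omega> i) {..<a})) = (\<lambda>\<omega>. complex_of_real (indicator E \<omega>))"
  proof
    fix \<omega> :: "nat \<Rightarrow> real"
    have "(\<Sum>j<nat \<lfloor>2 ^ n * q\<rfloor>. restrict \<omega> {..<a} j) = (\<Sum>j<nat \<lfloor>2 ^ n * q\<rfloor>. \<omega> j)" if "q \<in> J" for q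
      using qa[OF that] by (intro sum.cong) auto
    then show "(\<phi>1 \<circ> (\<lambda>\<omega>. restrict (\<lambda>i. \<omega> i) {..<a})) \<omega> = complex_of_real (indicator E \<omega>)"
      by (simp add: \<phi>1_def E_def gaussian_walk_def indicator_def)
  qed
  have \<phi>2_eq: "(\<phi>2 \<circ> (\<lambda>\<omega>. restrict (\<lambda>i. \<omega> i) {a..<b})) = (\<lambda>\<omega>. iexp (\<Sum>j\<in>{a..<b}. c * \<omega> j))"
    by (auto simp: \<phi>2_def fun_eq_iff intro!: arg_cong[of _ _ iexp] sum.cong)
  have i1: "integrable gaussian_sequence (\<lambda>\<omega>. complex_of_real (indicator E \<omega>))"
    by (intro integrable_of_real integrable_real_indicator) (auto simp: emeasure_eq_measure)
  have i2: "integrable gaussian_sequence (\<lambda>\<omega>. iexp (\<Sum>j\<in>{a..<b}. c * \<omega> j))"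
    by (intro integrable_iexp) auto
  have coord: "(LINT \<omega>|gaussian_sequence. iexp (c * \<omega> j)) = exp (- c\<^sup>2 / 2)" for j
  proof -
    have "(LINT \<omega>|gaussian_sequence. iexp (c * \<omega> j)) = char (distr gaussian_sequence borel (\<lambda>\<omega>. \<omega> j)) c"
      unfolding char_def by (subst integral_distr) auto
    then show ?thesis by (simp add: distr_gaussian_coordinate char_std_normal_distribution)
  qed
  have "indep_vars (\<lambda>_. borel) (\<lambda>j \<omega>. iexp (c * \<omega> j)) {a..<b}"
    by (rule indep_vars_compose2[OF indep_vars_subset[OF indep_gaussian_coordinates]]) auto
  then have "(LINT \<omega>|gaussian_sequence. (\<Prod>j\<in>{a..<b}. iexp (c * \<omega> j))) = (\<Prod>j\<in>{a..<b}. LINT \<omega>|gaussian_sequence. iexp (c * \<omega> j))"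
    by (intro indep_vars_lebesgue_integral integrable_iexp) auto
  also have "\<dots> = complex_of_real (exp (- c\<^sup>2 / 2) ^ (b - a))"
    by (simp only: coord prod_constant card_atLeastLessThan of_real_power)
  \<comment> \<open>c^2 (b - a) = u^2 (b - a)/2^n = u^2 (t - s).\<close>
  also have "exp (- c\<^sup>2 / 2) ^ (b - a) = exp (- (u\<^sup>2 * (t - s)) / 2)"
  proof -
    have "c\<^sup>2 = u\<^sup>2 / 2 ^ n" by (simp add: c_def power_divide power_mult[symmetric] mult.commute[of n 2] power_mult)
    moreover have "t - s = real (b - a) / 2 ^ n"
      using ab by (subst t_eq, subst s_eq) (simp add: of_nat_diff diff_divide_distrib)
    ultimately have "real (b - a) * (- c\<^sup>2 / 2) = - (u\<^sup>2 * (t - s)) / 2"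
      by (simp only:) simp
    then show ?thesis unfolding exp_of_nat_mult[symmetric] by simp
  qed
  finally have E2: "(LINT \<omega>|gaussian_sequence. iexp (\<Sum>j\<in>{a..<b}. c * \<omega> j)) = complex_of_real (exp (- (u\<^sup>2 * (t - s)) / 2))"
    by (simp add: exp_sum sum_distrib_left)
  have "(LINT \<omega>|gaussian_sequence. complex_of_real (indicator E \<omega>) * iexp (\<Sum>j\<in>{a..<b}. c * \<omega> j)) =
      (LINT \<omega>|gaussian_sequence. complex_of_real (indicator E \<omega>)) * (LINT \<omega>|gaussian_sequence. iexp (\<Sum>j\<in>{a..<b}. c * \<omega> j))"
    using ind i1 i2 unfolding \<phi>1_eq \<phi>2_eq by (intro indep_var_lebesgue_integral)
  also have "(LINT \<omega>|gaussian_sequence. complex_of_real (indicator E \<omega>)) = complex_of_real (measure gaussian_sequence E)"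
    by simp
  finally show ?thesis unfolding E2 incr E_def[symmetric] by simp
qed

locale dyadic_process = prob_space L for L :: "(real \<Rightarrow> real) measure" +
  assumes sets_L: "sets L = sets (PiM (\<Union>n. dyadics n) (\<lambda>_. borel))"
    and fdd: "\<And>J n. finite J \<Longrightarrow> J \<subseteq> dyadics n \<Longrightarrow> distr L (PiM J (\<lambda>_. borel)) (\<lambda>\<omega>. restrict \<omega> J) = walk_law n J"
begin

lemma measurable_dyadic_coordinate: "q \<in> dyadics n \<Longrightarrow> (\<lambda>\<omega>. \<omega> q) \<in> borel_measurable L"
  unfolding measurable_cong_sets[OF sets_L refl] by (rule measurable_component_singleton) auto

lemma integral_fdd:
  fixes \<phi> :: "(real \<Rightarrow> real) \<Rightarrow> 'b::{banach, second_countable_topology}"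
  assumes J: "finite J" "J \<subseteq> dyadics n" and \<phi>: "\<phi> \<in> borel_measurable (PiM J (\<lambda>_. borel))"
  shows "(LINT \<omega>|L. \<phi> (restrict \<omega> J)) = (LINT \<omega>|gaussian_sequence. \<phi> (\<lambda>t\<in>J. gaussian_walk n t \<omega>))"
proof -
  have "(\<lambda>\<omega>. restrict \<omega> J) \<in> L \<rightarrow>\<^sub>M PiM J (\<lambda>_. borel)"
    unfolding measurable_cong_sets[OF sets_L refl] using J by (intro measurable_restrict_subset) auto
  then have "(LINT \<omega>|L. \<phi> (restrict \<omega> J)) = (LINT x|distr L (PiM J (\<lambda>_. borel)) (\<lambda>\<omega>. restrict \<omega> J). \<phi> x)"
    using \<phi> by (simp add: integral_distr)
  also have "\<dots> = (LINT \<omega>|gaussian_sequence. \<phi> (\<lambda>t\<in>J. gaussian_walk n t \<omega>))"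
    unfolding fdd[OF J] walk_law_def by (rule integral_distr[OF measurable_walk \<phi>])
  finally show ?thesis .
qed

text \<open>Only the finitely many times in \<open>H\<close> matter, and on them the law is that of
  the walk; the probability of \<open>E\<close> is carried back by the same route.\<close>

lemma increment_char:
  fixes A :: "real \<Rightarrow> real set"
  assumes st: "s \<in> dyadics n" "t \<in> dyadics n" "s \<le> t"
    and J: "finite J" "J \<subseteq> dyadics n" "\<And>q. q \<in> J \<Longrightarrow> q \<le> s" and A: "\<And>q. q \<in> J \<Longrightarrow> A q \<in> sets borel"
  defines "E \<equiv> {\<omega>\<in>space L. \<forall>q\<in>J. \<omega> q \<in> A q}"
  shows "(LINT \<omega>|L. complex_of_real (indicator E \<omega>) * iexp (u * (\<omega> t - \<omega> s))) =
    complex_of_real (prob E * exp (- (u\<^sup>2 * (t - s)) / 2))"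
proof -
  interpret S: prob_space gaussian_sequence by (rule prob_space_gaussian_sequence)
  define H where "H = insert s (insert t J)"
  have H: "finite H" "H \<subseteq> dyadics n" using st J by (auto simp: H_def)
  have [measurable]: "(\<lambda>x. x q) \<in> borel_measurable (PiM H (\<lambda>_. borel))" if "q \<in> H" for q
    using that by (rule measurable_component_singleton)
  define \<eta> where "\<eta> x = (indicator {x. \<forall>q\<in>J. x q \<in> A q} x :: real)" for x :: "real \<Rightarrow> real"
  have "{x\<in>space (PiM H (\<lambda>_. borel)). \<forall>q\<in>J. x q \<in> A q} \<in> sets (PiM H (\<lambda>_. borel))"
    using J(1) A by (intro sets_Collect_finite_mem measurable_component_singleton) (auto simp: H_def)
  then have \<eta>[measurable]: "\<eta> \<in> borel_measurable (PiM H (\<lambda>_. borel))"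
    unfolding \<eta>_def by (intro borel_measurable_indicator_Collect)
  define \<phi> where "\<phi> x = complex_of_real (\<eta> x) * iexp (u * (x t - x s))" for x
  have \<phi>: "\<phi> \<in> borel_measurable (PiM H (\<lambda>_. borel))"
  proof -
    have "(\<lambda>x. x t) \<in> borel_measurable (PiM H (\<lambda>_. borel))" "(\<lambda>x. x s) \<in> borel_measurable (PiM H (\<lambda>_. borel))"
      by (auto simp: H_def)
    then show ?thesis unfolding \<phi>_def by measurable
  qed
  have E_sets: "E \<in> sets L"
    unfolding E_def using J A by (intro sets_Collect_finite_mem measurable_dyadic_coordinate) auto
  have "(LINT \<omega>|L. complex_of_real (indicator E \<omega>) * iexp (u * (\<omega> t - \<omega> s))) = (LINT \<omega>|L. \<phi> (restrict \<omega> H))"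
    by (intro Bochner_Integration.integral_cong) (auto simp: \<phi>_def \<eta>_def E_def H_def indicator_def)
  also have "\<dots> = (LINT \<omega>|gaussian_sequence. \<phi> (\<lambda>t\<in>H. gaussian_walk n t \<omega>))"
    by (rule integral_fdd[OF H \<phi>])
  also have "\<dots> = (LINT \<omega>|gaussian_sequence. complex_of_real (indicator {\<omega>. \<forall>q\<in>J. gaussian_walk n q \<omega> \<in> A q} \<omega>) *
      iexp (u * (gaussian_walk n t \<omega> - gaussian_walk n s \<omega>)))"
    by (intro Bochner_Integration.integral_cong) (auto simp: \<phi>_def \<eta>_def H_def indicator_def)
  also have "\<dots> = complex_of_real (measure gaussian_sequence {\<omega>. \<forall>q\<in>J. gaussian_walk n q \<omega> \<in> A q} * exp (- (u\<^sup>2 * (t - s)) / 2))"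
    by (rule gaussian_walk_increment_char[OF st J A])
  also have "measure gaussian_sequence {\<omega>. \<forall>q\<in>J. gaussian_walk n q \<omega> \<in> A q} = (LINT \<omega>|gaussian_sequence. \<eta> (\<lambda>t\<in>H. gaussian_walk n t \<omega>))"
  proof -
    have "(LINT \<omega>|gaussian_sequence. \<eta> (\<lambda>t\<in>H. gaussian_walk n t \<omega>)) = (LINT \<omega>|gaussian_sequence. indicator {\<omega>. \<forall>q\<in>J. gaussian_walk n q \<omega> \<in> A q} \<omega>)"
      by (intro Bochner_Integration.integral_cong) (auto simp: \<eta>_def H_def indicator_def)
    then show ?thesis by simp
  qed
  also have "\<dots> = (LINT \<omega>|L. \<eta> (restrict \<omega> H))" by (rule integral_fdd[OF H \<eta>, symmetric])
  also have "\<dots> = (LINT \<omega>|L. indicator E \<omega>)"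
    by (intro Bochner_Integration.integral_cong) (auto simp: \<eta>_def E_def H_def indicator_def)
  also have "\<dots> = prob E" using E_sets by simp
  finally show ?thesis .
qed

end

section \<open>Continuous Brownian motion\<close>

text \<open>Any ratio strictly between \<open>2 powr (-1/4)\<close> and \<open>1\<close> would do in place of \<open>9/10\<close>.\<close>

definition regular_increments :: "(real \<Rightarrow> real) \<Rightarrow> bool" where
  "regular_increments w \<longleftrightarrow> (\<forall>m. \<exists>n0. \<forall>n\<ge>n0. \<forall>k<m * 2 ^ n.
     \<bar>w (real (Suc k) / 2 ^ n) - w (real k / 2 ^ n)\<bar> \<le> (9 / 10) ^ n)"

lemma dyadics_I: "real k / 2 ^ n \<in> dyadics n"
  unfolding dyadics_def by blast

text \<open>Extends a path known at dyadic times to nonnegative reals along the dyadics just below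
  them. Where there is no limit, \<open>lim\<close> has an unspecified value, which regular paths
  never meet.\<close>

definition dyadic_limit :: "(real \<Rightarrow> real) \<Rightarrow> real \<Rightarrow> real" where
  "dyadic_limit w t = lim (\<lambda>n. w (dyadic_floor n t))"

text \<open>Refining the grid moves the floor of \<open>t\<close> by zero or one fine step, so
  successive values differ by at most (9/10)^(n+1); the geometric tail sums to 9 (9/10)^n.\<close>

lemma
  fixes w :: "real \<Rightarrow> real"
  assumes n0: "\<And>n k. n \<ge> n0 \<Longrightarrow> k < m * 2 ^ n \<Longrightarrow> \<bar>w (real (Suc k) / 2 ^ n) - w (real k / 2 ^ n)\<bar> \<le> (9 / 10) ^ n"
    and n: "n \<ge> n0" and t: "0 \<le> t" "t \<le> real m"
  shows dyadic_limit_tendsto: "(\<lambda>n. w (dyadic_floor n t)) \<longlonglongrightarrow> dyadic_limit w t"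
    and dyadic_limit_error: "\<bar>dyadic_limit w t - w (dyadic_floor n t)\<bar> \<le> 9 * (9 / 10) ^ n"
proof -
  have step: "\<bar>w (dyadic_floor (Suc n) t) - w (dyadic_floor n t)\<bar> \<le> (9 / 10) ^ Suc n" if "n \<ge> n0" for n
  proof -
    define k where "k = nat \<lfloor>2 ^ n * t\<rfloor>"
    define k' where "k' = nat \<lfloor>2 ^ Suc n * t\<rfloor>"
    have k: "real k \<le> 2 ^ n * t" "2 ^ n * t < real k + 1" using t by (auto simp: k_def)
    have k': "real k' \<le> 2 * (2 ^ n * t)" "2 * (2 ^ n * t) < real k' + 1" using t by (auto simp: k'_def mult.assoc)
    have "real k' < real (2 * k + 2)" "real (2 * k) < real (k' + 1)" using k k' by auto
    then have "k' = 2 * k \<or> k' = Suc (2 * k)" unfolding of_nat_less_iff by linarith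
    then show ?thesis
    proof
      assume "k' = 2 * k"
      then have "dyadic_floor (Suc n) t = dyadic_floor n t" by (simp add: dyadic_floor_def k_def[symmetric] k'_def[symmetric] del: power_Suc) simp
      then show ?thesis by simp
    next
      assume eq: "k' = Suc (2 * k)"
      have "real (2 * k) < real (m * 2 ^ Suc n)"
      proof -
        have "real k' \<le> 2 * (2 ^ n * real m)" using k'(1) t by (smt (verit) mult_left_mono zero_le_power)
        then show ?thesis using eq by (simp add: mult.commute)
      qed
      then have "2 * k < m * 2 ^ Suc n" by (simp only: of_nat_less_iff)
      from n0[OF _ this] that have "\<bar>w (real (Suc (2 * k)) / 2 ^ Suc n) - w (real (2 * k) / 2 ^ Suc n)\<bar> \<le> (9 / 10) ^ Suc n" by simp
      moreover have "dyadic_floor (Suc n) t = real (Suc (2 * k)) / 2 ^ Suc n" using eq by (simp only: dyadic_floor_def k'_def)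
      moreover have "dyadic_floor n t = real (2 * k) / 2 ^ Suc n" by (simp add: dyadic_floor_def k_def)
      ultimately show ?thesis by simp
    qed
  qed
  \<comment> \<open>The exact partial sum of the geometric series is carried along so that the
    induction closes.\<close>
  have diff: "\<bar>w (dyadic_floor (n + j) t) - w (dyadic_floor n t)\<bar> \<le> 9 * (9 / 10) ^ n * (1 - (9 / 10) ^ j)" if "n \<ge> n0" for n j
  proof (induction j)
    case (Suc j)
    have "\<bar>w (dyadic_floor (Suc (n + j)) t) - w (dyadic_floor n t)\<bar> \<le> (9 / 10) ^ Suc (n + j) + 9 * (9 / 10) ^ n * (1 - (9 / 10) ^ j)"
      using step[of "n + j"] that Suc by linarith
    also have "\<dots> = 9 * (9 / 10) ^ n * (1 - (9 / 10) ^ Suc j)" by (simp add: power_add algebra_simps)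
    finally show ?case by simp
  qed simp
  have diff': "\<bar>w (dyadic_floor k t) - w (dyadic_floor n t)\<bar> \<le> 9 * (9 / 10) ^ n" if "n \<ge> n0" "k \<ge> n" for n k
  proof -
    have "9 * (9 / 10) ^ n * (1 - (9 / 10) ^ (k - n)) \<le> 9 * (9 / 10 :: real) ^ n * 1"
      by (intro mult_left_mono) auto
    with diff[OF that(1), of "k - n"] have "\<bar>w (dyadic_floor (n + (k - n)) t) - w (dyadic_floor n t)\<bar> \<le> 9 * (9 / 10) ^ n" by linarith
    then show ?thesis using that(2) by simp
  qed
  have "Cauchy (\<lambda>n. w (dyadic_floor n t))"
  proof (rule metric_CauchyI)
    fix e :: real assume e: "0 < e"
    have "(\<lambda>n. 9 * (9 / 10) ^ n :: real) \<longlonglongrightarrow> 9 * 0" by (intro tendsto_intros LIMSEQ_power_zero) auto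
    then have "\<forall>\<^sub>F n in sequentially. 9 * (9 / 10) ^ n < e / 2" using e by (intro order_tendstoD(2)[where y = "9 * 0"]) auto
    then obtain M where M: "\<And>n. n \<ge> M \<Longrightarrow> 9 * (9 / 10) ^ n < e / 2" by (auto simp: eventually_sequentially)
    define M' where "M' = max M n0"
    have "dist (w (dyadic_floor j t)) (w (dyadic_floor k t)) < e" if "j \<ge> M'" "k \<ge> M'" for j k
      using diff'[of M' j] diff'[of M' k] M[of M'] that unfolding dist_real_def M'_def by linarith
    then show "\<exists>M. \<forall>m\<ge>M. \<forall>n\<ge>M. dist (w (dyadic_floor m t)) (w (dyadic_floor n t)) < e" by blast
  qed
  then show lim: "(\<lambda>n. w (dyadic_floor n t)) \<longlonglongrightarrow> dyadic_limit w t"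
    unfolding dyadic_limit_def by (simp add: Cauchy_convergent_iff convergent_LIMSEQ_iff)
  have "(\<lambda>k. \<bar>w (dyadic_floor k t) - w (dyadic_floor n t)\<bar>) \<longlonglongrightarrow> \<bar>dyadic_limit w t - w (dyadic_floor n t)\<bar>"
    by (intro tendsto_intros lim)
  then show "\<bar>dyadic_limit w t - w (dyadic_floor n t)\<bar> \<le> 9 * (9 / 10) ^ n"
    by (rule LIMSEQ_le_const2) (use diff'[OF n] in blast)
qed

lemma regular_increments_tendsto:
  assumes "regular_increments w" "0 \<le> t"
  shows "(\<lambda>n. w (dyadic_floor n t)) \<longlonglongrightarrow> dyadic_limit w t"
proof -
  obtain m where "t \<le> real m" using real_arch_simple by blast
  moreover obtain n0 where "\<And>n k. n \<ge> n0 \<Longrightarrow> k < m * 2 ^ n \<Longrightarrow> \<bar>w (real (Suc k) / 2 ^ n) - w (real k / 2 ^ n)\<bar> \<le> (9 / 10) ^ n"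
    using assms(1) unfolding regular_increments_def by blast
  ultimately show ?thesis using dyadic_limit_tendsto[of n0 m w n0 t] assms(2) by blast
qed

lemma regular_increments_dyadic:
  assumes "regular_increments w" "q \<in> dyadics n"
  shows "dyadic_limit w q = w q"
proof -
  have "\<forall>\<^sub>F k in sequentially. w (dyadic_floor k q) = w q"
    using eventually_ge_at_top[of n]
    by eventually_elim (use assms(2) dyadics_mono dyadic_floor_eq in \<open>metis subsetD\<close>)
  then have "(\<lambda>k. w (dyadic_floor k q)) \<longlonglongrightarrow> w q" by (rule tendsto_eventually)
  with regular_increments_tendsto[OF assms(1) dyadics_nonneg[OF assms(2)]] show ?thesis by (rule LIMSEQ_unique)
qed

text \<open>Points closer than 2^(-n) have floors of level \<open>n\<close> at most one step apart;
  comparing each limit with the value at its floor gives a locally uniform modulus.\<close>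

lemma continuous_on_dyadic_limit:
  assumes w: "regular_increments w" shows "continuous_on {0..} (dyadic_limit w)"
  unfolding continuous_on_iff
proof (intro ballI allI impI)
  fix t0 e :: real assume t0: "t0 \<in> {0..}" and e: "0 < e"
  obtain m where m: "t0 + 1 \<le> real m" using real_arch_simple by blast
  obtain n0 where n0: "\<And>n k. n \<ge> n0 \<Longrightarrow> k < m * 2 ^ n \<Longrightarrow> \<bar>w (real (Suc k) / 2 ^ n) - w (real k / 2 ^ n)\<bar> \<le> (9 / 10) ^ n"
    using w unfolding regular_increments_def by blast
  \<comment> \<open>19 = 9 + 1 + 9: two errors of approximation and one step of the grid.\<close>
  have "(\<lambda>n. 19 * (9 / 10) ^ n :: real) \<longlonglongrightarrow> 19 * 0" by (intro tendsto_intros LIMSEQ_power_zero) auto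
  then have "\<forall>\<^sub>F n in sequentially. 19 * (9 / 10) ^ n < e" using e by (intro order_tendstoD(2)[where y = "19 * 0"]) auto
  with eventually_ge_at_top[of n0] have "\<forall>\<^sub>F n in sequentially. n0 \<le> n \<and> 19 * (9 / 10) ^ n < e" by eventually_elim simp
  then obtain n where n: "n \<ge> n0" "19 * (9 / 10) ^ n < e" by (auto simp: eventually_sequentially)
  have close: "\<bar>w (dyadic_floor n t) - w (dyadic_floor n s)\<bar> \<le> (9 / 10) ^ n" if st: "0 \<le> s" "s \<le> t" "t \<le> real m" "t - s < (1 / 2) ^ n" for s t
  proof -
    define k where "k = nat \<lfloor>2 ^ n * s\<rfloor>"
    define k' where "k' = nat \<lfloor>2 ^ n * t\<rfloor>"
    have k: "real k \<le> 2 ^ n * s" "2 ^ n * s < real k + 1" using st by (auto simp: k_def)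
    have k': "real k' \<le> 2 ^ n * t" "2 ^ n * t < real k' + 1" using st by (auto simp: k'_def)
    have d: "2 ^ n * t < 2 ^ n * s + 1" using st(4) by (simp add: power_one_over field_simps)
    have "2 ^ n * s \<le> 2 ^ n * t" using st by simp
    then have "real k' < real (k + 2)" "real k < real (k' + 1)" using k k' d unfolding of_nat_add of_nat_numeral of_nat_1 by linarith+
    then have "k' = k \<or> k' = Suc k" unfolding of_nat_less_iff by linarith
    then show ?thesis
    proof
      assume eq: "k' = Suc k"
      have "2 ^ n * t \<le> 2 ^ n * real m" using st by simp
      then have "real (Suc k) \<le> 2 ^ n * real m" using k'(1) eq by linarith
      then have "real k < real (m * 2 ^ n)" by (simp add: mult.commute)
      then have "k < m * 2 ^ n" by (simp only: of_nat_less_iff)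
      from n0[OF n(1) this] show ?thesis
        using eq by (simp only: dyadic_floor_def k_def[symmetric] k'_def[symmetric])
    qed (simp add: dyadic_floor_def k_def k'_def)
  qed
  \<comment> \<open>The bound 1 keeps both points in [0,m], where the increment bounds from
    \<open>n0\<close> on are valid.\<close>
  define d where "d = min 1 ((1 / 2 :: real) ^ n)"
  have "dist (dyadic_limit w t) (dyadic_limit w t0) < e" if t: "t \<in> {0..}" "dist t t0 < d" for t
  proof -
    have tm: "t \<le> real m" "t0 \<le> real m" "\<bar>t - t0\<bar> < (1 / 2) ^ n" using t t0 m by (auto simp: d_def dist_real_def)
    have "\<bar>w (dyadic_floor n t) - w (dyadic_floor n t0)\<bar> \<le> (9 / 10) ^ n"
      using close[of t t0] close[of t0 t] t t0 tm by (cases "t \<le> t0") (auto simp: abs_minus_commute)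
    moreover have "\<bar>dyadic_limit w t - w (dyadic_floor n t)\<bar> \<le> 9 * (9 / 10) ^ n"
      using t tm by (intro dyadic_limit_error[of n0 m w n t] n0 n) auto
    moreover have "\<bar>dyadic_limit w t0 - w (dyadic_floor n t0)\<bar> \<le> 9 * (9 / 10) ^ n"
      using t0 tm by (intro dyadic_limit_error[of n0 m w n t0] n0 n) auto
    ultimately show ?thesis using n(2) unfolding dist_real_def by linarith
  qed
  moreover have "d > 0" by (simp add: d_def)
  ultimately show "\<exists>d>0. \<forall>x'\<in>{0..}. dist x' t0 < d \<longrightarrow> dist (dyadic_limit w x') (dyadic_limit w t0) < e" by blast
qed

text \<open>An image of the standard normal law rather than a density, so that variance 0 is
  included as the point mass at 0.\<close>

definition centered_normal :: "real \<Rightarrow> real measure" where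
  "centered_normal v = distr std_normal_distribution borel (\<lambda>z. sqrt v * z)"

lemma real_distribution_centered_normal: "real_distribution (centered_normal v)"
proof -
  have "prob_space (centered_normal v)" unfolding centered_normal_def
    by (rule prob_space.prob_space_distr[OF prob_space_normal_density]) auto
  then show ?thesis
    by (simp add: real_distribution_def real_distribution_axioms_def) (simp add: centered_normal_def)
qed

lemma char_centered_normal: "0 \<le> v \<Longrightarrow> char (centered_normal v) u = exp (- (u\<^sup>2 * v) / 2)"
proof -
  assume v: "0 \<le> v"
  have "char (centered_normal v) u = (LINT z|std_normal_distribution. iexp (u * (sqrt v * z)))"
    unfolding char_def centered_normal_def by (rule integral_distr) auto
  also have "\<dots> = char std_normal_distribution (u * sqrt v)" by (simp add: char_def mult_ac)
  finally show ?thesis using v by (simp add: char_std_normal_distribution power_mult_distrib)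
qed

text \<open>Markov's inequality for the fourth power, whose mean is 3 v^2. The second moment would
  give a bound of order v, too weak for a union over 2^n increments.\<close>

lemma centered_normal_tail:
  assumes v: "0 \<le> v" and e: "0 < e"
  shows "measure (centered_normal v) {z. e < \<bar>z\<bar>} \<le> 3 * v\<^sup>2 / e ^ 4"
proof -
  interpret S: prob_space std_normal_distribution by (rule prob_space_normal_density) simp
  have "measure (centered_normal v) {z. e < \<bar>z\<bar>} = measure std_normal_distribution {z. e < \<bar>sqrt v * z\<bar>}"
    unfolding centered_normal_def by (subst measure_distr) (auto simp: vimage_def intro!: borel_open open_Collect_less continuous_intros)
  also have "\<dots> \<le> measure std_normal_distribution {z \<in> space std_normal_distribution. e ^ 4 \<le> v\<^sup>2 * z ^ 4}"
  proof (rule S.finite_measure_mono)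
    show "{z. e < \<bar>sqrt v * z\<bar>} \<subseteq> {z \<in> space std_normal_distribution. e ^ 4 \<le> v\<^sup>2 * z ^ 4}"
    proof safe
      fix z assume "e < \<bar>sqrt v * z\<bar>"
      then have "e ^ 4 \<le> \<bar>sqrt v * z\<bar> ^ 4" using e by (intro power_mono) auto
      also have "\<dots> = (sqrt v ^ 2) ^ 2 * z ^ 4" by (simp add: power_mult_distrib power_mult[symmetric] power_even_abs)
      finally show "e ^ 4 \<le> v\<^sup>2 * z ^ 4" using v by simp
    qed simp
    show "{z \<in> space std_normal_distribution. e ^ 4 \<le> v\<^sup>2 * z ^ 4} \<in> sets std_normal_distribution"
      using borel_closed[OF closed_Collect_le, of "\<lambda>_. e ^ 4" "\<lambda>z. v\<^sup>2 * z ^ 4"]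
      by (simp add: continuous_intros)
  qed
  also have "\<dots> \<le> (LINT z|std_normal_distribution. v\<^sup>2 * z ^ 4) / e ^ 4"
  proof (rule integral_Markov_inequality_measure[where A = "{}"])
    show "integrable std_normal_distribution (\<lambda>z. v\<^sup>2 * z ^ 4)"
      by (intro integrable_mult_right integrable_std_normal_distribution_moment)
  qed (use e in auto)
  also have "(LINT z|std_normal_distribution. v\<^sup>2 * z ^ 4) = v\<^sup>2 * 3"
    using std_normal_distribution_even_moments(1)[of 2] by (simp add: fact_numeral)
  finally show ?thesis by (simp add: mult.commute)
qed

section \<open>Almost sure regularity of dyadic paths\<close>

context dyadic_process
begin

text \<open>Characteristic functions determine laws, and with an empty family of conditions
  \<open>increment_char\<close> gives that of the increment alone.\<close>

lemma distr_increment: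
  assumes st: "s \<in> dyadics n" "t \<in> dyadics n" "s \<le> t"
  shows "distr L borel (\<lambda>\<omega>. \<omega> t - \<omega> s) = centered_normal (t - s)"
proof (rule Levy_uniqueness)
  have m: "(\<lambda>\<omega>. \<omega> t - \<omega> s) \<in> borel_measurable L"
    by (rule borel_measurable_diff[OF measurable_dyadic_coordinate[OF st(2)] measurable_dyadic_coordinate[OF st(1)]])
  interpret D: prob_space "distr L borel (\<lambda>\<omega>. \<omega> t - \<omega> s)" using m by (rule prob_space_distr)
  show "real_distribution (distr L borel (\<lambda>\<omega>. \<omega> t - \<omega> s))" by unfold_locales simp_all
  show "real_distribution (centered_normal (t - s))" by (rule real_distribution_centered_normal)
  show "char (distr L borel (\<lambda>\<omega>. \<omega> t - \<omega> s)) = char (centered_normal (t - s))"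
  proof
    fix u
    have "char (distr L borel (\<lambda>\<omega>. \<omega> t - \<omega> s)) u = (LINT \<omega>|L. iexp (u * (\<omega> t - \<omega> s)))"
      unfolding char_def by (rule integral_distr[OF m]) auto
    also have "\<dots> = (LINT \<omega>|L. complex_of_real (indicator {\<omega>\<in>space L. \<forall>q\<in>{}. \<omega> q \<in> UNIV} \<omega>) * iexp (u * (\<omega> t - \<omega> s)))"
      by (intro Bochner_Integration.integral_cong) auto
    also have "\<dots> = complex_of_real (exp (- (u\<^sup>2 * (t - s)) / 2))"
      by (subst increment_char[OF st]) (auto simp: prob_space)
    finally show "char (distr L borel (\<lambda>\<omega>. \<omega> t - \<omega> s)) u = char (centered_normal (t - s)) u"
      using st by (simp add: char_centered_normal)
  qed
qed

lemma AE_start: "AE \<omega> in L. \<omega> 0 = 0"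
proof -
  have 0: "(0 :: real) \<in> dyadics 0" by (auto simp: dyadics_def)
  have m: "(\<lambda>x. indicator {0 :: real} (x 0) :: real) \<in> borel_measurable (PiM {0 :: real} (\<lambda>_. borel))"
    by (rule measurable_compose[OF measurable_component_singleton borel_measurable_indicator]) auto
  have "(LINT \<omega>|L. indicator {0} (\<omega> 0)) = (LINT \<omega>|L. indicator {0 :: real} (restrict \<omega> {0} 0) :: real)" by simp
  also have "\<dots> = (LINT \<omega>|gaussian_sequence. indicator {0} ((\<lambda>t\<in>{0}. gaussian_walk 0 t \<omega>) 0))"
    by (rule integral_fdd[OF _ _ m]) (use 0 in auto)
  also have "\<dots> = 1" using prob_space.prob_space[OF prob_space_gaussian_sequence] by (simp add: gaussian_walk_def)
  finally have *: "(LINT \<omega>|L. indicator {0 :: real} (\<omega> 0) :: real) = 1" .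
  have "{\<omega>\<in>space L. \<omega> 0 = 0} \<in> events"
    using sets_Collect_finite_mem[of "{0}" "\<lambda>q \<omega>. \<omega> q" L "\<lambda>_. {0}"] measurable_dyadic_coordinate[OF 0] by simp
  moreover have "(LINT \<omega>|L. indicator {0 :: real} (\<omega> 0) :: real) = (LINT \<omega>|L. indicator {\<omega>\<in>space L. \<omega> 0 = 0} \<omega>)"
    by (intro Bochner_Integration.integral_cong) (auto simp: indicator_def)
  ultimately have "prob {\<omega>\<in>space L. \<omega> 0 = 0} = 1" using * by simp
  then show ?thesis using prob_Collect_eq_1[of "\<lambda>\<omega>. \<omega> 0 = 0"] \<open>{\<omega>\<in>space L. \<omega> 0 = 0} \<in> events\<close> by simp
qed

text \<open>2500/6561 = (1/4)/(9/10)^4: the squared variance 4^(-n) over the fourth power of the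
  threshold.\<close>

lemma prob_large_increment:
  "prob {\<omega>\<in>space L. (9 / 10) ^ n < \<bar>\<omega> (real (Suc k) / 2 ^ n) - \<omega> (real k / 2 ^ n)\<bar>} \<le> 3 * (2500 / 6561) ^ n"
proof -
  define t s where "t = real (Suc k) / 2 ^ n" and "s = real k / 2 ^ n"
  have st: "s \<in> dyadics n" "t \<in> dyadics n" "s \<le> t"
    unfolding s_def t_def by (intro dyadics_I divide_right_mono; simp)+
  have ts: "t - s = 1 / 2 ^ n" by (simp add: t_def s_def diff_divide_distrib[symmetric])
  have m: "(\<lambda>\<omega>. \<omega> t - \<omega> s) \<in> borel_measurable L"
    by (rule borel_measurable_diff[OF measurable_dyadic_coordinate[OF st(2)] measurable_dyadic_coordinate[OF st(1)]])
  have "prob {\<omega>\<in>space L. (9 / 10) ^ n < \<bar>\<omega> t - \<omega> s\<bar>} = measure (distr L borel (\<lambda>\<omega>. \<omega> t - \<omega> s)) {z. (9 / 10) ^ n < \<bar>z\<bar>}"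
    by (subst measure_distr[OF m]) (auto intro!: arg_cong[where f = prob])
  also have "\<dots> \<le> 3 * (t - s)\<^sup>2 / ((9 / 10) ^ n) ^ 4"
    unfolding distr_increment[OF st] using st by (intro centered_normal_tail) auto
  also have "(t - s)\<^sup>2 / ((9 / 10) ^ n) ^ 4 = (2500 / 6561) ^ n"
  proof -
    have "((9 / 10 :: real) ^ n) ^ 4 = ((9 / 10) ^ 4) ^ n" by (simp only: power_mult[symmetric] mult.commute)
    moreover have "(t - s)\<^sup>2 = (1 / 4) ^ n" unfolding ts by (simp add: power_divide power_mult[symmetric] mult.commute[of n 2]) (simp add: power_mult)
    moreover have "(9 / 10 :: real) ^ 4 = 6561 / 10000" by (simp add: eval_nat_numeral)
    ultimately show ?thesis by (simp add: power_divide[symmetric])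
  qed
  then have "3 * (t - s)\<^sup>2 / ((9 / 10) ^ n) ^ 4 = 3 * (2500 / 6561) ^ n" by simp
  finally show ?thesis unfolding t_def s_def .
qed

lemma
  shows measurable_large_increment: "{\<omega>\<in>space L. c < \<bar>\<omega> (real j / 2 ^ n) - \<omega> (real k / 2 ^ n)\<bar>} \<in> events"
    and measurable_small_increment: "{\<omega>\<in>space L. \<bar>\<omega> (real j / 2 ^ n) - \<omega> (real k / 2 ^ n)\<bar> \<le> c} \<in> events"
proof -
  have "(\<lambda>\<omega>. \<bar>\<omega> (real j / 2 ^ n) - \<omega> (real k / 2 ^ n)\<bar>) \<in> borel_measurable L"
    by (intro borel_measurable_abs borel_measurable_diff measurable_dyadic_coordinate[of _ n] dyadics_I)
  then show "{\<omega>\<in>space L. c < \<bar>\<omega> (real j / 2 ^ n) - \<omega> (real k / 2 ^ n)\<bar>} \<in> events"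
    "{\<omega>\<in>space L. \<bar>\<omega> (real j / 2 ^ n) - \<omega> (real k / 2 ^ n)\<bar> \<le> c} \<in> events" by measurable
qed

text \<open>Borel-Cantelli for each horizon \<open>m\<close>: there are m 2^n increments at level
  \<open>n\<close>, and twice 2500/6561 is below 1, so the failure probabilities are
  summable.\<close>

lemma AE_regular_increments: "AE \<omega> in L. regular_increments \<omega>"
  unfolding regular_increments_def
proof (subst AE_all_countable, intro allI)
  fix m
  define B where "B n = (\<Union>k\<in>{..<m * 2 ^ n}. {\<omega>\<in>space L. (9 / 10) ^ n < \<bar>\<omega> (real (Suc k) / 2 ^ n) - \<omega> (real k / 2 ^ n)\<bar>})" for n
  have B: "B n \<in> events" for n
    unfolding B_def by (intro sets.finite_UN measurable_large_increment) auto
  have "prob (B n) \<le> 3 * real m * (5000 / 6561) ^ n" for n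
  proof -
    have "prob (B n) \<le> (\<Sum>k<m * 2 ^ n. prob {\<omega>\<in>space L. (9 / 10) ^ n < \<bar>\<omega> (real (Suc k) / 2 ^ n) - \<omega> (real k / 2 ^ n)\<bar>})"
      unfolding B_def by (intro finite_measure_subadditive_finite image_subsetI measurable_large_increment) simp
    also have "\<dots> \<le> (\<Sum>k<m * 2 ^ n. 3 * (2500 / 6561) ^ n)"
      by (intro sum_mono prob_large_increment)
    also have "\<dots> = 3 * real m * (2 ^ n * (2500 / 6561) ^ n)" by simp
    also have "2 ^ n * (2500 / 6561) ^ n = (5000 / 6561 :: real) ^ n" by (simp add: power_mult_distrib[symmetric])
    finally show ?thesis .
  qed
  then have bound: "norm (prob (B n)) \<le> 3 * real m * (5000 / 6561) ^ n" for n by simp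
  have "summable (\<lambda>n. 3 * real m * (5000 / 6561) ^ n)" by (rule summable_mult, rule summable_geometric) simp
  then have "summable (\<lambda>n. prob (B n))" by (rule summable_comparison_test'[where N = 0]) (rule bound)
  then have "AE \<omega> in L. \<forall>\<^sub>F n in sequentially. \<omega> \<in> space L - B n"
    by (intro borel_cantelli_AE1 B) (auto simp: emeasure_eq_measure)
  then show "AE \<omega> in L. \<exists>n0. \<forall>n\<ge>n0. \<forall>k<m * 2 ^ n. \<bar>\<omega> (real (Suc k) / 2 ^ n) - \<omega> (real k / 2 ^ n)\<bar> \<le> (9 / 10) ^ n"
  proof eventually_elim
    case (elim \<omega>)
    then obtain n0 where "\<And>n. n \<ge> n0 \<Longrightarrow> \<omega> \<in> space L - B n" by (auto simp: eventually_sequentially)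
    then show ?case by (intro exI[of _ n0]) (auto simp: B_def not_less)
  qed
qed

text \<open>The other paths form a null set but have to be removed, because
  \<open>brownian_motion\<close> asks for continuity and the start in 0 at every sample
  point.\<close>

definition good :: "(real \<Rightarrow> real) set" where
  "good = {\<omega>\<in>space L. \<omega> 0 = 0 \<and> regular_increments \<omega>}"

lemma good_sets: "good \<in> events"
proof -
  have 0: "(0 :: real) \<in> dyadics 0" by (auto simp: dyadics_def)
  have "{\<omega>\<in>space L. \<omega> 0 = 0} \<in> events"
    using sets_Collect_finite_mem[of "{0}" "\<lambda>q \<omega>. \<omega> q" L "\<lambda>_. {0}"] measurable_dyadic_coordinate[OF 0] by simp
  moreover have "{\<omega>\<in>space L. regular_increments \<omega>} \<in> events"
    unfolding regular_increments_def
    by (intro sets.sets_Collect_countable_All sets.sets_Collect_countable_Ex sets.sets_Collect_imp sets.sets_Collect_const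
        measurable_small_increment)
  ultimately have "{\<omega>\<in>space L. \<omega> 0 = 0} \<inter> {\<omega>\<in>space L. regular_increments \<omega>} \<in> events" by blast
  also have "{\<omega>\<in>space L. \<omega> 0 = 0} \<inter> {\<omega>\<in>space L. regular_increments \<omega>} = good" by (auto simp: good_def)
  finally show ?thesis .
qed

lemma AE_good: "AE \<omega> in L. \<omega> \<in> good"
  using AE_start AE_regular_increments AE_space by eventually_elim (simp add: good_def)

end

text \<open>Independence and normality of increments are combined in one product formula; the whole
  space as \<open>A\<close> gives the law of the increment.\<close>

locale brownian_motion = prob_space M for M :: "'a measure" +
  fixes W :: "real \<Rightarrow> 'a \<Rightarrow> real"
  assumes measurable_W: "\<And>t. 0 \<le> t \<Longrightarrow> W t \<in> borel_measurable M"
    and W_0: "\<And>\<omega>. \<omega> \<in> space M \<Longrightarrow> W 0 \<omega> = 0"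
    and continuous_W: "\<And>\<omega>. \<omega> \<in> space M \<Longrightarrow> continuous_on {0..} (\<lambda>t. W t \<omega>)"
    and indep_increment: "\<And>s t A B. 0 \<le> s \<Longrightarrow> 0 \<le> t \<Longrightarrow> A \<in> sets (natural_filtration (space M) W s) \<Longrightarrow> B \<in> sets borel \<Longrightarrow>
      prob (A \<inter> {\<omega>\<in>space M. W (s + t) \<omega> - W s \<omega> \<in> B}) = prob A * measure (centered_normal t) B"

lemma borel_measurable_iexp: "f \<in> borel_measurable M \<Longrightarrow> (\<lambda>x. iexp (f x)) \<in> borel_measurable M"
  by (erule measurable_compose, rule borel_measurable_continuous_onI) (intro continuous_intros)

text \<open>Conditioned on \<open>E\<close>, the variable \<open>Y\<close> has the characteristic
  function of the normal law, hence that law; undoing the conditioning gives the product. A null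
  event is treated apart because conditioning divides by its probability.\<close>

lemma (in prob_space) indep_normal_charI:
  assumes Y[measurable]: "Y \<in> borel_measurable M" and E[measurable]: "E \<in> events" and v: "0 \<le> v"
    and char: "\<And>u. (LINT \<omega>|M. complex_of_real (indicator E \<omega>) * iexp (u * Y \<omega>)) = complex_of_real (prob E * exp (- (u\<^sup>2 * v) / 2))"
    and B: "B \<in> sets borel"
  shows "prob (E \<inter> {\<omega>\<in>space M. Y \<omega> \<in> B}) = prob E * measure (centered_normal v) B"
proof (cases "prob E = 0")
  case True
  have YB: "{\<omega>\<in>space M. Y \<omega> \<in> B} \<in> events" using measurable_sets[OF Y B] by (simp add: vimage_def Int_def conj_commute)
  have "prob (E \<inter> {\<omega>\<in>space M. Y \<omega> \<in> B}) \<le> prob E" by (rule finite_measure_mono) auto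
  then show ?thesis using True measure_nonneg[of M "E \<inter> {\<omega>\<in>space M. Y \<omega> \<in> B}"] by simp
next
  case False
  define p where "p = prob E"
  have p: "0 < p" using False zero_less_measure_iff[of M E] by (simp add: p_def)
  have U_eq: "uniform_measure M E = density M (\<lambda>\<omega>. ennreal (indicator E \<omega> / p))"
    unfolding uniform_measure_def using p
    by (intro density_cong) (auto simp: emeasure_eq_measure p_def[symmetric] divide_ennreal indicator_def ennreal_1[symmetric] simp del: ennreal_1)
  interpret U: prob_space "uniform_measure M E"
    using False by (intro prob_space_uniform_measure) (auto simp: emeasure_eq_measure)
  have YU[measurable]: "Y \<in> borel_measurable (uniform_measure M E)" using Y by (simp cong: measurable_cong_sets)
  have "distr (uniform_measure M E) borel Y = centered_normal v"
  proof (rule Levy_uniqueness)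
    show "real_distribution (distr (uniform_measure M E) borel Y)"
      using U.prob_space_distr[OF YU] by (simp add: real_distribution_def real_distribution_axioms_def)
    show "real_distribution (centered_normal v)" by (rule real_distribution_centered_normal)
    show "char (distr (uniform_measure M E) borel Y) = char (centered_normal v)"
    proof
      fix u
      have iY: "(\<lambda>\<omega>. iexp (u * Y \<omega>)) \<in> borel_measurable M" by (intro borel_measurable_iexp borel_measurable_times borel_measurable_const Y)
      have "char (distr (uniform_measure M E) borel Y) u = (LINT \<omega>|uniform_measure M E. iexp (u * Y \<omega>))"
        unfolding char_def by (rule integral_distr[OF YU]) auto
      also have "\<dots> = (LINT \<omega>|M. (indicator E \<omega> / p) *\<^sub>R iexp (u * Y \<omega>))"
        unfolding U_eq using p iY by (intro integral_density) auto
      also have "\<dots> = (LINT \<omega>|M. (complex_of_real (indicator E \<omega>) * iexp (u * Y \<omega>)) / complex_of_real p)"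
        by (intro Bochner_Integration.integral_cong) (auto simp: scaleR_conv_of_real)
      also have "\<dots> = complex_of_real (exp (- (u\<^sup>2 * v) / 2))"
        using p by (simp only: Bochner_Integration.integral_divide_zero char) (simp add: p_def[symmetric])
      finally show "char (distr (uniform_measure M E) borel Y) u = char (centered_normal v) u"
        using v by (simp add: char_centered_normal)
    qed
  qed
  then have "measure (centered_normal v) B = measure (distr (uniform_measure M E) borel Y) B" by simp
  also have "\<dots> = measure (uniform_measure M E) {\<omega>\<in>space M. Y \<omega> \<in> B}"
    by (subst measure_distr[OF YU B]) (auto intro!: arg_cong[where f = "measure _"])
  also have "\<dots> = prob (E \<inter> {\<omega>\<in>space M. Y \<omega> \<in> B}) / p"
    using p measurable_sets[OF Y B] unfolding p_def
    by (subst measure_uniform_measure) (auto simp: vimage_def Int_def conj_commute emeasure_eq_measure)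
  finally show ?thesis using p by (simp add: p_def field_simps)
qed

section \<open>The continuous extension is a Brownian motion\<close>

context dyadic_process
begin

definition wiener :: "(real \<Rightarrow> real) measure" where "wiener = restrict_space L good"

lemma good_subset: "good \<subseteq> space L" by (auto simp: good_def)

lemma space_wiener [simp]: "space wiener = good"
  unfolding wiener_def space_restrict_space using good_subset by auto

lemma prob_space_wiener: "prob_space wiener"
  unfolding wiener_def
  by (intro prob_space_restrict_space good_sets emeasure_eq_1_AE AE_good)

lemma measurable_wiener: "f \<in> borel_measurable L \<Longrightarrow> f \<in> borel_measurable wiener"
  unfolding wiener_def by (rule measurable_restrict_space1)

lemma sets_wiener: "E \<in> events \<Longrightarrow> good \<inter> E \<in> sets wiener"
  unfolding wiener_def using good_sets by (auto simp: sets_restrict_space)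

lemma measure_wiener: "E \<in> events \<Longrightarrow> measure wiener (good \<inter> E) = prob E"
proof -
  assume E: "E \<in> events"
  have "measure wiener (good \<inter> E) = prob (good \<inter> E)"
    unfolding wiener_def using good_sets good_subset by (intro measure_restrict_space) (auto simp: Int_absorb2)
  also have "\<dots> = prob E"
    using E good_sets AE_good by (intro finite_measure_eq_AE) auto
  finally show ?thesis .
qed

lemma integral_wiener:
  fixes f :: "(real \<Rightarrow> real) \<Rightarrow> complex"
  assumes [measurable]: "f \<in> borel_measurable L" shows "(LINT \<omega>|wiener. f \<omega>) = (LINT \<omega>|L. f \<omega>)"
proof -
  have [measurable]: "good \<in> events" by (rule good_sets)
  have "(LINT \<omega>|wiener. f \<omega>) = (LINT \<omega>|L. indicator good \<omega> *\<^sub>R f \<omega>)"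
    unfolding wiener_def using good_sets good_subset by (intro integral_restrict_space) (auto simp: Int_absorb2)
  also have "\<dots> = (LINT \<omega>|L. f \<omega>)"
    using AE_good by (intro integral_cong_AE) auto
  finally show ?thesis .
qed

lemma measurable_dyadic_limit: "0 \<le> t \<Longrightarrow> (\<lambda>\<omega>. dyadic_limit \<omega> t) \<in> borel_measurable wiener"
proof (rule borel_measurable_LIMSEQ_real)
  assume t: "0 \<le> t"
  show "(\<lambda>n. \<omega> (dyadic_floor n t)) \<longlonglongrightarrow> dyadic_limit \<omega> t" if "\<omega> \<in> space wiener" for \<omega>
    using that t by (intro regular_increments_tendsto) (auto simp: good_def)
  show "(\<lambda>\<omega>. \<omega> (dyadic_floor n t)) \<in> borel_measurable wiener" for n
    by (rule measurable_wiener[OF measurable_dyadic_coordinate[OF dyadic_floor_in]])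
qed

text \<open>Both times are replaced by their floors of level \<open>n\<close>, where
  \<open>increment_char\<close> applies, and bounded convergence takes the limit. The past event
  stays admissible: a dyadic q \<le> s is its own floor once its grid is reached, so it stays below
  the floor of s.\<close>

lemma wiener_increment_char:
  fixes A :: "real \<Rightarrow> real set"
  assumes s: "0 \<le> s" and t: "0 \<le> t"
    and J: "finite J" "J \<subseteq> (\<Union>n. dyadics n)" "\<And>q. q \<in> J \<Longrightarrow> q \<le> s" and A: "\<And>q. q \<in> J \<Longrightarrow> A q \<in> sets borel"
  defines "E \<equiv> {\<omega>\<in>space L. \<forall>q\<in>J. \<omega> q \<in> A q}"
  shows "(LINT \<omega>|wiener. complex_of_real (indicator (good \<inter> E) \<omega>) * iexp (u * (dyadic_limit \<omega> (s + t) - dyadic_limit \<omega> s))) =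
    complex_of_real (measure wiener (good \<inter> E) * exp (- (u\<^sup>2 * t) / 2))"
proof -
  interpret W: prob_space wiener by (rule prob_space_wiener)
  obtain n0 where n0: "J \<subseteq> dyadics n0" using finite_dyadics_level[OF J(1,2)] .
  have E: "E \<in> events" unfolding E_def
    using J(1) A n0 by (intro sets_Collect_finite_mem) (auto intro: measurable_dyadic_coordinate)
  define d where "d n = dyadic_floor n (s + t) - dyadic_floor n s" for n
  define Z where "Z n \<omega> = complex_of_real (indicator E \<omega>) * iexp (u * (\<omega> (dyadic_floor n (s + t)) - \<omega> (dyadic_floor n s)))" for n \<omega>
  have Zm: "Z n \<in> borel_measurable L" for n
  proof -
    have "(\<lambda>\<omega>. u * (\<omega> (dyadic_floor n (s + t)) - \<omega> (dyadic_floor n s))) \<in> borel_measurable L"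
      by (intro borel_measurable_times borel_measurable_const borel_measurable_diff
          measurable_dyadic_coordinate[OF dyadic_floor_in])
    from borel_measurable_iexp[OF this] have "(\<lambda>\<omega>. iexp (u * (\<omega> (dyadic_floor n (s + t)) - \<omega> (dyadic_floor n s)))) \<in> borel_measurable L" .
    then show ?thesis unfolding Z_def
      using E by (intro borel_measurable_times borel_measurable_complex_of_real borel_measurable_indicator)
  qed
  have eq: "(LINT \<omega>|wiener. Z n \<omega>) = complex_of_real (prob E * exp (- (u\<^sup>2 * d n) / 2))" if "n \<ge> n0" for n
  proof -
    have Jn: "J \<subseteq> dyadics n" using n0 dyadics_mono[OF that] by auto
    have "q \<le> dyadic_floor n s" if "q \<in> J" for q
      using dyadic_floor_mono[OF J(3)[OF that], of n] dyadic_floor_eq[of q n] that Jn by auto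
    then have "(LINT \<omega>|L. Z n \<omega>) = complex_of_real (prob E * exp (- (u\<^sup>2 * d n) / 2))"
      unfolding Z_def d_def E_def using J(1) Jn A t
      by (intro increment_char) (auto intro: dyadic_floor_in dyadic_floor_mono)
    then show ?thesis using integral_wiener[OF Zm] by simp
  qed
  have lim: "(\<lambda>n. \<omega> (dyadic_floor n v)) \<longlonglongrightarrow> dyadic_limit \<omega> v" if "\<omega> \<in> good" "0 \<le> v" for \<omega> v
    using that by (intro regular_increments_tendsto) (auto simp: good_def)
  have "(\<lambda>n. LINT \<omega>|wiener. Z n \<omega>) \<longlonglongrightarrow>
      (LINT \<omega>|wiener. complex_of_real (indicator (good \<inter> E) \<omega>) * iexp (u * (dyadic_limit \<omega> (s + t) - dyadic_limit \<omega> s)))"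
  proof (rule integral_dominated_convergence[where w = "\<lambda>_. 1"])
    show "AE \<omega> in wiener. (\<lambda>n. Z n \<omega>) \<longlonglongrightarrow> complex_of_real (indicator (good \<inter> E) \<omega>) * iexp (u * (dyadic_limit \<omega> (s + t) - dyadic_limit \<omega> s))"
    proof (rule AE_I2)
      fix \<omega> assume "\<omega> \<in> space wiener"
      then have g: "\<omega> \<in> good" by simp
      have "(\<lambda>n. complex_of_real (indicator E \<omega>) * iexp (u * (\<omega> (dyadic_floor n (s + t)) - \<omega> (dyadic_floor n s)))) \<longlonglongrightarrow>
          complex_of_real (indicator E \<omega>) * iexp (u * (dyadic_limit \<omega> (s + t) - dyadic_limit \<omega> s))"
        using s t by (intro tendsto_intros lim g) auto
      then show "(\<lambda>n. Z n \<omega>) \<longlonglongrightarrow> complex_of_real (indicator (good \<inter> E) \<omega>) * iexp (u * (dyadic_limit \<omega> (s + t) - dyadic_limit \<omega> s))"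
        using g by (simp add: Z_def indicator_def)
    qed
    show "AE \<omega> in wiener. norm (Z n \<omega>) \<le> 1" for n
      by (intro AE_I2) (simp add: Z_def norm_mult indicator_def)
    show "Z n \<in> borel_measurable wiener" for n by (rule measurable_wiener[OF Zm])
    have "(\<lambda>\<omega>. u * (dyadic_limit \<omega> (s + t) - dyadic_limit \<omega> s)) \<in> borel_measurable wiener"
      using s t by (intro borel_measurable_times borel_measurable_const borel_measurable_diff measurable_dyadic_limit) auto
    from borel_measurable_iexp[OF this] have "(\<lambda>\<omega>. iexp (u * (dyadic_limit \<omega> (s + t) - dyadic_limit \<omega> s))) \<in> borel_measurable wiener" .
    then show "(\<lambda>\<omega>. complex_of_real (indicator (good \<inter> E) \<omega>) * iexp (u * (dyadic_limit \<omega> (s + t) - dyadic_limit \<omega> s))) \<in> borel_measurable wiener"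
      using sets_wiener[OF E] by (intro borel_measurable_times borel_measurable_complex_of_real borel_measurable_indicator)
  qed simp
  moreover have "(\<lambda>n. LINT \<omega>|wiener. Z n \<omega>) \<longlonglongrightarrow> complex_of_real (prob E * exp (- (u\<^sup>2 * t) / 2))"
  proof (rule Lim_transform_eventually)
    have "d \<longlonglongrightarrow> (s + t) - s"
      unfolding d_def using s t by (intro tendsto_diff dyadic_floor_tendsto) auto
    then have "d \<longlonglongrightarrow> t" by simp
    then show "(\<lambda>n. complex_of_real (prob E * exp (- (u\<^sup>2 * d n) / 2))) \<longlonglongrightarrow> complex_of_real (prob E * exp (- (u\<^sup>2 * t) / 2))"
      by (intro tendsto_intros) auto
    show "\<forall>\<^sub>F n in sequentially. complex_of_real (prob E * exp (- (u\<^sup>2 * d n) / 2)) = (LINT \<omega>|wiener. Z n \<omega>)"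
      using eventually_ge_at_top[of n0] by eventually_elim (use eq in simp)
  qed
  ultimately show ?thesis unfolding measure_wiener[OF E] by (rule LIMSEQ_unique)
qed

text \<open>Independence is first known for finite dyadic cylinders; as these are stable under
  intersection, it extends to the sigma-algebra they generate, which contains the past of the
  continuous process.\<close>

lemma brownian_motion_wiener: "brownian_motion wiener (\<lambda>t \<omega>. dyadic_limit \<omega> t)"
proof -
  interpret W: prob_space wiener by (rule prob_space_wiener)
  show ?thesis
  proof
    show "(\<lambda>\<omega>. dyadic_limit \<omega> t) \<in> borel_measurable wiener" if "0 \<le> t" for t
      using that by (rule measurable_dyadic_limit)
    show "dyadic_limit \<omega> 0 = 0" if "\<omega> \<in> space wiener" for \<omega>
    proof -
      have "(0 :: real) \<in> dyadics 0" using dyadics_I[of 0 0] by simp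
      then show ?thesis using that regular_increments_dyadic[of \<omega> 0 0] by (simp add: good_def)
    qed
    show "continuous_on {0..} (\<lambda>t. dyadic_limit \<omega> t)" if "\<omega> \<in> space wiener" for \<omega>
      using that continuous_on_dyadic_limit[of \<omega>] by (simp add: good_def)
    fix s t :: real and A and B :: "real set"
    assume s: "0 \<le> s" and t: "0 \<le> t" and A: "A \<in> sets (natural_filtration (space wiener) (\<lambda>t \<omega>. dyadic_limit \<omega> t) s)"
      and B: "B \<in> sets borel"
    define cyl where "cyl J D = good \<inter> {\<omega>\<in>space L. \<forall>q\<in>J. \<omega> q \<in> D q}" for J and D :: "real \<Rightarrow> real set"
    define \<C> where "\<C> = {cyl J D |J D. finite J \<and> J \<subseteq> (\<Union>n. dyadics n) \<and> (\<forall>q\<in>J. q \<le> s \<and> D q \<in> sets borel)}"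
    define Y where "Y \<omega> = dyadic_limit \<omega> (s + t) - dyadic_limit \<omega> s" for \<omega>
    define \<B> where "\<B> = {Y -` B \<inter> space wiener |B. B \<in> sets borel}"
    have Y: "Y \<in> borel_measurable wiener"
      unfolding Y_def using s t by (intro borel_measurable_diff measurable_dyadic_limit) auto
    have cyl_sets: "cyl J D \<in> sets wiener" if J: "finite J" "J \<subseteq> (\<Union>n. dyadics n)" "\<forall>q\<in>J. q \<le> s \<and> D q \<in> sets borel" for J D
      unfolding cyl_def using J by (intro sets_wiener sets_Collect_finite_mem) (auto intro: measurable_dyadic_coordinate)
    have ind: "W.prob (cyl J D \<inter> {\<omega>\<in>space wiener. Y \<omega> \<in> B}) = W.prob (cyl J D) * measure (centered_normal t) B"
      if J: "finite J" "J \<subseteq> (\<Union>n. dyadics n)" "\<forall>q\<in>J. q \<le> s \<and> D q \<in> sets borel" and B: "B \<in> sets borel" for J D B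
    proof (rule W.indep_normal_charI[OF Y cyl_sets[OF J] t _ B])
      show "(LINT \<omega>|wiener. complex_of_real (indicator (cyl J D) \<omega>) * iexp (u * Y \<omega>)) =
          complex_of_real (W.prob (cyl J D) * exp (- (u\<^sup>2 * t) / 2))" for u
        unfolding cyl_def Y_def by (rule wiener_increment_char[OF s t J(1,2)]) (use J(3) in auto)
    qed
    have YB: "Y -` B \<inter> space wiener = {\<omega>\<in>space wiener. Y \<omega> \<in> B}" for B by auto
    have marg: "W.prob {\<omega>\<in>space wiener. Y \<omega> \<in> B} = measure (centered_normal t) B" if "B \<in> sets borel" for B
    proof -
      have "cyl {} (\<lambda>_. UNIV) = space wiener" using good_subset by (auto simp: cyl_def)
      then show ?thesis using ind[of "{}" "\<lambda>_. UNIV" B] that W.prob_space by (simp add: Int_absorb1 Int_def)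
    qed
    have "W.indep_set \<C> \<B>"
    proof (rule W.indep_setI)
      show "\<C> \<subseteq> sets wiener" unfolding \<C>_def using cyl_sets by blast
      show "\<B> \<subseteq> sets wiener" unfolding \<B>_def using measurable_sets[OF Y] by blast
      show "W.prob (a \<inter> b) = W.prob a * W.prob b" if "a \<in> \<C>" "b \<in> \<B>" for a b
        using that ind marg unfolding \<C>_def \<B>_def YB by auto
    qed
    moreover have "Int_stable \<C>"
    proof (rule Int_stableI)
      fix a b assume "a \<in> \<C>" "b \<in> \<C>"
      then obtain J D K D' where a: "a = cyl J D" "finite J" "J \<subseteq> (\<Union>n. dyadics n)" "\<forall>q\<in>J. q \<le> s \<and> D q \<in> sets borel"
        and b: "b = cyl K D'" "finite K" "K \<subseteq> (\<Union>n. dyadics n)" "\<forall>q\<in>K. q \<le> s \<and> D' q \<in> sets borel"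
        unfolding \<C>_def by blast
      \<comment> \<open>Coordinates outside one of the two index sets are unconstrained there, so
        conditions are padded by \<open>UNIV\<close> before being intersected.\<close>
      define D'' where "D'' q = (if q \<in> J then D q else UNIV) \<inter> (if q \<in> K then D' q else UNIV)" for q
      have "a \<inter> b = cyl (J \<union> K) D''" unfolding a(1) b(1) cyl_def D''_def by auto
      moreover have "\<forall>q\<in>J \<union> K. q \<le> s \<and> D'' q \<in> sets borel" using a(4) b(4) by (auto simp: D''_def)
      ultimately show "a \<inter> b \<in> \<C>" unfolding \<C>_def using a b by (auto intro!: exI[of _ "J \<union> K"] exI[of _ D''])
    qed
    moreover have "Int_stable \<B>"
    proof (rule Int_stableI)
      fix a b assume "a \<in> \<B>" "b \<in> \<B>"
      then obtain B1 B2 where "a = Y -` B1 \<inter> space wiener" "B1 \<in> sets borel" "b = Y -` B2 \<inter> space wiener" "B2 \<in> sets borel"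
        unfolding \<B>_def by blast
      then have "a \<inter> b = Y -` (B1 \<inter> B2) \<inter> space wiener" "B1 \<inter> B2 \<in> sets borel" by auto
      then show "a \<inter> b \<in> \<B>" unfolding \<B>_def by blast
    qed
    ultimately have indep: "W.indep_set (sigma_sets (space wiener) \<C>) (sigma_sets (space wiener) \<B>)"
      by (rule W.indep_set_sigma_sets)
    define G where "G = sigma good \<C>"
    have \<C>_sub: "\<C> \<subseteq> Pow good" unfolding \<C>_def cyl_def by auto
    have sG: "sets G = sigma_sets good \<C>" "space G = good" unfolding G_def using \<C>_sub by (simp_all add: sets_measure_of space_measure_of)
    have coord: "(\<lambda>\<omega>. \<omega> q) \<in> borel_measurable G" if "q \<in> dyadics n" "q \<le> s" for q n
    proof (rule measurableI)
      fix D :: "real set" assume "D \<in> sets borel"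
      then have "cyl {q} (\<lambda>_. D) \<in> \<C>" unfolding \<C>_def using that by blast
      moreover have "cyl {q} (\<lambda>_. D) = (\<lambda>\<omega>. \<omega> q) -` D \<inter> space G" using good_subset sG by (auto simp: cyl_def)
      ultimately show "(\<lambda>\<omega>. \<omega> q) -` D \<inter> space G \<in> sets G" unfolding sG(1) by auto
    qed simp
    \<comment> \<open>The limit at \<open>v\<close> runs through dyadics not exceeding
      \<open>v\<close>, hence not exceeding \<open>s\<close>: rounding down keeps the process
      adapted to the dyadic past.\<close>
    have lim_G: "(\<lambda>\<omega>. dyadic_limit \<omega> v) \<in> borel_measurable G" if "0 \<le> v" "v \<le> s" for v
    proof (rule borel_measurable_LIMSEQ_real)
      show "(\<lambda>n. \<omega> (dyadic_floor n v)) \<longlonglongrightarrow> dyadic_limit \<omega> v" if "\<omega> \<in> space G" for \<omega>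
        using that \<open>0 \<le> v\<close> sG by (intro regular_increments_tendsto) (auto simp: good_def)
      show "(\<lambda>\<omega>. \<omega> (dyadic_floor n v)) \<in> borel_measurable G" for n
        using dyadic_floor_le[of v n] that by (intro coord[OF dyadic_floor_in]) auto
    qed
    have "sets (natural_filtration (space wiener) (\<lambda>t \<omega>. dyadic_limit \<omega> t) s) \<subseteq> sets G"
      unfolding sets_natural_filtration
    proof (simp only: space_wiener sG(2)[symmetric], rule sets.sigma_sets_subset)
      show "(\<Union>sa\<in>{0..s}. {(\<lambda>\<omega>. dyadic_limit \<omega> sa) -` A \<inter> space G |A. A \<in> sets borel}) \<subseteq> sets G"
        using measurable_sets[OF lim_G] by auto
    qed
    with A have "A \<in> sigma_sets (space wiener) \<C>" unfolding sG by auto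
    moreover have "Y -` B \<inter> space wiener \<in> sigma_sets (space wiener) \<B>" using B unfolding \<B>_def by auto
    ultimately have "W.prob (A \<inter> (Y -` B \<inter> space wiener)) = W.prob A * W.prob (Y -` B \<inter> space wiener)"
      by (rule W.indep_setD[OF indep])
    then show "W.prob (A \<inter> {\<omega>\<in>space wiener. dyadic_limit \<omega> (s + t) - dyadic_limit \<omega> s \<in> B}) = W.prob A * measure (centered_normal t) B"
      unfolding YB marg[OF B] by (simp only: Y_def)
  qed
qed

end

theorem brownian_motion_exists: "\<exists>(M :: (real \<Rightarrow> real) measure) W. brownian_motion M W"
proof -
  obtain L :: "(real \<Rightarrow> real) measure" where "prob_space L" "sets L = sets (PiM (\<Union>n. dyadics n) (\<lambda>_. borel))"
    "\<forall>J n. finite J \<longrightarrow> J \<subseteq> dyadics n \<longrightarrow> distr L (PiM J (\<lambda>_. borel)) (\<lambda>\<omega>. restrict \<omega> J) = walk_law n J"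
    using dyadic_gaussian_process_exists by blast
  then have "dyadic_process L" by (simp add: dyadic_process_def dyadic_process_axioms_def)
  then show ?thesis using dyadic_process.brownian_motion_wiener by blast
qed

section \<open>Existence of reflected Brownian motion\<close>

text \<open>One space for all starting points, with the coordinates as process. Continuity and
  nonnegativity must hold at every point, so other paths are cut away. The continuous paths are not
  a measurable subset of the uncountable product; only the trace sigma-algebra is used.\<close>

definition reflected_paths :: "(real \<Rightarrow> real) measure" where
  "reflected_paths = restrict_space (PiM UNIV (\<lambda>_. borel)) {w. continuous_on {0..} w \<and> (\<forall>t\<ge>0. 0 \<le> w t)}"

lemma space_reflected_paths: "space reflected_paths = {w. continuous_on {0..} w \<and> (\<forall>t\<ge>0. 0 \<le> w t)}"
  by (simp add: reflected_paths_def space_restrict_space space_PiM)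

lemma measurable_reflected_coordinate [measurable]: "(\<lambda>w. w t) \<in> borel_measurable reflected_paths"
  unfolding reflected_paths_def by (intro measurable_restrict_space1 measurable_component_singleton) simp

lemma measurable_reflected_pathsI:
  assumes "\<And>t. (\<lambda>x. f x t) \<in> borel_measurable M" "\<And>x. x \<in> space M \<Longrightarrow> f x \<in> space reflected_paths"
  shows "f \<in> M \<rightarrow>\<^sub>M reflected_paths"
  unfolding reflected_paths_def
proof (rule measurable_restrict_space2)
  show "f \<in> space M \<rightarrow> {w. continuous_on {0..} w \<and> (\<forall>t\<ge>0. 0 \<le> w t)}" using assms(2) by (auto simp: space_reflected_paths)
  show "f \<in> M \<rightarrow>\<^sub>M PiM UNIV (\<lambda>_. borel)" using assms(1) by (intro measurable_PiM_single') auto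
qed

lemma prob_space_centered_normal: "prob_space (centered_normal v)"
  using real_distribution_centered_normal by (simp add: real_distribution_def)

lemma sets_centered_normal [simp, measurable_cong]: "sets (centered_normal v) = sets borel"
  by (simp add: centered_normal_def)

lemma integral_centered_normal:
  fixes g :: "real \<Rightarrow> real"
  assumes "g \<in> borel_measurable borel"
  shows "(LINT z|centered_normal v. g z) = (LINT z|std_normal_distribution. g (sqrt v * z))"
  unfolding centered_normal_def using assms by (intro integral_distr) auto

lemma integral_centered_normal_uminus:
  fixes g :: "real \<Rightarrow> real"
  assumes [measurable]: "g \<in> borel_measurable borel"
  shows "(LINT z|centered_normal v. g (- z)) = (LINT z|centered_normal v. g z)"
proof -
  have even: "std_normal_density (- z) = std_normal_density z" for z by (simp add: normal_density_def)
  have "(LINT z|std_normal_distribution. g (sqrt v * z)) = (LINT z|lborel. std_normal_density z * g (sqrt v * z))"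
    by (subst integral_real_density) auto
  also have "\<dots> = (LINT z|lborel. std_normal_density z * g (- (sqrt v * z)))"
    using lborel_integral_real_affine[of "- 1" "\<lambda>z. std_normal_density z * g (sqrt v * z)" 0] by (simp add: even)
  also have "\<dots> = (LINT z|std_normal_distribution. g (- (sqrt v * z)))"
    by (subst integral_real_density) auto
  finally show ?thesis by (simp add: integral_centered_normal)
qed

text \<open>The heat semigroup applied to the even extension of \<open>g\<close>; negative
  \<open>y\<close> are included so that its symmetry can be used.\<close>

definition reflected_semigroup :: "real \<Rightarrow> (real \<Rightarrow> real) \<Rightarrow> real \<Rightarrow> real" where
  "reflected_semigroup t g y = (LINT z|centered_normal t. g \<bar>y + z\<bar>)"

text \<open>By symmetry of the normal law the value depends only on the distance from 0; this is why
  the modulus of Brownian motion is Markov.\<close>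

lemma reflected_semigroup_abs:
  assumes [measurable]: "g \<in> borel_measurable borel"
  shows "reflected_semigroup t g \<bar>y\<bar> = reflected_semigroup t g y"
proof (cases "0 \<le> y")
  case False
  have "reflected_semigroup t g y = (LINT z|centered_normal t. g \<bar>y + - z\<bar>)"
    unfolding reflected_semigroup_def by (rule integral_centered_normal_uminus[symmetric]) measurable
  also have "\<dots> = reflected_semigroup t g \<bar>y\<bar>"
    unfolding reflected_semigroup_def using False
    by (intro Bochner_Integration.integral_cong) (auto simp: abs_minus_commute)
  finally show ?thesis ..
qed simp

lemma borel_measurable_reflected_semigroup:
  assumes g[measurable]: "g \<in> borel_measurable borel"
  shows "(\<lambda>(t, y). reflected_semigroup t g y) \<in> borel_measurable (borel \<Otimes>\<^sub>M borel)"
proof -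
  interpret S: prob_space std_normal_distribution by (rule prob_space_normal_density) simp
  have "(\<lambda>z. g \<bar>snd (fst z) + sqrt (fst (fst z)) * snd z\<bar>) \<in> borel_measurable ((borel \<Otimes>\<^sub>M borel) \<Otimes>\<^sub>M borel)"
    by measurable
  also have "borel_measurable ((borel \<Otimes>\<^sub>M borel) \<Otimes>\<^sub>M borel) = borel_measurable ((borel \<Otimes>\<^sub>M borel) \<Otimes>\<^sub>M std_normal_distribution)"
    by (intro measurable_cong_sets sets_pair_measure_cong) auto
  finally have "(\<lambda>p. LINT z|std_normal_distribution. g \<bar>snd p + sqrt (fst p) * z\<bar>) \<in> borel_measurable (borel \<Otimes>\<^sub>M borel)"
    by (intro S.borel_measurable_lebesgue_integral) (simp add: case_prod_unfold)
  moreover have "reflected_semigroup t g y = (LINT z|std_normal_distribution. g \<bar>y + sqrt t * z\<bar>)" for t y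
    unfolding reflected_semigroup_def by (rule integral_centered_normal) measurable
  ultimately show ?thesis by (simp add: case_prod_unfold)
qed

lemma reflected_semigroup_bound:
  assumes "\<And>y. 0 \<le> y \<Longrightarrow> \<bar>g y\<bar> \<le> C" shows "\<bar>reflected_semigroup t g y\<bar> \<le> C"
proof -
  interpret prob_space "centered_normal t" by (rule prob_space_centered_normal)
  obtain x where "x \<in> space (centered_normal t)" using not_empty by auto
  have C0: "0 \<le> C" using assms[of 0] by simp
  show ?thesis
  proof (cases "integrable (centered_normal t) (\<lambda>z. g \<bar>y + z\<bar>)")
    case True
    then have "reflected_semigroup t g y \<le> C" "- C \<le> reflected_semigroup t g y"
      using assms unfolding reflected_semigroup_def by (auto intro!: integral_le_const integral_ge_const AE_I2 simp: abs_le_iff minus_le_iff)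
    then show ?thesis by simp
  qed (simp add: reflected_semigroup_def not_integrable_integral_eq C0)
qed

section \<open>Markov property of the reflected process\<close>

context brownian_motion
begin

abbreviation "past s \<equiv> natural_filtration (space M) W s"

lemma past_subset: "sets (past s) \<subseteq> events"
  by (rule sets_natural_filtration_subset) (auto intro: measurable_W)

text \<open>The increment is independent of the past, so the two have a product law, and Fubini
  integrates the increment with the past held fixed.\<close>

lemma past_integral:
  fixes g :: "real \<Rightarrow> real"
  assumes s: "0 \<le> s" and t: "0 \<le> t" and A: "A \<in> sets (past s)"
    and g[measurable]: "g \<in> borel_measurable borel" and C: "\<And>y. \<bar>g y\<bar> \<le> C"
  shows "(LINT \<omega>:A|M. g (x + W (s + t) \<omega>)) = (LINT \<omega>:A|M. (LINT z|centered_normal t. g (x + W s \<omega> + z)))"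
proof -
  interpret N: prob_space "centered_normal t" by (rule prob_space_centered_normal)
  have C0: "0 \<le> C" using C[of 0] by linarith
  define Y where "Y \<omega> = W (s + t) \<omega> - W s \<omega>" for \<omega>
  \<comment> \<open>\<open>Q\<close> is the measure restricted to the past sigma-algebra, written as
    an image under the identity, so that the product involves past events only.\<close>
  define Q where "Q = distr M (past s) (\<lambda>\<omega>. \<omega>)"
  have idm: "(\<lambda>\<omega>. \<omega>) \<in> M \<rightarrow>\<^sub>M past s" using past_subset by (intro measurableI) auto
  interpret Q: prob_space Q unfolding Q_def using idm by (rule prob_space_distr)
  interpret QN: pair_prob_space Q "centered_normal t" ..
  have Y[measurable]: "Y \<in> borel_measurable M" unfolding Y_def using s t by (intro borel_measurable_diff measurable_W) auto
  have pm: "(\<lambda>\<omega>. (\<omega>, Y \<omega>)) \<in> M \<rightarrow>\<^sub>M past s \<Otimes>\<^sub>M borel" using idm Y by (rule measurable_Pair)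
  have joint: "Q \<Otimes>\<^sub>M centered_normal t = distr M (past s \<Otimes>\<^sub>M borel) (\<lambda>\<omega>. (\<omega>, Y \<omega>))"
  proof (rule pair_measure_eqI)
    show "sigma_finite_measure Q" "sigma_finite_measure (centered_normal t)" ..
    show "sets (Q \<Otimes>\<^sub>M centered_normal t) = sets (distr M (past s \<Otimes>\<^sub>M borel) (\<lambda>\<omega>. (\<omega>, Y \<omega>)))"
      by (simp add: Q_def cong: sets_pair_measure_cong)
    fix B D assume "B \<in> sets Q" "D \<in> sets (centered_normal t)"
    then have B: "B \<in> sets (past s)" and D: "D \<in> sets borel" by (simp_all add: Q_def)
    have B': "B \<in> events" using B past_subset by auto
    have "emeasure Q B = prob B" unfolding Q_def
      using emeasure_distr[OF idm B] sets.sets_into_space[OF B'] by (simp add: Int_absorb2 emeasure_eq_measure)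
    moreover have "emeasure (distr M (past s \<Otimes>\<^sub>M borel) (\<lambda>\<omega>. (\<omega>, Y \<omega>))) (B \<times> D) = prob (B \<inter> {\<omega>\<in>space M. Y \<omega> \<in> D})"
    proof -
      have "(\<lambda>\<omega>. (\<omega>, Y \<omega>)) -` (B \<times> D) \<inter> space M = B \<inter> {\<omega>\<in>space M. Y \<omega> \<in> D}" by auto
      then show ?thesis using emeasure_distr[OF pm, of "B \<times> D"] B D by (simp add: emeasure_eq_measure)
    qed
    ultimately show "emeasure Q B * emeasure (centered_normal t) D = emeasure (distr M (past s \<Otimes>\<^sub>M borel) (\<lambda>\<omega>. (\<omega>, Y \<omega>))) (B \<times> D)"
      using indep_increment[OF s t B D] by (simp add: Y_def N.emeasure_eq_measure ennreal_mult)
  qed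
  have Ws: "W s \<in> borel_measurable (past s)" using s by (intro measurable_natural_filtration) auto
  define G where "G p = indicator A (fst p) * g (x + W s (fst p) + snd p)" for p
  have Gm: "G \<in> borel_measurable (past s \<Otimes>\<^sub>M borel)"
  proof -
    have [measurable]: "(\<lambda>p. W s (fst p)) \<in> borel_measurable (past s \<Otimes>\<^sub>M borel)"
      by (rule measurable_compose[OF measurable_fst Ws])
    have [measurable]: "(\<lambda>p. indicator A (fst p) :: real) \<in> borel_measurable (past s \<Otimes>\<^sub>M borel)"
      by (rule measurable_compose[OF measurable_fst borel_measurable_indicator[OF A]])
    have "(\<lambda>p. x + W s (fst p) + snd p) \<in> borel_measurable (past s \<Otimes>\<^sub>M borel)"
      by (intro borel_measurable_add borel_measurable_const) measurable
    from measurable_compose[OF this g] show ?thesis unfolding G_def by measurable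
  qed
  then have Gm': "G \<in> borel_measurable (Q \<Otimes>\<^sub>M centered_normal t)"
    by (simp add: Q_def cong: measurable_cong_sets sets_pair_measure_cong)
  have Gint: "integrable (Q \<Otimes>\<^sub>M centered_normal t) G"
    by (rule QN.integrable_const_bound[where B = C]) (use C C0 Gm' in \<open>auto simp: G_def indicator_def\<close>)
  have "(LINT \<omega>:A|M. g (x + W (s + t) \<omega>)) = (LINT \<omega>|M. G (\<omega>, Y \<omega>))"
    unfolding set_lebesgue_integral_def by (intro Bochner_Integration.integral_cong) (auto simp: G_def Y_def algebra_simps)
  also have "\<dots> = (LINT p|distr M (past s \<Otimes>\<^sub>M borel) (\<lambda>\<omega>. (\<omega>, Y \<omega>)). G p)"
    by (rule integral_distr[OF pm Gm, symmetric])
  also have "\<dots> = (LINT \<omega>|Q. LINT z|centered_normal t. G (\<omega>, z))"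
    unfolding joint[symmetric] by (rule QN.integral_fst'[OF Gint, symmetric])
  also have "\<dots> = (LINT \<omega>|M. LINT z|centered_normal t. G (\<omega>, z))"
    unfolding Q_def
  proof (rule integral_distr[OF idm])
    have "(\<lambda>\<omega>. LINT z|centered_normal t. G (\<omega>, z)) \<in> borel_measurable Q"
      using Gm' by (intro N.borel_measurable_lebesgue_integral) simp
    then show "(\<lambda>\<omega>. LINT z|centered_normal t. G (\<omega>, z)) \<in> borel_measurable (past s)"
      by (simp add: Q_def cong: measurable_cong_sets)
  qed
  also have "\<dots> = (LINT \<omega>:A|M. (LINT z|centered_normal t. g (x + W s \<omega> + z)))"
    unfolding set_lebesgue_integral_def by (simp add: G_def)
  finally show ?thesis .
qed

definition reflected_path :: "real \<Rightarrow> 'a \<Rightarrow> real \<Rightarrow> real" where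
  "reflected_path x \<omega> t = \<bar>x + W (max 0 t) \<omega>\<bar>"

definition reflected_law :: "real \<Rightarrow> (real \<Rightarrow> real) measure" where
  "reflected_law x = distr M reflected_paths (reflected_path x)"

lemma reflected_path_in_space: "\<omega> \<in> space M \<Longrightarrow> reflected_path x \<omega> \<in> space reflected_paths"
proof -
  assume \<omega>: "\<omega> \<in> space M"
  have "continuous_on {0..} (\<lambda>t. W (max 0 t) \<omega>)"
    by (rule continuous_on_compose2[OF continuous_W[OF \<omega>]]) (auto intro!: continuous_on_max continuous_on_const continuous_on_id)
  then have "continuous_on {0..} (\<lambda>t. \<bar>x + W (max 0 t) \<omega>\<bar>)" by (intro continuous_intros)
  then show ?thesis by (simp add: space_reflected_paths reflected_path_def[abs_def])
qed

lemma measurable_reflected_path: "reflected_path x \<in> M \<rightarrow>\<^sub>M reflected_paths"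
proof (rule measurable_reflected_pathsI)
  have [measurable]: "W (max 0 t) \<in> borel_measurable M" for t by (intro measurable_W) simp
  show "(\<lambda>\<omega>. reflected_path x \<omega> t) \<in> borel_measurable M" for t
    unfolding reflected_path_def by measurable
qed (rule reflected_path_in_space)

lemma prob_space_reflected_law: "prob_space (reflected_law x)"
  unfolding reflected_law_def by (rule prob_space_distr[OF measurable_reflected_path])

lemma sets_reflected_law [simp]: "sets (reflected_law x) = sets reflected_paths"
  by (simp add: reflected_law_def)

text \<open>The path depends jointly measurably on the starting point and the sample, so the laws
  are images of one constant kernel.\<close>

lemma measurable_reflected_law: "reflected_law \<in> restrict_space borel S \<rightarrow>\<^sub>M prob_algebra reflected_paths"
proof (rule measurable_prob_algebraI)
  have "(\<lambda>x. distr M reflected_paths (reflected_path x)) \<in> borel \<rightarrow>\<^sub>M subprob_algebra reflected_paths"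
  proof (rule measurable_distr2)
    show "case_prod reflected_path \<in> borel \<Otimes>\<^sub>M M \<rightarrow>\<^sub>M reflected_paths"
    proof (rule measurable_reflected_pathsI)
      have [measurable]: "W (max 0 t) \<in> borel_measurable M" for t by (intro measurable_W) simp
      show "(\<lambda>z. (case z of (x, \<omega>) \<Rightarrow> reflected_path x \<omega>) t) \<in> borel_measurable (borel \<Otimes>\<^sub>M M)" for t
        unfolding reflected_path_def case_prod_unfold by measurable
      show "(case z of (x, \<omega>) \<Rightarrow> reflected_path x \<omega>) \<in> space reflected_paths" if "z \<in> space (borel \<Otimes>\<^sub>M M)" for z
        using that by (auto simp: space_pair_measure intro: reflected_path_in_space)
    qed
    show "(\<lambda>x. M) \<in> borel \<rightarrow>\<^sub>M subprob_algebra M"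
      by (rule measurable_const) (simp add: space_subprob_algebra prob_space_imp_subprob_space prob_space_axioms)
  qed
  then show "reflected_law \<in> restrict_space borel S \<rightarrow>\<^sub>M subprob_algebra reflected_paths"
    unfolding reflected_law_def[abs_def] by (rule measurable_restrict_space1)
qed (rule prob_space_reflected_law)

abbreviation "reflected_past s \<equiv> natural_filtration (space reflected_paths) (\<lambda>t w. w t) s"

text \<open>The modulus forgets the sign, so the past of the reflected path is contained in that of
  \<open>W\<close>, and independence from the larger past passes down.\<close>

lemma vimage_reflected_past:
  assumes "A \<in> sets (reflected_past s)" shows "reflected_path x -` A \<inter> space M \<in> sets (past s)"
proof -
  have "reflected_path x \<in> past s \<rightarrow>\<^sub>M reflected_past s"
    unfolding natural_filtration_def[of "space reflected_paths"]
  proof (rule measurable_measure_of)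
    show "reflected_path x \<in> space (past s) \<rightarrow> space reflected_paths" using reflected_path_in_space by auto
    fix B assume "B \<in> (\<Union>u\<in>{0..s}. {(\<lambda>w. w u) -` A \<inter> space reflected_paths |A. A \<in> sets borel})"
    then obtain u D where u: "0 \<le> u" "u \<le> s" "D \<in> sets borel" "B = (\<lambda>w. w u) -` D \<inter> space reflected_paths" by auto
    have "W u \<in> borel_measurable (past s)" using u by (intro measurable_natural_filtration)
    then have "(\<lambda>\<omega>. \<bar>x + W u \<omega>\<bar>) \<in> borel_measurable (past s)" by measurable
    from measurable_sets[OF this u(3)] show "reflected_path x -` B \<inter> space (past s) \<in> sets (past s)"
      using u reflected_path_in_space by (auto simp: reflected_path_def vimage_def Int_def conj_commute cong: conj_cong)
  qed auto
  from measurable_sets[OF this assms] show ?thesis by simp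
qed

lemma integral_reflected_law:
  fixes h :: "(real \<Rightarrow> real) \<Rightarrow> real"
  assumes "h \<in> borel_measurable reflected_paths"
  shows "(LINT w|reflected_law x. h w) = (LINT \<omega>|M. h (reflected_path x \<omega>))"
  unfolding reflected_law_def by (rule integral_distr[OF measurable_reflected_path assms])

lemma set_integral_reflected_law:
  fixes h :: "(real \<Rightarrow> real) \<Rightarrow> real"
  assumes "h \<in> borel_measurable reflected_paths" "A \<in> sets reflected_paths"
  shows "(LINT w:A|reflected_law x. h w) = (LINT \<omega>:reflected_path x -` A \<inter> space M|M. h (reflected_path x \<omega>))"
proof -
  have "(LINT w:A|reflected_law x. h w) = (LINT \<omega>|M. indicator A (reflected_path x \<omega>) *\<^sub>R h (reflected_path x \<omega>))"
    unfolding set_lebesgue_integral_def using assms by (intro integral_reflected_law) auto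
  also have "\<dots> = (LINT \<omega>:reflected_path x -` A \<inter> space M|M. h (reflected_path x \<omega>))"
    unfolding set_lebesgue_integral_def by (intro Bochner_Integration.integral_cong) (auto simp: indicator_def)
  finally show ?thesis .
qed

lemma reflected_past_subset: "sets (reflected_past s) \<subseteq> sets reflected_paths"
  by (rule sets_natural_filtration_subset) auto

text \<open>Given the past of \<open>W\<close>, the future depends on x + W s; by
  \<open>reflected_semigroup_abs\<close> only the modulus enters, which the reflected path
  knows.\<close>

lemma reflected_Markov:
  fixes g :: "real \<Rightarrow> real"
  assumes s: "0 \<le> s" and t: "0 \<le> t" and A: "A \<in> sets (reflected_past s)"
    and g[measurable]: "g \<in> borel_measurable borel" and C: "\<And>y. \<bar>g y\<bar> \<le> C"
  shows "(LINT w:A|reflected_law x. g (w (s + t))) = (LINT w:A|reflected_law x. reflected_semigroup t g (w s))"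
proof -
  have A': "A \<in> sets reflected_paths" using A reflected_past_subset by auto
  have [measurable]: "reflected_semigroup t g \<in> borel_measurable borel"
    using measurable_Pair2[OF borel_measurable_reflected_semigroup[OF g], of t] by simp
  have "(LINT w:A|reflected_law x. g (w (s + t))) = (LINT \<omega>:reflected_path x -` A \<inter> space M|M. g \<bar>x + W (s + t) \<omega>\<bar>)"
    using s t by (subst set_integral_reflected_law[OF _ A']) (auto simp: reflected_path_def)
  also have "\<dots> = (LINT \<omega>:reflected_path x -` A \<inter> space M|M. reflected_semigroup t g (x + W s \<omega>))"
    unfolding reflected_semigroup_def
    by (rule past_integral[OF s t vimage_reflected_past[OF A]]) (use C in auto)
  also have "\<dots> = (LINT \<omega>:reflected_path x -` A \<inter> space M|M. reflected_semigroup t g \<bar>x + W s \<omega>\<bar>)"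
    by (simp only: reflected_semigroup_abs[OF g])
  also have "\<dots> = (LINT w:A|reflected_law x. reflected_semigroup t g (w s))"
    using s by (subst set_integral_reflected_law[OF _ A']) (auto simp: reflected_path_def)
  finally show ?thesis .
qed

lemma integral_reflected_coordinate:
  fixes g :: "real \<Rightarrow> real"
  assumes t: "0 \<le> t" and g[measurable]: "g \<in> borel_measurable borel" and C: "\<And>y. \<bar>g y\<bar> \<le> C"
  shows "(LINT w|reflected_law x. g (w t)) = reflected_semigroup t g x"
proof -
  have top: "space M \<in> sets (past 0)" using sets.top[of "past 0"] by simp
  have "(LINT w|reflected_law x. g (w t)) = (LINT \<omega>|M. g \<bar>x + W (0 + t) \<omega>\<bar>)"
    using t by (subst integral_reflected_law) (auto simp: reflected_path_def)
  also have "\<dots> = (LINT \<omega>:space M|M. g \<bar>x + W (0 + t) \<omega>\<bar>)" unfolding set_lebesgue_integral_def by (intro Bochner_Integration.integral_cong) auto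
  also have "\<dots> = (LINT \<omega>:space M|M. reflected_semigroup t g (x + W 0 \<omega>))"
    unfolding reflected_semigroup_def by (rule past_integral[OF order.refl t top]) (use C in auto)
  also have "\<dots> = (LINT \<omega>|M. reflected_semigroup t g x)"
    unfolding set_lebesgue_integral_def by (intro Bochner_Integration.integral_cong) (auto simp: W_0)
  finally show ?thesis by (simp add: prob_space)
qed

end

section \<open>Even extensions and second-order Taylor estimates\<close>

lemma has_real_derivative_nonneg_nonpos:
  fixes h :: "real \<Rightarrow> real"
  assumes "0 \<le> v \<Longrightarrow> (h has_real_derivative d) (at v within {0..})"
    and "v \<le> 0 \<Longrightarrow> (h has_real_derivative d) (at v within {..0})"
  shows "(h has_real_derivative d) (at v)"
proof -
  consider "v < 0" | "v = 0" | "0 < v" by linarith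
  then show ?thesis
  proof cases
    case 1 then show ?thesis using assms(2) by (simp add: at_within_interior[of v "{..0}"])
  next
    case 3 then show ?thesis using assms(1) by (simp add: at_within_interior[of v "{0..}"])
  next
    case 2
    have "{0..} \<union> {..0} = (UNIV :: real set)" by auto
    then show ?thesis
      using Lim_Un[OF assms(1)[unfolded has_field_derivative_iff] assms(2)[unfolded has_field_derivative_iff]] 2
      by (simp add: has_field_derivative_iff)
  qed
qed

lemma has_real_derivative_reflect:
  fixes g g' :: "real \<Rightarrow> real"
  assumes "v \<le> 0" and g: "\<And>y. 0 \<le> y \<Longrightarrow> (g has_real_derivative g' y) (at y within {0..})"
  shows "((\<lambda>y. g (- y)) has_real_derivative - g' (- v)) (at v within {..0})"
proof -
  have "uminus ` {..0} = {0 :: real..}" by simp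
  then have "(g has_real_derivative g' (- v)) (at (- v) within uminus ` {..0})" using g[of "- v"] assms(1) by simp
  moreover have "((\<lambda>y :: real. - y) has_real_derivative - 1) (at v within {..0})" by (auto intro!: derivative_eq_intros)
  ultimately show ?thesis using DERIV_image_chain[of g "g' (- v)" uminus v "{..0}" "- 1"] by (simp add: comp_def)
qed

text \<open>The one-sided slopes of the even extension at 0 are \<open>g' 0\<close> and its
  negative; the Neumann condition makes them agree.\<close>

lemma has_real_derivative_even_extension:
  fixes g g' :: "real \<Rightarrow> real"
  assumes g: "\<And>y. 0 \<le> y \<Longrightarrow> (g has_real_derivative g' y) (at y within {0..})" and "g' 0 = 0"
  shows "((\<lambda>y. g \<bar>y\<bar>) has_real_derivative sgn v * g' \<bar>v\<bar>) (at v)"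
proof (rule has_real_derivative_nonneg_nonpos)
  assume v: "0 \<le> v"
  have "sgn v * g' \<bar>v\<bar> = g' v" using v assms(2) by (cases "v = 0") auto
  then show "((\<lambda>y. g \<bar>y\<bar>) has_real_derivative sgn v * g' \<bar>v\<bar>) (at v within {0..})"
    using g[OF v] by (auto intro: has_field_derivative_transform_within[where d = 1] simp: v)
next
  assume v: "v \<le> 0"
  have "sgn v * g' \<bar>v\<bar> = - g' (- v)" using v assms(2) by (cases "v = 0") auto
  then show "((\<lambda>y. g \<bar>y\<bar>) has_real_derivative sgn v * g' \<bar>v\<bar>) (at v within {..0})"
    using has_real_derivative_reflect[OF v g] by (auto intro: has_field_derivative_transform_within[where d = 1] simp: v)
qed

text \<open>Meant for the derivative of an even extension, which is odd. It vanishes at 0 by the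
  Neumann condition, and then its one-sided slopes agree, so the even extension of a test function
  is twice differentiable.\<close>

lemma has_real_derivative_odd_extension:
  fixes g g' :: "real \<Rightarrow> real"
  assumes g: "\<And>y. 0 \<le> y \<Longrightarrow> (g has_real_derivative g' y) (at y within {0..})" and "g 0 = 0"
  shows "((\<lambda>y. sgn y * g \<bar>y\<bar>) has_real_derivative g' \<bar>v\<bar>) (at v)"
proof (rule has_real_derivative_nonneg_nonpos)
  have s1: "sgn y * g \<bar>y\<bar> = g y" if "0 \<le> y" for y using that assms(2) by (cases "y = 0") auto
  have s2: "sgn y * g \<bar>y\<bar> = - g (- y)" if "y \<le> 0" for y using that assms(2) by (cases "y = 0") auto
  show "((\<lambda>y. sgn y * g \<bar>y\<bar>) has_real_derivative g' \<bar>v\<bar>) (at v within {0..})" if v: "0 \<le> v"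
  proof (rule has_field_derivative_transform_within[OF _ zero_less_one])
    show "(g has_real_derivative g' \<bar>v\<bar>) (at v within {0..})" using g[OF v] v by simp
  qed (use s1 v in \<open>simp_all only: atLeast_iff\<close>)
  show "((\<lambda>y. sgn y * g \<bar>y\<bar>) has_real_derivative g' \<bar>v\<bar>) (at v within {..0})" if v: "v \<le> 0"
  proof (rule has_field_derivative_transform_within[OF _ zero_less_one])
    show "((\<lambda>y. - g (- y)) has_real_derivative g' \<bar>v\<bar>) (at v within {..0})"
      using DERIV_minus[OF has_real_derivative_reflect[OF v g]] v by simp
  qed (use s2 v in auto)
qed

lemma second_order_Taylor_bound:
  fixes F F' F'' :: "real \<Rightarrow> real"
  assumes d1: "\<And>v. (F has_real_derivative F' v) (at v)" and d2: "\<And>v. (F' has_real_derivative F'' v) (at v)"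
    and B: "\<And>\<xi>. \<bar>\<xi> - w\<bar> \<le> \<bar>z\<bar> \<Longrightarrow> \<bar>F'' \<xi> - F'' w\<bar> \<le> B"
  shows "\<bar>F (w + z) - F w - F' w * z - F'' w * z\<^sup>2 / 2\<bar> \<le> B * z\<^sup>2 / 2"
proof (cases "z = 0")
  case False
  define diff where "diff m = (if m = 0 then F else if m = 1 then F' else F'')" for m :: nat
  have "\<exists>t. (if w + z < w then w + z < t \<and> t < w else w < t \<and> t < w + z) \<and>
      F (w + z) = (\<Sum>m<2. diff m w / fact m * ((w + z) - w) ^ m) + diff 2 t / fact 2 * ((w + z) - w) ^ 2"
    by (rule Taylor[where a = "min w (w + z)" and b = "max w (w + z)"])
       (use False d1 d2 in \<open>auto simp: diff_def less_Suc_eq numeral_2_eq_2\<close>)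
  then obtain t where t': "if w + z < w then w + z < t \<and> t < w else w < t \<and> t < w + z"
    and eq: "F (w + z) = (\<Sum>m<2. diff m w / fact m * ((w + z) - w) ^ m) + diff 2 t / fact 2 * ((w + z) - w) ^ 2"
    by blast
  have t: "\<bar>t - w\<bar> \<le> \<bar>z\<bar>" using t' by (auto split: if_splits)
  have "F (w + z) = F w + F' w * z + F'' t * z\<^sup>2 / 2"
    unfolding eq by (simp add: numeral_2_eq_2 diff_def)
  then have "F (w + z) - F w - F' w * z - F'' w * z\<^sup>2 / 2 = (F'' t - F'' w) * z\<^sup>2 / 2"
    by (simp add: field_simps)
  also have "\<bar>\<dots>\<bar> = \<bar>F'' t - F'' w\<bar> * z\<^sup>2 / 2" by (simp add: abs_mult)
  also have "\<dots> \<le> B * z\<^sup>2 / 2" by (intro divide_right_mono mult_right_mono B t) auto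
  finally show ?thesis .
qed simp

lemma
  assumes h: "0 \<le> h"
  shows integrable_centered_normal_moment: "integrable (centered_normal h) (\<lambda>z. z ^ k)"
    and centered_normal_mean: "(LINT z|centered_normal h. z) = 0"
    and centered_normal_second_moment: "(LINT z|centered_normal h. z\<^sup>2) = h"
    and centered_normal_fourth_moment: "(LINT z|centered_normal h. z ^ 4) = 3 * h\<^sup>2"
proof -
  have *: "(sqrt h * z) ^ k = sqrt h ^ k * z ^ k" for z k by (simp add: power_mult_distrib)
  show "integrable (centered_normal h) (\<lambda>z. z ^ k)"
    unfolding centered_normal_def
    by (subst integrable_distr_eq) (auto simp: * intro!: integrable_mult_right integrable_std_normal_distribution_moment)
  show "(LINT z|centered_normal h. z) = 0"
    using integral_std_normal_distribution_moment_odd[of 1] by (simp add: integral_centered_normal)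
  show "(LINT z|centered_normal h. z\<^sup>2) = h"
    using std_normal_distribution_even_moments(1)[of 1] h by (simp add: integral_centered_normal * fact_numeral)
  have "sqrt h ^ 4 = h\<^sup>2"
  proof -
    have "sqrt h ^ 4 = (sqrt h ^ 2) ^ 2" by (simp only: power_mult[symmetric]) simp
    then show ?thesis using h by simp
  qed
  then show "(LINT z|centered_normal h. z ^ 4) = 3 * h\<^sup>2"
    using std_normal_distribution_even_moments(1)[of 2] by (simp add: integral_centered_normal * fact_numeral)
qed

lemma borel_measurable_centered_normal_shift:
  fixes F :: "real \<Rightarrow> real"
  assumes "F \<in> borel_measurable borel" shows "(\<lambda>z. F (w + z)) \<in> borel_measurable (centered_normal h)"
proof -
  have "(\<lambda>z. z) \<in> borel_measurable (centered_normal h)" by (rule measurable_ident_sets) simp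
  then have "(\<lambda>z. w + z) \<in> borel_measurable (centered_normal h)" by (intro borel_measurable_add borel_measurable_const)
  from measurable_compose[OF this assms] show ?thesis .
qed

text \<open>Mean 0 removes the linear term, and variance h gives the generator. The remainder is
  governed by \<epsilon> for small displacements; for large ones the factor z^2/\<delta>^2 \<ge> 1
  trades the crude bound 2C for a fourth moment of order h^2. The estimate is uniform in
  \<open>w\<close>.\<close>

lemma centered_normal_Taylor:
  fixes F F' F'' :: "real \<Rightarrow> real"
  assumes d1: "\<And>v. (F has_real_derivative F' v) (at v)" and d2: "\<And>v. (F' has_real_derivative F'' v) (at v)"
    and C: "\<And>v. \<bar>F v\<bar> \<le> C" "\<And>v. \<bar>F'' v\<bar> \<le> C"
    and \<delta>: "0 < \<delta>" "\<And>v w. \<bar>v - w\<bar> < \<delta> \<Longrightarrow> \<bar>F'' v - F'' w\<bar> \<le> \<epsilon>" and h: "0 \<le> h"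
  shows "\<bar>(LINT z|centered_normal h. F (w + z)) - F w - h * F'' w / 2\<bar> \<le> h * (\<epsilon> / 2 + 3 * C / \<delta>\<^sup>2 * h)"
proof -
  interpret prob_space "centered_normal h" by (rule prob_space_centered_normal)
  have C0: "0 \<le> C" using C(1)[of 0] by linarith
  have \<epsilon>0: "0 \<le> \<epsilon>" using \<delta>(2)[of 0 0] \<delta>(1) by simp
  have Fm[measurable]: "F \<in> borel_measurable borel"
    using d1 by (intro borel_measurable_continuous_onI DERIV_continuous_on) (auto intro: has_field_derivative_at_within)
  have pointwise: "\<bar>F (w + z) - F w - F' w * z - F'' w * z\<^sup>2 / 2\<bar> \<le> \<epsilon> / 2 * z\<^sup>2 + C / \<delta>\<^sup>2 * z ^ 4" for z
  proof -
    have "\<bar>F (w + z) - F w - F' w * z - F'' w * z\<^sup>2 / 2\<bar> \<le> (\<epsilon> + 2 * C / \<delta>\<^sup>2 * z\<^sup>2) * z\<^sup>2 / 2"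
    proof (rule second_order_Taylor_bound[OF d1 d2])
      fix \<xi> assume \<xi>: "\<bar>\<xi> - w\<bar> \<le> \<bar>z\<bar>"
      show "\<bar>F'' \<xi> - F'' w\<bar> \<le> \<epsilon> + 2 * C / \<delta>\<^sup>2 * z\<^sup>2"
      proof (cases "\<bar>\<xi> - w\<bar> < \<delta>")
        case True
        have "0 \<le> 2 * C / \<delta>\<^sup>2 * z\<^sup>2" using C0 by simp
        with \<delta>(2)[OF True] show ?thesis by linarith
      next
        case False
        with \<xi> have "\<delta> \<le> \<bar>z\<bar>" by linarith
        then have "\<delta>\<^sup>2 \<le> z\<^sup>2" using \<delta>(1) by (subst abs_le_square_iff[symmetric]) simp
        then have "1 \<le> z\<^sup>2 / \<delta>\<^sup>2" using \<delta>(1) by simp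
        then have "2 * C * 1 \<le> 2 * C * (z\<^sup>2 / \<delta>\<^sup>2)" using C0 by (intro mult_left_mono) auto
        then show ?thesis using C(2)[of \<xi>] C(2)[of w] \<epsilon>0 by simp
      qed
    qed
    also have "\<dots> = \<epsilon> / 2 * z\<^sup>2 + C / \<delta>\<^sup>2 * z ^ 4" by (simp add: algebra_simps power2_eq_square power4_eq_xxxx add_divide_distrib)
    finally show ?thesis .
  qed
  have mom: "integrable (centered_normal h) (\<lambda>z. z)" "integrable (centered_normal h) (\<lambda>z. z\<^sup>2)" "integrable (centered_normal h) (\<lambda>z. z ^ 4)"
    using integrable_centered_normal_moment[OF h, of 1] integrable_centered_normal_moment[OF h] by simp_all
  have iF: "integrable (centered_normal h) (\<lambda>z. F (w + z))"
  proof (rule integrable_const_bound[where B = C])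
    show "(\<lambda>z. F (w + z)) \<in> borel_measurable (centered_normal h)" by (rule borel_measurable_centered_normal_shift[OF Fm])
  qed (use C in auto)
  have iR: "integrable (centered_normal h) (\<lambda>z. F (w + z) - F w - F' w * z - F'' w * z\<^sup>2 / 2)"
    using iF mom by (intro Bochner_Integration.integrable_diff integrable_mult_right integrable_divide integrable_const)
  have "(LINT z|centered_normal h. F (w + z) - F w - F' w * z - F'' w * z\<^sup>2 / 2) =
      (LINT z|centered_normal h. F (w + z)) - F w - F' w * (LINT z|centered_normal h. z) - F'' w * (LINT z|centered_normal h. z\<^sup>2) / 2"
    using iF mom prob_space by simp
  then have eq: "(LINT z|centered_normal h. F (w + z)) - F w - h * F'' w / 2 =
      (LINT z|centered_normal h. F (w + z) - F w - F' w * z - F'' w * z\<^sup>2 / 2)"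
    using centered_normal_mean[OF h] centered_normal_second_moment[OF h] by simp
  have "\<bar>(LINT z|centered_normal h. F (w + z)) - F w - h * F'' w / 2\<bar> \<le>
      (LINT z|centered_normal h. \<bar>F (w + z) - F w - F' w * z - F'' w * z\<^sup>2 / 2\<bar>)"
    unfolding eq by (rule integral_abs_bound)
  also have "\<dots> \<le> (LINT z|centered_normal h. \<epsilon> / 2 * z\<^sup>2 + C / \<delta>\<^sup>2 * z ^ 4)"
  proof (rule integral_mono)
    show "integrable (centered_normal h) (\<lambda>z. \<bar>F (w + z) - F w - F' w * z - F'' w * z\<^sup>2 / 2\<bar>)" by (rule integrable_abs[OF iR])
    show "integrable (centered_normal h) (\<lambda>z. \<epsilon> / 2 * z\<^sup>2 + C / \<delta>\<^sup>2 * z ^ 4)"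
      by (intro Bochner_Integration.integrable_add integrable_mult_right mom)
  qed (rule pointwise)
  also have "\<dots> = \<epsilon> / 2 * h + C / \<delta>\<^sup>2 * (3 * h\<^sup>2)"
    using mom centered_normal_second_moment[OF h] centered_normal_fourth_moment[OF h] by simp
  also have "\<dots> = h * (\<epsilon> / 2 + 3 * C / \<delta>\<^sup>2 * h)" by (simp add: algebra_simps power2_eq_square)
  finally show ?thesis .
qed

text \<open>Backward difference quotients are forward ones based at a nearby point, where \<open>\<psi>\<close> is close by
  continuity.\<close>

lemma has_real_derivative_forward:
  fixes \<phi> \<psi> :: "real \<Rightarrow> real"
  assumes forward: "\<And>\<epsilon>. 0 < \<epsilon> \<Longrightarrow> \<exists>K\<ge>0. \<forall>u\<ge>0. \<forall>h\<ge>0. \<bar>\<phi> (u + h) - \<phi> u - h * \<psi> u\<bar> \<le> h * (\<epsilon> + K * h)"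
    and cont: "continuous_on {0..} \<psi>" and u: "0 \<le> u"
  shows "(\<phi> has_real_derivative \<psi> u) (at u within {0..})"
  unfolding has_field_derivative_def has_derivative_within_alt
proof (intro conjI allI impI)
  show "bounded_linear ((*) (\<psi> u))" by (rule bounded_linear_mult_right)
  fix e :: real assume e: "0 < e"
  obtain K where K: "0 \<le> K" "\<And>u h. 0 \<le> u \<Longrightarrow> 0 \<le> h \<Longrightarrow> \<bar>\<phi> (u + h) - \<phi> u - h * \<psi> u\<bar> \<le> h * (e / 3 + K * h)"
    using forward[of "e / 3"] e by auto
  obtain d0 where d0: "0 < d0" "\<And>v. 0 \<le> v \<Longrightarrow> \<bar>v - u\<bar> < d0 \<Longrightarrow> \<bar>\<psi> v - \<psi> u\<bar> < e / 3"
    using cont u e unfolding continuous_on_iff dist_real_def by (metis atLeast_iff divide_pos_pos zero_less_numeral)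
  \<comment> \<open>\<open>K + 1\<close> avoids a division by 0; steps shorter than \<open>d\<close>
    keep K h at most e/3.\<close>
  define d where "d = min d0 (e / (3 * (K + 1)))"
  have d: "0 < d" using d0 e K by (simp add: d_def)
  have small: "K * h \<le> e / 3" if "0 \<le> h" "h < d" for h
  proof -
    have "K * h \<le> (K + 1) * (e / (3 * (K + 1)))" using that K by (intro mult_mono) (auto simp: d_def)
    also have "k * (e / (3 * k)) = e / 3" if "k \<noteq> 0" for k using that by simp
    from this[of "K + 1"] have "(K + 1) * (e / (3 * (K + 1))) = e / 3" using K(1) by linarith
    finally show ?thesis .
  qed
  have "norm (\<phi> v - \<phi> u - \<psi> u * (v - u)) \<le> e * norm (v - u)" if v: "0 \<le> v" "norm (v - u) < d" for v
  proof (cases "u \<le> v")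
    case True
    define h where "h = v - u"
    have h: "0 \<le> h" "h < d" using True v by (auto simp: h_def)
    have "\<bar>\<phi> (u + h) - \<phi> u - h * \<psi> u\<bar> \<le> h * (e / 3 + K * h)" by (rule K(2)[OF u h(1)])
    also have "\<dots> \<le> h * e" using h small[OF h] e by (intro mult_left_mono) auto
    finally show ?thesis using h by (simp add: h_def mult.commute)
  next
    case False
    \<comment> \<open>The forward estimate based at \<open>v\<close> costs 2e/3, and replacing
      \<open>\<psi> v\<close> by \<open>\<psi> u\<close> the remaining e/3.\<close>
    define h where "h = u - v"
    have h: "0 \<le> h" "h < d" using False v by (auto simp: h_def)
    have "\<bar>\<phi> (v + h) - \<phi> v - h * \<psi> v\<bar> \<le> h * (e / 3 + K * h)" by (rule K(2)[OF v(1) h(1)])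
    also have "\<dots> \<le> h * (2 * e / 3)" using h small[OF h] e by (intro mult_left_mono) auto
    finally have 1: "\<bar>\<phi> u - \<phi> v - h * \<psi> v\<bar> \<le> h * (2 * e / 3)" by (simp add: h_def)
    have "\<bar>\<psi> v - \<psi> u\<bar> \<le> e / 3" using d0(2)[of v] v by (auto simp: d_def)
    then have "h * \<bar>\<psi> v - \<psi> u\<bar> \<le> h * (e / 3)" using h(1) by (rule mult_left_mono)
    then have 2: "\<bar>h * (\<psi> v - \<psi> u)\<bar> \<le> h * (e / 3)" using h by (simp add: abs_mult)
    have "\<phi> v - \<phi> u - \<psi> u * (v - u) = - (\<phi> u - \<phi> v - h * \<psi> v) - h * (\<psi> v - \<psi> u)" by (simp add: h_def algebra_simps)
    then have "\<bar>\<phi> v - \<phi> u - \<psi> u * (v - u)\<bar> \<le> h * (2 * e / 3) + h * (e / 3)" using 1 2 by linarith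
    also have "\<dots> = e * h" by (simp add: algebra_simps)
    finally show ?thesis using h by (simp add: h_def)
  qed
  with d show "\<exists>d>0. \<forall>y\<in>{0..}. norm (y - u) < d \<longrightarrow> norm (\<phi> y - \<phi> u - \<psi> u * (y - u)) \<le> e * norm (y - u)" by auto
qed

section \<open>The heat equation\<close>

context brownian_motion
begin

lemma expectation_shift:
  fixes g :: "real \<Rightarrow> real"
  assumes s: "0 \<le> s" and t: "0 \<le> t"
    and g[measurable]: "g \<in> borel_measurable borel" and C: "\<And>y. \<bar>g y\<bar> \<le> C"
  shows "expectation (\<lambda>\<omega>. g (y + W (s + t) \<omega>)) = expectation (\<lambda>\<omega>. LINT z|centered_normal t. g (y + W s \<omega> + z))"
proof -
  have top: "space M \<in> sets (past s)" using sets.top[of "past s"] by simp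
  have space: "(LINT \<omega>:space M|M. f \<omega>) = expectation f" for f :: "'a \<Rightarrow> real"
    unfolding set_lebesgue_integral_def by (intro Bochner_Integration.integral_cong) auto
  show ?thesis using past_integral[OF s t top g C, of y] by (simp add: space)
qed

lemma expectation_coordinate:
  fixes g :: "real \<Rightarrow> real"
  assumes t: "0 \<le> t" and g: "g \<in> borel_measurable borel" and C: "\<And>y. \<bar>g y\<bar> \<le> C"
  shows "expectation (\<lambda>\<omega>. g (y + W t \<omega>)) = (LINT z|centered_normal t. g (y + z))"
proof -
  have "expectation (\<lambda>\<omega>. LINT z|centered_normal t. g (y + W 0 \<omega> + z)) = expectation (\<lambda>\<omega>. LINT z|centered_normal t. g (y + z))"
    by (intro Bochner_Integration.integral_cong) (auto simp: W_0)
  then show ?thesis using expectation_shift[OF order.refl t g C, of y] by (simp add: prob_space)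
qed

text \<open>The mean of F(y + W u) has as derivative in u half the mean of F''(y + W u): given the
  position at u, a short step is controlled by \<open>centered_normal_Taylor\<close>, uniformly in
  that position. The fundamental theorem of calculus integrates this.\<close>

lemma heat_equation:
  fixes F F' F'' :: "real \<Rightarrow> real"
  assumes d1: "\<And>v. (F has_real_derivative F' v) (at v)" and d2: "\<And>v. (F' has_real_derivative F'' v) (at v)"
    and C: "\<And>v. \<bar>F v\<bar> \<le> C" "\<And>v. \<bar>F'' v\<bar> \<le> C" and unif: "uniformly_continuous_on UNIV F''" and t: "0 \<le> t"
  shows "(LINT z|centered_normal t. F (y + z)) - F y = (LBINT u:{0..t}. (LINT z|centered_normal u. F'' (y + z)) / 2)"
proof -
  have C0: "0 \<le> C" using C(1)[of 0] by linarith
  have cF: "continuous_on UNIV F" "continuous_on UNIV F''"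
    by (rule DERIV_continuous_on[OF has_field_derivative_at_within[OF d1]]) (rule uniformly_continuous_imp_continuous[OF unif])
  then have Fm[measurable]: "F \<in> borel_measurable borel" "F'' \<in> borel_measurable borel"
    by (auto intro: borel_measurable_continuous_onI)
  have Wm: "W u \<in> borel_measurable M" if "0 \<le> u" for u using that by (rule measurable_W)
  define \<phi> where "\<phi> u = expectation (\<lambda>\<omega>. F (y + W u \<omega>))" for u
  define \<psi> where "\<psi> u = expectation (\<lambda>\<omega>. F'' (y + W u \<omega>)) / 2" for u
  have int: "integrable M (\<lambda>\<omega>. g (y + W u \<omega>))" if "0 \<le> u" "g \<in> borel_measurable borel" "\<And>v. \<bar>g v\<bar> \<le> C" for g u
    by (rule integrable_const_bound[where B = C])
       (use that(3) in auto, rule measurable_compose[OF borel_measurable_add[OF borel_measurable_const Wm[OF that(1)]] that(2)])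
  \<comment> \<open>Continuity of the candidate derivative, from continuous paths and bounded
    convergence, is what allows forward estimates to yield a two-sided derivative.\<close>
  have cont: "continuous_on {0..} \<psi>"
  proof (rule continuous_on_sequentiallyI)
    fix v :: "nat \<Rightarrow> real" and u assume v: "\<forall>n. v n \<in> {0..}" "u \<in> {0..}" "v \<longlonglongrightarrow> u"
    have "(\<lambda>n. expectation (\<lambda>\<omega>. F'' (y + W (v n) \<omega>))) \<longlonglongrightarrow> expectation (\<lambda>\<omega>. F'' (y + W u \<omega>))"
    proof (rule integral_dominated_convergence[where w = "\<lambda>_. C"])
      show "AE \<omega> in M. (\<lambda>n. F'' (y + W (v n) \<omega>)) \<longlonglongrightarrow> F'' (y + W u \<omega>)"
      proof (rule AE_I2)
        fix \<omega> assume \<omega>: "\<omega> \<in> space M"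
        have "(\<lambda>n. W (v n) \<omega>) \<longlonglongrightarrow> W u \<omega>"
          by (rule continuous_on_tendsto_compose[OF continuous_W[OF \<omega>] v(3)]) (use v in auto)
        then have "(\<lambda>n. y + W (v n) \<omega>) \<longlonglongrightarrow> y + W u \<omega>" by (intro tendsto_intros)
        then show "(\<lambda>n. F'' (y + W (v n) \<omega>)) \<longlonglongrightarrow> F'' (y + W u \<omega>)"
          by (rule continuous_on_tendsto_compose[OF cF(2)]) auto
      qed
      show "(\<lambda>\<omega>. F'' (y + W u \<omega>)) \<in> borel_measurable M" "(\<lambda>\<omega>. F'' (y + W (v n) \<omega>)) \<in> borel_measurable M" for n
        using int[OF _ Fm(2) C(2), of u] int[OF _ Fm(2) C(2), of "v n"] v by auto
    qed (use C in auto)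
    then show "(\<lambda>n. \<psi> (v n)) \<longlonglongrightarrow> \<psi> u" unfolding \<psi>_def by (intro tendsto_intros) auto
  qed
  have forward: "\<exists>K\<ge>0. \<forall>u\<ge>0. \<forall>h\<ge>0. \<bar>\<phi> (u + h) - \<phi> u - h * \<psi> u\<bar> \<le> h * (\<epsilon> + K * h)" if \<epsilon>: "0 < \<epsilon>" for \<epsilon>
  proof -
    obtain \<delta> where \<delta>: "0 < \<delta>" "\<And>v w. \<bar>v - w\<bar> < \<delta> \<Longrightarrow> \<bar>F'' v - F'' w\<bar> < 2 * \<epsilon>"
      using unif \<epsilon> unfolding uniformly_continuous_on_def dist_real_def
      by (metis UNIV_I mult_pos_pos zero_less_numeral)
    define K where "K = 3 * C / \<delta>\<^sup>2"
    have "\<bar>\<phi> (u + h) - \<phi> u - h * \<psi> u\<bar> \<le> h * (\<epsilon> + K * h)" if uh: "0 \<le> u" "0 \<le> h" for u h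
    proof -
      \<comment> \<open>The conditional mean of \<open>F\<close> after a further time
        \<open>h\<close>, as a function of the present position.\<close>
      define Q where "Q w = (LINT z|centered_normal h. F (w + z))" for w
      interpret N: prob_space "centered_normal h" by (rule prob_space_centered_normal)
      have Qm: "Q \<in> borel_measurable borel"
      proof -
        have "(\<lambda>p. F (fst p + snd p)) \<in> borel_measurable (borel \<Otimes>\<^sub>M borel)" by measurable
        also have "borel_measurable (borel \<Otimes>\<^sub>M borel) = borel_measurable (borel \<Otimes>\<^sub>M centered_normal h)"
          by (intro measurable_cong_sets sets_pair_measure_cong) auto
        finally show ?thesis unfolding Q_def by (intro N.borel_measurable_lebesgue_integral) (simp add: case_prod_unfold)
      qed
      have QC: "\<bar>Q w\<bar> \<le> C" for w
      proof -
        have i: "integrable (centered_normal h) (\<lambda>z. F (w + z))"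
          by (rule N.integrable_const_bound[where B = C]) (use C borel_measurable_centered_normal_shift[OF Fm(1)] in auto)
        have "Q w \<le> C" "- C \<le> Q w" unfolding Q_def using C i
          by (auto intro!: N.integral_le_const N.integral_ge_const AE_I2 simp: abs_le_iff minus_le_iff)
        then show ?thesis by simp
      qed
      have bound: "\<bar>Q w - F w - h * F'' w / 2\<bar> \<le> h * (\<epsilon> + K * h)" for w
        using centered_normal_Taylor[OF d1 d2 C \<delta>(1), of "2 * \<epsilon>" h w] \<delta>(2) uh by (auto simp: Q_def K_def less_imp_le)
      have i3: "integrable M (\<lambda>\<omega>. Q (y + W u \<omega>) - F (y + W u \<omega>) - h * F'' (y + W u \<omega>) / 2)"
        using int[OF uh(1) Qm QC] int[OF uh(1) Fm(1) C(1)] int[OF uh(1) Fm(2) C(2)]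
        by (intro Bochner_Integration.integrable_diff integrable_mult_right integrable_divide)
      have "\<phi> (u + h) = expectation (\<lambda>\<omega>. Q (y + W u \<omega>))"
        unfolding \<phi>_def Q_def by (rule expectation_shift[OF uh Fm(1) C(1)])
      then have eq: "\<phi> (u + h) - \<phi> u - h * \<psi> u = expectation (\<lambda>\<omega>. Q (y + W u \<omega>) - F (y + W u \<omega>) - h * F'' (y + W u \<omega>) / 2)"
        unfolding \<phi>_def \<psi>_def using int[OF uh(1) Qm QC] int[OF uh(1) Fm(1) C(1)] int[OF uh(1) Fm(2) C(2)] by simp
      have "\<bar>\<phi> (u + h) - \<phi> u - h * \<psi> u\<bar> \<le>
          expectation (\<lambda>\<omega>. \<bar>Q (y + W u \<omega>) - F (y + W u \<omega>) - h * F'' (y + W u \<omega>) / 2\<bar>)"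
        unfolding eq by (rule integral_abs_bound)
      also have "\<dots> \<le> h * (\<epsilon> + K * h)"
        by (rule integral_le_const[OF integrable_abs[OF i3]], rule AE_I2) (rule bound)
      finally show ?thesis .
    qed
    moreover have "0 \<le> K" using C0 by (simp add: K_def)
    ultimately show ?thesis by blast
  qed
  have "(\<phi> has_vector_derivative \<psi> u) (at u within {0..t})" if "u \<in> {0..t}" for u
    using has_real_derivative_forward[OF forward cont, of u] that
    by (auto intro: has_vector_derivative_within_subset[of _ _ _ "{0..}"] simp: has_real_derivative_iff_has_vector_derivative)
  then have "(\<psi> has_integral \<phi> t - \<phi> 0) {0..t}" using t by (rule fundamental_theorem_of_calculus[rotated])
  moreover have "(LBINT u:{0..t}. \<psi> u) = integral {0..t} \<psi>"
    by (rule set_borel_integral_eq_integral(2)[OF borel_integrable_atLeastAtMost'])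
       (rule continuous_on_subset[OF cont], auto)
  ultimately have "(LBINT u:{0..t}. \<psi> u) = \<phi> t - \<phi> 0" by (simp add: integral_unique)
  moreover have "\<phi> t = (LINT z|centered_normal t. F (y + z))" unfolding \<phi>_def by (rule expectation_coordinate[OF t Fm(1) C(1)])
  moreover have "\<phi> 0 = F y"
  proof -
    have "\<phi> 0 = expectation (\<lambda>\<omega>. F y)" unfolding \<phi>_def by (intro Bochner_Integration.integral_cong) (auto simp: W_0)
    then show ?thesis by (simp add: prob_space)
  qed
  moreover have "(LBINT u:{0..t}. \<psi> u) = (LBINT u:{0..t}. (LINT z|centered_normal u. F'' (y + z)) / 2)"
    by (rule set_lebesgue_integral_cong) (auto simp: \<psi>_def expectation_coordinate[OF _ Fm(2) C(2)])
  ultimately show ?thesis by simp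
qed

end

section \<open>Interchange of integrals, and functions of compact support\<close>

lemma (in prob_space) set_integral_swap_interval:
  fixes H :: "real \<Rightarrow> 'a \<Rightarrow> real"
  assumes Hm: "case_prod H \<in> borel_measurable (borel \<Otimes>\<^sub>M M)" and C: "\<And>u \<omega>. u \<in> {0..a} \<Longrightarrow> \<omega> \<in> space M \<Longrightarrow> \<bar>H u \<omega>\<bar> \<le> C"
    and A[measurable]: "A \<in> events"
  shows "(LINT \<omega>:A|M. (LBINT u:{0..a}. H u \<omega>)) = (LBINT u:{0..a}. (LINT \<omega>:A|M. H u \<omega>))"
    and "(\<lambda>\<omega>. LBINT u:{0..a}. H u \<omega>) \<in> borel_measurable M"
proof -
  interpret pair_sigma_finite lborel M ..
  have C0: "0 \<le> C" if "a \<ge> 0"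
  proof -
    obtain \<omega> where "\<omega> \<in> space M" using not_empty by auto
    then show ?thesis using C[of 0 \<omega>] that by simp
  qed
  have eq: "borel_measurable (borel \<Otimes>\<^sub>M M) = borel_measurable (lborel \<Otimes>\<^sub>M M)"
    by (intro measurable_cong_sets sets_pair_measure_cong) auto
  have eq2: "borel_measurable (borel \<Otimes>\<^sub>M M) = borel_measurable (lborel \<Otimes>\<^sub>M M)" by (rule eq)
  have ind1: "(\<lambda>p. indicator {0..a} (fst p) :: real) \<in> borel_measurable (borel \<Otimes>\<^sub>M M)"
    by (rule measurable_compose[OF measurable_fst borel_measurable_indicator]) simp
  have ind2: "(\<lambda>p. indicator A (snd p) :: real) \<in> borel_measurable (borel \<Otimes>\<^sub>M M)"
    by (rule measurable_compose[OF measurable_snd borel_measurable_indicator[OF A]])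
  define K where "K u \<omega> = indicator {0..a} u * (indicator A \<omega> * H u \<omega>)" for u \<omega>
  have Km: "case_prod K \<in> borel_measurable (lborel \<Otimes>\<^sub>M M)"
    using borel_measurable_times[OF ind1 borel_measurable_times[OF ind2 Hm]] unfolding eq[symmetric] K_def by (simp add: case_prod_unfold)
  have "(\<lambda>p. indicator {0..a} (fst p) * case_prod H p) \<in> borel_measurable (borel \<Otimes>\<^sub>M M)"
    by (rule borel_measurable_times[OF ind1 Hm])
  from measurable_compose[OF measurable_pair_swap' this]
  have "(\<lambda>p. indicator {0..a} (snd p) * H (snd p) (fst p)) \<in> borel_measurable (M \<Otimes>\<^sub>M borel)"
    by (simp add: case_prod_unfold)
  also have "borel_measurable (M \<Otimes>\<^sub>M borel) = borel_measurable (M \<Otimes>\<^sub>M lborel)"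
    by (intro measurable_cong_sets sets_pair_measure_cong) auto
  finally show "(\<lambda>\<omega>. LBINT u:{0..a}. H u \<omega>) \<in> borel_measurable M"
    unfolding set_lebesgue_integral_def by (intro lborel.borel_measurable_lebesgue_integral) (simp add: case_prod_unfold)
  have Kint: "integrable (lborel \<Otimes>\<^sub>M M) (case_prod K)"
  proof (rule integrableI_bounded_set[where A = "{0..a} \<times> space M" and B = C])
    show "{0..a} \<times> space M \<in> sets (lborel \<Otimes>\<^sub>M M)" by (intro pair_measureI) auto
    have "emeasure (lborel \<Otimes>\<^sub>M M) ({0..a} \<times> space M) = emeasure lborel {0..a} * emeasure M (space M)"
      by (rule sigma_finite_measure.emeasure_pair_measure_Times[OF prob_space_imp_sigma_finite[OF prob_space_axioms]]) auto
    then show "emeasure (lborel \<Otimes>\<^sub>M M) ({0..a} \<times> space M) < \<infinity>"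
      using emeasure_lborel_Icc_eq[of 0 a] by (simp add: emeasure_space_1)
    show "AE p\<in>{0..a} \<times> space M in lborel \<Otimes>\<^sub>M M. norm (case_prod K p) \<le> C"
      using C C0 by (auto simp: K_def indicator_def intro!: AE_I2)
    show "AE p in lborel \<Otimes>\<^sub>M M. p \<notin> {0..a} \<times> space M \<longrightarrow> case_prod K p = 0"
      by (auto simp: K_def indicator_def space_pair_measure intro!: AE_I2)
  qed (rule Km)
  have "(LINT \<omega>:A|M. (LBINT u:{0..a}. H u \<omega>)) = (LINT \<omega>|M. LINT u|lborel. K u \<omega>)"
  proof -
    have "K u \<omega> = indicator A \<omega> * (indicator {0..a} u * H u \<omega>)" for u \<omega> by (simp add: K_def mult.left_commute)
    then show ?thesis unfolding set_lebesgue_integral_def by simp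
  qed
  also have "\<dots> = (LINT u|lborel. LINT \<omega>|M. K u \<omega>)" by (rule Fubini_integral[OF Kint])
  also have "\<dots> = (LBINT u:{0..a}. (LINT \<omega>:A|M. H u \<omega>))"
    unfolding set_lebesgue_integral_def K_def by simp
  finally show "(LINT \<omega>:A|M. (LBINT u:{0..a}. H u \<omega>)) = (LBINT u:{0..a}. (LINT \<omega>:A|M. H u \<omega>))" .
qed

lemma set_integral_split_shift:
  fixes f :: "real \<Rightarrow> real"
  assumes s: "0 \<le> s" "s \<le> t" and f: "set_integrable lborel {0..t} f"
  shows "(LBINT u:{0..t}. f u) - (LBINT u:{0..s}. f u) = (LBINT u:{0..t - s}. f (s + u))"
proof -
  have "(LBINT u:{0..t}. f u) = (LBINT u:{0..s}. f u) + (LBINT u:{s<..t}. f u)"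
  proof -
    have "{0..t} = {0..s} \<union> {s<..t}" using s by auto
    moreover have "set_integrable lborel {0..s} f" "set_integrable lborel {s<..t} f"
      by (rule set_integrable_subset[OF f]; use s in auto)+
    ultimately show ?thesis by (subst \<open>{0..t} = {0..s} \<union> {s<..t}\<close>) (rule set_integral_Un, auto)
  qed
  moreover have "(LBINT u:{s<..t}. f u) = (LINT u|lborel. indicator {s<..t} (s + u) * f (s + u))"
    using lborel_integral_real_affine[of 1 "\<lambda>u. indicator {s<..t} u * f u" s] by (simp add: set_lebesgue_integral_def)
  moreover have "(LINT u|lborel. indicator {s<..t} (s + u) * f (s + u)) = (LBINT u:{0..t - s}. f (s + u))"
    unfolding set_lebesgue_integral_def
    by (rule integral_discrete_difference[where X = "{0}"]) (auto simp: indicator_def)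
  ultimately show ?thesis by simp
qed

text \<open>The definition bounds only the support of \<open>f\<close>; beyond that bound
  \<open>f\<close> is locally constant, so both derivatives vanish there as well.\<close>

lemma neumann_test_function_support:
  assumes "neumann_test_function {0..} f f' f''"
  obtains K where "0 < K" "\<And>y. K < y \<Longrightarrow> f y = 0 \<and> f' y = 0 \<and> f'' y = 0"
proof -
  have d1: "\<And>y. 0 \<le> y \<Longrightarrow> (f has_real_derivative f' y) (at y within {0..})"
    and d2: "\<And>y. 0 \<le> y \<Longrightarrow> (f' has_real_derivative f'' y) (at y within {0..})"
    and b: "bounded {y\<in>{0..}. f y \<noteq> 0}"
    using assms by (auto simp: neumann_test_function_def)
  obtain K where K: "0 < K" "\<And>y. y \<in> {y\<in>{0..}. f y \<noteq> 0} \<Longrightarrow> norm y \<le> K" using b unfolding bounded_pos by blast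
  have zero_deriv: "d = 0" if y: "K < y" and g: "(g has_real_derivative d) (at y within {0..})" and z: "\<And>v. K < v \<Longrightarrow> g v = 0" for g d y
  proof -
    have "(g has_real_derivative d) (at y)" using g y K(1) by (simp add: at_within_interior[of y "{0..}"])
    moreover have "(g has_real_derivative 0) (at y)"
      by (rule has_field_derivative_transform_within_open[of "\<lambda>_. 0" _ _ "{K<..}"]) (use y z in auto)
    ultimately show ?thesis by (rule DERIV_unique)
  qed
  have f0: "f y = 0" if "K < y" for y using K(2)[of y] that K(1) by force
  have f1: "f' y = 0" if "K < y" for y using zero_deriv[OF that d1 f0] that K(1) by simp
  have f2: "f'' y = 0" if "K < y" for y using zero_deriv[OF that d2 f1] that K(1) by simp
  show ?thesis using that[OF K(1)] f0 f1 f2 by blast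
qed

lemma compact_support_uniformly_continuous:
  fixes g :: "real \<Rightarrow> real"
  assumes cont: "continuous_on UNIV g" and z: "\<And>y. K < \<bar>y\<bar> \<Longrightarrow> g y = 0"
  shows "uniformly_continuous_on UNIV g"
  unfolding uniformly_continuous_on_def
proof (intro allI impI)
  fix e :: real assume e: "0 < e"
  have "uniformly_continuous_on {- K - 1..K + 1} g"
    by (rule compact_uniformly_continuous[OF continuous_on_subset[OF cont]]) auto
  then obtain d where d: "0 < d" "\<And>x y. x \<in> {- K - 1..K + 1} \<Longrightarrow> y \<in> {- K - 1..K + 1} \<Longrightarrow> dist y x < d \<Longrightarrow> dist (g y) (g x) < e"
    using e unfolding uniformly_continuous_on_def by metis
  \<comment> \<open>Distances below 1 keep both points in [-K-1,K+1] as soon as one of them lies in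
    [-K,K].\<close>
  have "dist (g y) (g x) < e" if "dist y x < min d 1" for x y
  proof (cases "K < \<bar>x\<bar> \<and> K < \<bar>y\<bar>")
    case True then show ?thesis using z e by simp
  next
    case False
    then have "x \<in> {- K - 1..K + 1}" "y \<in> {- K - 1..K + 1}" using that by (auto simp: dist_real_def)
    then show ?thesis using d(2)[of x y] that by simp
  qed
  then show "\<exists>d>0. \<forall>x\<in>UNIV. \<forall>x'\<in>UNIV. dist x' x < d \<longrightarrow> dist (g x') (g x) < e"
    using d(1) by (intro exI[of _ "min d 1"]) auto
qed

lemma compact_support_bounded:
  fixes g :: "real \<Rightarrow> real"
  assumes cont: "continuous_on UNIV g" and z: "\<And>y. K < \<bar>y\<bar> \<Longrightarrow> g y = 0"
  obtains C where "\<And>y. \<bar>g y\<bar> \<le> C"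
proof -
  have "compact (g ` {- K..K})" by (intro compact_continuous_image continuous_on_subset[OF cont]) auto
  then obtain B where B: "\<And>y. y \<in> {- K..K} \<Longrightarrow> \<bar>g y\<bar> \<le> B" using compact_imp_bounded by (fastforce simp: bounded_iff)
  have "\<bar>g y\<bar> \<le> max B 0" for y
    using B[of y] z[of y] by (cases "K < \<bar>y\<bar>") (auto simp: not_less abs_le_iff le_max_iff_disj)
  then show ?thesis by (rule that)
qed

section \<open>The martingale problem for the reflected process\<close>

context brownian_motion
begin

text \<open>The even extension makes f of the reflected path a twice continuously differentiable
  function of Brownian motion. Its semigroup solves the heat equation, and the Markov property turns
  that into the martingale identity.\<close>

lemma reflected_martingale:
  assumes x: "0 \<le> x" and f: "neumann_test_function {0..} f f' f''"
  shows "martingale (reflected_law x) (natural_filtration (space reflected_paths) (\<lambda>t w. w t))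
    (\<lambda>t w. f (w t) - (LBINT s:{0..t}. (1 :: real)\<^sup>2 / 2 * f'' (w s) + 0 * f' (w s)))"
proof -
  interpret P: prob_space "reflected_law x" by (rule prob_space_reflected_law)
  have space_law [simp]: "space (reflected_law x) = space reflected_paths" by (rule sets_eq_imp_space_eq) simp
  have d1: "\<And>y. 0 \<le> y \<Longrightarrow> (f has_real_derivative f' y) (at y within {0..})"
    and d2: "\<And>y. 0 \<le> y \<Longrightarrow> (f' has_real_derivative f'' y) (at y within {0..})"
    and c2: "continuous_on {0..} f''" and f'0: "f' 0 = 0"
    using f by (auto simp: neumann_test_function_def frontier_def)
  obtain K where K: "0 < K" "\<And>y. K < y \<Longrightarrow> f y = 0 \<and> f' y = 0 \<and> f'' y = 0"
    using neumann_test_function_support[OF f] by blast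
  define G where "G v = f \<bar>v\<bar>" for v
  define G1 where "G1 v = sgn v * f' \<bar>v\<bar>" for v
  define G2 where "G2 v = f'' \<bar>v\<bar>" for v
  have dG: "(G has_real_derivative G1 v) (at v)" for v
    unfolding G_def[abs_def] G1_def by (rule has_real_derivative_even_extension[OF d1 f'0])
  have dG1: "(G1 has_real_derivative G2 v) (at v)" for v
    unfolding G1_def[abs_def] G2_def by (rule has_real_derivative_odd_extension[OF d2 f'0])
  have cG: "continuous_on UNIV G" by (rule DERIV_continuous_on[OF has_field_derivative_at_within[OF dG]])
  have cG2: "continuous_on UNIV G2"
    unfolding G2_def[abs_def] by (rule continuous_on_compose2[OF c2]) (auto intro!: continuous_intros)
  have zero: "G y = 0" "G2 y = 0" if "K < \<bar>y\<bar>" for y using K(2)[OF that] by (simp_all add: G_def G2_def)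
  obtain C0 where C0: "\<And>y. \<bar>G y\<bar> \<le> C0" using compact_support_bounded[OF cG zero(1)] by blast
  obtain C2 where C2: "\<And>y. \<bar>G2 y\<bar> \<le> C2" using compact_support_bounded[OF cG2 zero(2)] by blast
  define C where "C = max C0 C2"
  have C: "\<bar>G y\<bar> \<le> C" "\<bar>G2 y\<bar> \<le> C" for y using C0[of y] C2[of y] by (auto simp: C_def)
  have C_nonneg: "0 \<le> C" using C(1)[of 0] by linarith
  have Gm: "G \<in> borel_measurable borel" "G2 \<in> borel_measurable borel"
    using cG cG2 by (auto intro: borel_measurable_continuous_onI)
  have unif: "uniformly_continuous_on UNIV G2" by (rule compact_support_uniformly_continuous[OF cG2]) (rule zero(2))
  have heat: "reflected_semigroup t G y - G y = (LBINT u:{0..t}. reflected_semigroup u G2 y / 2)" if "0 \<le> t" for t y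
  proof -
    have "reflected_semigroup t G y = (LINT z|centered_normal t. G (y + z))" "\<And>u. reflected_semigroup u G2 y = (LINT z|centered_normal u. G2 (y + z))"
      by (simp_all add: reflected_semigroup_def G_def G2_def)
    then show ?thesis
      using heat_equation[OF dG dG1 C unif that, of y] by simp
  qed
  have nonneg: "0 \<le> w t" if "w \<in> space reflected_paths" "0 \<le> t" for w t using that by (auto simp: space_reflected_paths)
  have cont_w: "continuous_on {0..} w" if "w \<in> space reflected_paths" for w using that by (auto simp: space_reflected_paths)
  define I where "I t w = (LBINT u:{0..t}. G2 (w u) / 2)" for t and w :: "real \<Rightarrow> real"
  define Z where "Z t w = f (w t) - (LBINT s:{0..t}. (1 :: real)\<^sup>2 / 2 * f'' (w s) + 0 * f' (w s))" for t and w :: "real \<Rightarrow> real"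
  have Z_eq: "Z t w = G (w t) - I t w" if "w \<in> space reflected_paths" "0 \<le> t" for t w
  proof -
    have "(LBINT s:{0..t}. (1 :: real)\<^sup>2 / 2 * f'' (w s) + 0 * f' (w s)) = I t w"
      unfolding I_def using nonneg[OF that(1)] by (intro set_lebesgue_integral_cong) (auto simp: G2_def)
    then show ?thesis using nonneg[OF that] by (simp add: Z_def G_def)
  qed
  \<comment> \<open>The compensator \<open>I t\<close> must be measurable for the past up to
    \<open>t\<close>, so its integrand uses the path stopped at \<open>t\<close>; on [0,t] stopping
    changes nothing.\<close>
  have stopped: "(\<lambda>(u, w). w (min (max 0 u) t)) \<in> borel_measurable (borel \<Otimes>\<^sub>M reflected_past t)" if t: "0 \<le> t" for t
  proof (rule borel_measurable_continuous_process[of "\<lambda>u w. w (min u t)"])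
    show "(\<lambda>w. w (min u t)) \<in> borel_measurable (reflected_past t)" if "0 \<le> u" for u
      using measurable_natural_filtration[of "min u t" t "\<lambda>t w. w t" "space reflected_paths"] that t by simp
    show "continuous_on {0..} (\<lambda>u. w (min u t))" if "w \<in> space (reflected_past t)" for w
      by (rule continuous_on_compose2[OF cont_w]) (use that t in \<open>auto intro!: continuous_on_min continuous_on_id continuous_on_const\<close>)
  qed
  have I_meas: "I t \<in> borel_measurable (reflected_past t)" if t: "0 \<le> t" for t
  proof -
    have "(\<lambda>p. G2 (case p of (u, w) \<Rightarrow> w (min (max 0 u) t))) \<in> borel_measurable (borel \<Otimes>\<^sub>M reflected_past t)"
      by (rule measurable_compose[OF stopped[OF t] Gm(2)])
    moreover have "(\<lambda>p. indicator {0..t} (fst p) :: real) \<in> borel_measurable (borel \<Otimes>\<^sub>M reflected_past t)"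
      by (rule measurable_compose[OF measurable_fst borel_measurable_indicator]) simp
    ultimately have "(\<lambda>p. indicator {0..t} (fst p) * (G2 (case p of (u, w) \<Rightarrow> w (min (max 0 u) t)) / 2)) \<in> borel_measurable (borel \<Otimes>\<^sub>M reflected_past t)"
      by (intro borel_measurable_times borel_measurable_divide borel_measurable_const)
    from measurable_compose[OF measurable_pair_swap' this]
    have "(\<lambda>p. indicator {0..t} (snd p) * (G2 (fst p (min (max 0 (snd p)) t)) / 2)) \<in> borel_measurable (reflected_past t \<Otimes>\<^sub>M borel)"
      by (simp add: case_prod_unfold)
    also have "borel_measurable (reflected_past t \<Otimes>\<^sub>M borel) = borel_measurable (reflected_past t \<Otimes>\<^sub>M lborel)"
      by (intro measurable_cong_sets sets_pair_measure_cong) auto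
    finally have "(\<lambda>w. LINT u|lborel. indicator {0..t} u * (G2 (w (min (max 0 u) t)) / 2)) \<in> borel_measurable (reflected_past t)"
      by (intro lborel.borel_measurable_lebesgue_integral) (simp add: case_prod_unfold)
    also have "(\<lambda>w. LINT u|lborel. indicator {0..t} u * (G2 (w (min (max 0 u) t)) / 2)) = I t"
      unfolding I_def set_lebesgue_integral_def by (intro ext Bochner_Integration.integral_cong) (auto simp: indicator_def)
    finally show ?thesis .
  qed
  have w_meas: "(\<lambda>w. w t) \<in> borel_measurable (reflected_past t)" if "0 \<le> t" for t
    using measurable_natural_filtration[of t t "\<lambda>t w. w t" "space reflected_paths"] that by simp
  have Z_meas: "Z t \<in> borel_measurable (reflected_past t)" if t: "0 \<le> t" for t
  proof -
    have "(\<lambda>w. G (w t) - I t w) \<in> borel_measurable (reflected_past t)"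
      by (intro borel_measurable_diff I_meas[OF t] measurable_compose[OF w_meas[OF t] Gm(1)])
    then show ?thesis by (rule measurable_cong[THEN iffD1, rotated]) (use Z_eq t in simp)
  qed
  have sub: "subalgebra (reflected_law x) (reflected_past s)" for s
    using reflected_past_subset by (simp add: subalgebra_def)
  have to_law: "h \<in> borel_measurable (reflected_law x)" if "h \<in> borel_measurable (reflected_past s)" for h :: "(real \<Rightarrow> real) \<Rightarrow> real" and s
    using measurable_from_subalg[OF sub that] .
  have si: "set_integrable lborel {0..t} (\<lambda>u. G2 (w u) / 2)" if "w \<in> space reflected_paths" for w t
  proof (rule borel_integrable_atLeastAtMost')
    have "continuous_on {0..t} w" by (rule continuous_on_subset[OF cont_w[OF that]]) auto
    then have "continuous_on {0..t} (\<lambda>u. G2 (w u))" by (rule continuous_on_compose2[OF cG2]) auto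
    then show "continuous_on {0..t} (\<lambda>u. G2 (w u) / 2)" by (intro continuous_intros) auto
  qed
  have I_bound: "\<bar>I t w\<bar> \<le> t * C" if "0 \<le> t" "w \<in> space reflected_paths" for t w
  proof -
    have "\<bar>I t w\<bar> \<le> (LBINT u:{0..t}. \<bar>G2 (w u) / 2\<bar>)"
      unfolding I_def using set_integral_norm_bound[OF si[OF that(2)]] by simp
    also have "\<dots> \<le> (LBINT u:{0..t}. C)"
    proof (rule set_integral_mono)
      show "set_integrable lborel {0..t} (\<lambda>u. \<bar>G2 (w u) / 2\<bar>)" using set_integrable_abs[OF si[OF that(2)]] .
      show "set_integrable lborel {0..t} (\<lambda>u. C)" by (rule borel_integrable_atLeastAtMost') (rule continuous_on_const)
      show "\<bar>G2 (w u) / 2\<bar> \<le> C" for u using C(2)[of "w u"] C_nonneg by simp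
    qed
    also have "\<dots> = t * C" using that(1) by (simp add: set_lebesgue_integral_def)
    finally show ?thesis .
  qed
  have Z_int: "integrable (reflected_law x) (Z t)" if t: "0 \<le> t" for t
  proof (rule P.integrable_const_bound[where B = "C + t * C"])
    show "AE w in reflected_law x. norm (Z t w) \<le> C + t * C"
    proof (rule AE_I2)
      fix w assume "w \<in> space (reflected_law x)"
      then have w: "w \<in> space reflected_paths" by simp
      show "norm (Z t w) \<le> C + t * C" using I_bound[OF t w] C(1)[of "w t"] Z_eq[OF w t] by (simp add: abs_le_iff)
    qed
  qed (rule to_law[OF Z_meas[OF t]])
  \<comment> \<open>The compensator accrued on [s,t] is swapped with the expectation, turned by the
    Markov property into semigroup values at \<open>w s\<close>, and summed by the heat
    equation.\<close>
  have key: "(LINT w:A|reflected_law x. Z t w) = (LINT w:A|reflected_law x. Z s w)"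
    if st: "0 \<le> s" "s \<le> t" and A: "A \<in> sets (reflected_past s)" for s t A
  proof -
    have t0: "0 \<le> t" and ts: "0 \<le> t - s" using st by auto
    have A': "A \<in> sets (reflected_law x)" using A reflected_past_subset by auto
    have ws: "(\<lambda>w. w u) \<in> borel_measurable (reflected_law x)" for u by (simp cong: measurable_cong_sets)
    have RG: "reflected_semigroup (t - s) G \<in> borel_measurable borel"
      using measurable_Pair2[OF borel_measurable_reflected_semigroup[OF Gm(1)], of "t - s"] by simp
    have int1: "set_integrable (reflected_law x) A h" if "h \<in> borel_measurable (reflected_law x)" "\<And>w. w \<in> space reflected_paths \<Longrightarrow> \<bar>h w\<bar> \<le> B" for h :: "(real \<Rightarrow> real) \<Rightarrow> real" and B
      unfolding set_integrable_def using that A'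
      by (intro integrable_mult_indicator P.integrable_const_bound[where B = B]) auto
    have iG: "set_integrable (reflected_law x) A (\<lambda>w. G (w u))" for u
      by (rule int1[of _ C]) (use C measurable_compose[OF ws Gm(1)] in auto)
    have iR: "set_integrable (reflected_law x) A (\<lambda>w. reflected_semigroup (t - s) G (w s))"
      by (rule int1[of _ C]) (use reflected_semigroup_bound[of G C] C measurable_compose[OF ws RG] in auto)
    have iI: "set_integrable (reflected_law x) A (I u)" if "0 \<le> u" for u
      by (rule int1[of _ "u * C"]) (use I_bound[OF that] to_law[OF I_meas[OF that]] in auto)
    have joint_w: "(\<lambda>(u, w). w (max 0 u)) \<in> borel_measurable (borel \<Otimes>\<^sub>M reflected_law x)"
      by (rule borel_measurable_continuous_process[of "\<lambda>u w. w u"]) (use ws cont_w in auto)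
    have H1: "(\<lambda>(u, w). G2 (w (max 0 (s + u))) / 2) \<in> borel_measurable (borel \<Otimes>\<^sub>M reflected_law x)"
    proof -
      have "(\<lambda>p. (s + fst p, snd p)) \<in> borel \<Otimes>\<^sub>M reflected_law x \<rightarrow>\<^sub>M borel \<Otimes>\<^sub>M reflected_law x" by measurable
      from measurable_compose[OF measurable_compose[OF this joint_w] Gm(2)] show ?thesis
        unfolding case_prod_unfold by (intro borel_measurable_divide borel_measurable_const) simp
    qed
    have H2: "(\<lambda>(u, w). reflected_semigroup u G2 (w s) / 2) \<in> borel_measurable (borel \<Otimes>\<^sub>M reflected_law x)"
    proof -
      have "(\<lambda>p. (fst p, snd p s)) \<in> borel \<Otimes>\<^sub>M reflected_law x \<rightarrow>\<^sub>M borel \<Otimes>\<^sub>M borel"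
        using measurable_compose[OF measurable_snd ws] by (intro measurable_Pair measurable_fst)
      from measurable_compose[OF this borel_measurable_reflected_semigroup[OF Gm(2)]] show ?thesis
        unfolding case_prod_unfold by (intro borel_measurable_divide borel_measurable_const) simp
    qed
    have half: "\<bar>G2 y / 2\<bar> \<le> C" "\<bar>reflected_semigroup u G2 y / 2\<bar> \<le> C" for y u
      using C(2)[of y] reflected_semigroup_bound[where g = G2 and C = C and t = u and y = y, OF C(2)] C_nonneg by linarith+
    have "(LINT w:A|reflected_law x. I t w) - (LINT w:A|reflected_law x. I s w) = (LINT w:A|reflected_law x. I t w - I s w)"
      using iI[OF t0] iI[OF st(1)] by (rule set_integral_diff(2)[symmetric])
    also have "\<dots> = (LINT w:A|reflected_law x. (LBINT u:{0..t - s}. G2 (w (max 0 (s + u))) / 2))"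
      unfolding set_lebesgue_integral_def[of "reflected_law x"]
    proof (intro Bochner_Integration.integral_cong refl)
      fix w assume "w \<in> space (reflected_law x)"
      then have w: "w \<in> space reflected_paths" by simp
      have "I t w - I s w = (LBINT u:{0..t - s}. G2 (w (s + u)) / 2)"
        unfolding I_def by (rule set_integral_split_shift[OF st si[OF w]])
      also have "\<dots> = (LBINT u:{0..t - s}. G2 (w (max 0 (s + u))) / 2)"
        using st by (intro set_lebesgue_integral_cong) (auto simp: max_def)
      finally show "indicator A w *\<^sub>R (I t w - I s w) = indicator A w *\<^sub>R (LBINT u:{0..t - s}. G2 (w (max 0 (s + u))) / 2)" by simp
    qed
    also have "\<dots> = (LBINT u:{0..t - s}. (LINT w:A|reflected_law x. G2 (w (max 0 (s + u))) / 2))"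
      by (rule P.set_integral_swap_interval(1)[OF H1 half(1) A'])
    also have "\<dots> = (LBINT u:{0..t - s}. (LINT w:A|reflected_law x. reflected_semigroup u G2 (w s) / 2))"
    proof (rule set_lebesgue_integral_cong)
      show "\<forall>u. u \<in> {0..t - s} \<longrightarrow> (LINT w:A|reflected_law x. G2 (w (max 0 (s + u))) / 2) = (LINT w:A|reflected_law x. reflected_semigroup u G2 (w s) / 2)"
        using reflected_Markov[OF st(1) _ A Gm(2) C(2), of _ x] st(1) by (simp add: max_def)
    qed simp
    also have "\<dots> = (LINT w:A|reflected_law x. (LBINT u:{0..t - s}. reflected_semigroup u G2 (w s) / 2))"
      by (rule P.set_integral_swap_interval(1)[OF H2 half(2) A', symmetric])
    also have "\<dots> = (LINT w:A|reflected_law x. reflected_semigroup (t - s) G (w s) - G (w s))"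
      by (simp only: heat[OF ts])
    also have "\<dots> = (LINT w:A|reflected_law x. reflected_semigroup (t - s) G (w s)) - (LINT w:A|reflected_law x. G (w s))"
      by (rule set_integral_diff(2)[OF iR iG])
    also have "(LINT w:A|reflected_law x. reflected_semigroup (t - s) G (w s)) = (LINT w:A|reflected_law x. G (w t))"
      using reflected_Markov[OF st(1) ts A Gm(1) C(1), of x] by simp
    finally have "(LINT w:A|reflected_law x. G (w t)) - (LINT w:A|reflected_law x. I t w) =
        (LINT w:A|reflected_law x. G (w s)) - (LINT w:A|reflected_law x. I s w)" by simp
    moreover have "(LINT w:A|reflected_law x. Z u w) = (LINT w:A|reflected_law x. G (w u)) - (LINT w:A|reflected_law x. I u w)" if "0 \<le> u" for u
    proof -
      have "(LINT w:A|reflected_law x. Z u w) = (LINT w:A|reflected_law x. G (w u) - I u w)"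
        unfolding set_lebesgue_integral_def using Z_eq that by (intro Bochner_Integration.integral_cong) auto
      also have "\<dots> = (LINT w:A|reflected_law x. G (w u)) - (LINT w:A|reflected_law x. I u w)"
        by (rule set_integral_diff(2)[OF iG iI[OF that]])
      finally show ?thesis .
    qed
    ultimately show ?thesis using t0 st by simp
  qed
  have "AE w in reflected_law x. real_cond_exp (reflected_law x) (reflected_past s) (Z t) w = Z s w" if "0 \<le> s" "s \<le> t" for s t
  proof -
    have "finite_measure_subalgebra (reflected_law x) (reflected_past s)" by unfold_locales (rule sub)
    then interpret sf: sigma_finite_subalgebra "reflected_law x" "reflected_past s" by (rule finite_measure_subalgebra_is_sigma_finite)
    show ?thesis using that by (intro sf.real_cond_exp_charact key Z_int Z_meas) auto
  qed
  then have "martingale (reflected_law x) (natural_filtration (space reflected_paths) (\<lambda>t w. w t)) Z"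
    using Z_meas Z_int by (auto simp: martingale_def)
  then show ?thesis unfolding Z_def .
qed

theorem reflected_brownian_motion_reflected_law:
  "reflected_brownian_motion reflected_paths reflected_law (\<lambda>t w. w t)"
proof
  show "is_interval {0 :: real..}" "closed {0 :: real..}" "interior {0 :: real..} \<noteq> {}" "frontier {0 :: real..} \<noteq> {}"
    by (auto simp: is_interval_ci frontier_def)
  show "continuous_on {0 :: real..} (\<lambda>_. 0 :: real)" "continuous_on {0 :: real..} (\<lambda>_. 1 :: real)" by (intro continuous_on_const)+
  show "reflected_law \<in> restrict_space borel {0..} \<rightarrow>\<^sub>M prob_algebra reflected_paths" by (rule measurable_reflected_law)
  show "(\<lambda>w. w t) \<in> borel_measurable reflected_paths" for t by (rule measurable_reflected_coordinate)
  show "w t \<in> {0..}" if "0 \<le> t" "w \<in> space reflected_paths" for t w using that by (auto simp: space_reflected_paths)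
  show "continuous_on {0..} (\<lambda>t. w t)" if "w \<in> space reflected_paths" for w using that by (simp add: space_reflected_paths)
  show "AE w in reflected_law x. w 0 = x" if "x \<in> {0..}" for x
  proof -
    have "{w\<in>space reflected_paths. w 0 = x} \<in> sets reflected_paths" by measurable
    then show ?thesis unfolding reflected_law_def
      using that by (subst AE_distr_iff[OF measurable_reflected_path]) (auto simp: reflected_path_def W_0 intro!: AE_I2)
  qed
  show "AE w in reflected_law x. real_cond_exp (reflected_law x) (reflected_past s) (\<lambda>w'. g (w' (s + t))) w = (LINT w'|reflected_law (w s). g (w' t))"
    if x: "x \<in> {0..}" and s: "0 \<le> s" and t: "0 \<le> t" and g: "g \<in> borel_measurable borel" and b: "bounded (range g)" for x s t and g :: "real \<Rightarrow> real"
  proof -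
    obtain C where C: "\<And>y. \<bar>g y\<bar> \<le> C" using b by (auto simp: bounded_iff)
    interpret P: prob_space "reflected_law x" by (rule prob_space_reflected_law)
    have space_law [simp]: "space (reflected_law x) = space reflected_paths" by (rule sets_eq_imp_space_eq) simp
    have sub: "subalgebra (reflected_law x) (reflected_past s)" using reflected_past_subset by (simp add: subalgebra_def)
    have "finite_measure_subalgebra (reflected_law x) (reflected_past s)" by unfold_locales (rule sub)
    then interpret sf: sigma_finite_subalgebra "reflected_law x" "reflected_past s" by (rule finite_measure_subalgebra_is_sigma_finite)
    have ws: "(\<lambda>w. w u) \<in> borel_measurable (reflected_law x)" for u by (simp cong: measurable_cong_sets)
    have Rm: "reflected_semigroup t g \<in> borel_measurable borel"
      using measurable_Pair2[OF borel_measurable_reflected_semigroup[OF g], of t] by simp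
    have "AE w in reflected_law x. real_cond_exp (reflected_law x) (reflected_past s) (\<lambda>w'. g (w' (s + t))) w = reflected_semigroup t g (w s)"
    proof (rule sf.real_cond_exp_charact)
      show "(LINT w:A|reflected_law x. g (w (s + t))) = (LINT w:A|reflected_law x. reflected_semigroup t g (w s))" if "A \<in> sets (reflected_past s)" for A
        by (rule reflected_Markov[OF s t that g C])
      show "integrable (reflected_law x) (\<lambda>w. g (w (s + t)))"
        by (rule P.integrable_const_bound[where B = C]) (use C measurable_compose[OF ws g] in auto)
      show "integrable (reflected_law x) (\<lambda>w. reflected_semigroup t g (w s))"
        by (rule P.integrable_const_bound[where B = C]) (use reflected_semigroup_bound[of g C] C measurable_compose[OF ws Rm] in auto)
      have "(\<lambda>w. w s) \<in> borel_measurable (reflected_past s)"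
        using measurable_natural_filtration[of s s "\<lambda>t w. w t" "space reflected_paths"] s by simp
      then show "(\<lambda>w. reflected_semigroup t g (w s)) \<in> borel_measurable (reflected_past s)"
        by (rule measurable_compose[OF _ Rm])
    qed
    \<comment> \<open>The integral under the law restarted at \<open>w s\<close> is the semigroup
      evaluated at \<open>w s\<close>.\<close>
    then show ?thesis unfolding integral_reflected_coordinate[OF t g C] .
  qed
  show "martingale (reflected_law x) (natural_filtration (space reflected_paths) (\<lambda>t w. w t))
      (\<lambda>t w. f (w t) - (LBINT s:{0..t}. 1\<^sup>2 / 2 * f'' (w s) + 0 * f' (w s)))"
    if "x \<in> {0..}" "neumann_test_function {0..} f f' f''" for x f f' f''
    using that by (intro reflected_martingale) auto
qed simp

end

section \<open>The strict inequality\<close>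

theorem proposition4p1:
  fixes r b \<theta> :: real
    and N :: "'w measure" and P :: "real \<Rightarrow> 'w measure" and X :: "real \<Rightarrow> 'w \<Rightarrow> real"
  assumes "r > 0" and "b > 0" and \<theta>: "\<theta> = sqrt (2 * r)"
  shows
    "(\<exists>S \<mu> \<sigma> (N' :: (real \<Rightarrow> real) measure) P' X' C f.
        reflected_diffusion S \<mu> \<sigma> N' P' X' \<and>
        openin (top_of_set S) C \<and> C \<noteq> {} \<and>
        f \<in> borel_measurable borel \<and> bounded (range f) \<and> (\<forall>y. 0 \<le> f y) \<and>
        (\<forall>x\<in>C. killed_resolvent P' X' r (S - C) f x
                 < reflected_resolvent P' X' r (\<lambda>y. f y * indicator C y) x))
   \<and> (\<exists>(N' :: (real \<Rightarrow> real) measure) P' X'. reflected_brownian_motion N' P' X')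
   \<and> (reflected_brownian_motion N P X \<longrightarrow>
        (\<forall>x\<in>{0..<b}.
           reflected_resolvent P X r (\<lambda>y. indicator {0..<b} y * indicator {0..<b} y) x
               - killed_resolvent P X r {b..} (indicator {0..<b}) x
             = cosh (\<theta> * x) / r * ((1 - exp (- 2 * \<theta> * b)) / (2 * cosh (\<theta> * b))) \<and>
           cosh (\<theta> * x) / r * ((1 - exp (- 2 * \<theta> * b)) / (2 * cosh (\<theta> * b))) > 0))"
proof -
  have pos: "cosh (\<theta> * x) / r * ((1 - exp (- 2 * \<theta> * b)) / (2 * cosh (\<theta> * b))) > 0" for x
    using assms by simp
  \<comment> \<open>Stated for an arbitrary sample space, since it serves both the given process and
    the one constructed on path space.\<close>
  have eq: "reflected_resolvent Q Y r (\<lambda>y. indicator {0..<b} y * indicator {0..<b} y) x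
        - killed_resolvent Q Y r {b..} (indicator {0..<b}) x
      = cosh (\<theta> * x) / r * ((1 - exp (- 2 * \<theta> * b)) / (2 * cosh (\<theta> * b)))"
    if rbm: "reflected_brownian_motion L Q Y" and x: "x \<in> {0..<b}"
    for L :: "'v measure" and Q Y x
  proof -
    interpret reflected_brownian L Q Y using rbm by (simp add: reflected_brownian_def)
    have "(\<lambda>y. indicator {0..<b} y * indicator {0..<b} y) = (indicator {0..<b} :: real \<Rightarrow> real)"
      by (auto simp: indicator_def)
    then show ?thesis using resolvent_difference[OF assms, of x] x by simp
  qed
  obtain M :: "(real \<Rightarrow> real) measure" and W where "brownian_motion M W"
    using brownian_motion_exists by blast
  then have rbm: "reflected_brownian_motion reflected_paths (brownian_motion.reflected_law M W) (\<lambda>t w. w t)"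
    by (rule brownian_motion.reflected_brownian_motion_reflected_law)
  \<comment> \<open>[0,b) contains the reflecting boundary point and is open only relative to the
    state space, as the trace of an open half-line.\<close>
  have "openin (top_of_set {0..}) {0..<b}"
    by (rule openin_open[THEN iffD2], rule exI[of _ "{..<b}"]) auto
  moreover have "{0..} - {0..<b} = {b..}" using assms by auto
  moreover have "killed_resolvent (brownian_motion.reflected_law M W) (\<lambda>t w. w t) r {b..} (indicator {0..<b}) x
      < reflected_resolvent (brownian_motion.reflected_law M W) (\<lambda>t w. w t) r (\<lambda>y. indicator {0..<b} y * indicator {0..<b} y) x"
    if "x \<in> {0..<b}" for x
    using eq[OF rbm that] pos[of x] by simp
  moreover have "indicator {0..<b} \<in> borel_measurable borel" "bounded (range (indicator {0..<b} :: real \<Rightarrow> real))"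
    by (auto intro!: boundedI[where B = 1] simp: indicator_def)
  ultimately have ex: "\<exists>S \<mu> \<sigma> (N' :: (real \<Rightarrow> real) measure) P' X' C f.
        reflected_diffusion S \<mu> \<sigma> N' P' X' \<and>
        openin (top_of_set S) C \<and> C \<noteq> {} \<and>
        f \<in> borel_measurable borel \<and> bounded (range f) \<and> (\<forall>y. 0 \<le> f y) \<and>
        (\<forall>x\<in>C. killed_resolvent P' X' r (S - C) f x
                 < reflected_resolvent P' X' r (\<lambda>y. f y * indicator C y) x)"
    using rbm assms
    by (intro exI[of _ "{0..}"] exI[of _ "\<lambda>_. 0"] exI[of _ "\<lambda>_. 1"] exI[of _ reflected_paths]
        exI[of _ "brownian_motion.reflected_law M W"] exI[of _ "\<lambda>t w. w t"] exI[of _ "{0..<b}"]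
        exI[of _ "indicator {0..<b}"] conjI ballI allI) auto
  show ?thesis using ex rbm eq pos by (intro conjI impI ballI) blast+
qed

end
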